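(* Let $N\ge2$ and let $\mu^1,\dots,\mu^N$ be partitions. Then, as formal power series in $Q_1,\dots,Q_{N-1}$, $$\frac{\tilde K_{\mu^1\cdots\mu^N}(Q_1,\dots,Q_{N-1})}{\prod_{1\le k<l\le N}K_{(0)(0)}(Q_k\cdots Q_{l-1})}=\prod_{k=1}^N\mathcal{W}_{\mu^k}(q)\cdot\exp\left(\sum_{1\le k<l\le N}\sum_{n\ge1}\frac{(Q_k\cdots Q_{l-1})^n}{n}f_{\mu^k(\mu^l)^t}(q^n)\right)$$ $$=\prod_{k=1}^N\mathcal{W}_{\mu^k}(q)\prod_{1\le k<l\le N}\ \prod_{n\in\mathbb{Z}}\left(1-q^nQ_k\cdots Q_{l-1}\right)^{-C_n(\mu^k,(\mu^l)^t)}.$$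
   Context: A partition $\mu$ is a nonincreasing sequence $\mu_1\ge\mu_2\ge\cdots$ of nonnegative integers with finitely many nonzero terms; $l(\mu)$ is the number of nonzero terms, $|\mu|=\sum_i\mu_i$, $\mu^t$ the transposed partition, $(0)=\emptyset$ the empty partition, $\kappa_\mu=\sum_{i=1}^{l(\mu)}\mu_i(\mu_i-2i+1)$. Let $q$ be an indeterminate, $[m]=q^{m/2}-q^{-m/2}$. For a symmetric function $F$, $F(q^{\mu+\rho})$ denotes its evaluation at $x_i=q^{\mu_i-i+1/2}$, $i\ge1$, regarded as a rational function of $q^{1/2}$ (series converge for $|q|>1$; the power sums become $p_n=\sum_{i=1}^{l(\mu)}(q^{n(\mu_i-i+1/2)}-q^{n(-i+1/2)})+\frac{1}{q^{n/2}-q^{-n/2}}$). $s_\nu$ is the Schur function and $c^\mu_{\nu\rho}$ are the Littlewood–Richardson coefficients, $s_\nu s_\rho=\sum_\mu c^\mu_{\nu\rho}s_\mu$. Define $$\mathcal{W}_\mu=q^{\kappa_\mu/4}\prod_{1\le i<j\le l(\mu)}\frac{[\mu_i-\mu_j+j-i]}{[j-i]}\prod_{i=1}^{l(\mu)}\prod_{v=1}^{\mu_i}\frac{1}{[v-i+l(\mu)]},\qquad \mathcal{W}_{\mu\nu}=\mathcal{W}_\mu\, s_\nu(q^{\mu+\rho}),$$ and the topological vertex $$\mathcal{W}_{\mu^1\mu^2\mu^3}=\sum_{\rho^1,\rho^3}\left(\sum_\eta c^{\mu^1}_{\eta\rho^1}c^{(\mu^3)^t}_{\eta(\rho^3)^t}\right)q^{\kappa_{\mu^2}/2+\kappa_{\mu^3}/2}\frac{\mathcal{W}_{(\mu^2)^t\rho^1}\mathcal{W}_{\mu^2(\rho^3)^t}}{\mathcal{W}_{\mu^2\emptyset}}.$$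 Define $$K_{(0)(0)}(Q)=\sum_\nu Q^{|\nu|}\mathcal{W}_{(0)\nu}\mathcal{W}_{\nu(0)},\qquad \tilde K_{\mu^1\cdots\mu^N}(Q_1,\dots,Q_{N-1})=\sum_{\nu^1,\dots,\nu^{N-1}}\prod_{k=1}^N q^{\kappa_{\nu^k}/2}\,\mathcal{W}_{\nu^{k-1}\mu^k(\nu^k)^t}(q)\,Q_k^{|\nu^k|},$$ where the sum is over all partitions $\nu^1,\dots,\nu^{N-1}$, and $\nu^0=\nu^N=(0)$, $Q_N=1$. Define $f_{\lambda\mu}(q)=q\left(\sum_{i\ge1}q^{\lambda_i-i}\sum_{j\ge1}q^{\mu_j-j}-\sum_{i\ge1}q^{-i}\sum_{j\ge1}q^{-j}\right)$ (series summed for $|q|>1$), a Laurent polynomial in $q$ with integer coefficients $C_k(\lambda,\mu)$: $f_{\lambda\mu}(q)=\sum_{k\in\mathbb{Z}}C_k(\lambda,\mu)q^k$. *)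

theory Defs
  imports
    "HOL-Analysis.Infinite_Sum"
    "HOL-Computational_Algebra.Computational_Algebra"
    "HOL-Computational_Algebra.Field_as_Ring"
    "HOL-Library.Groups_Big_Fun"
begin

section \<open>Formal power series in several variables\<close>

text \<open>
  A monomial in the variables indexed by \<^typ>\<open>'v\<close> is a multiset of variables; a formal power series
  assigns a coefficient to every monomial. Infinitely many variables are allowed.
\<close>

typedef ('v, 'a) mfps = "UNIV :: ('v multiset \<Rightarrow> 'a) set"
  morphisms mcoeff Abs_mfps ..

setup_lifting type_definition_mfps

lemma mfps_eqI: "(\<And>M. mcoeff f M = mcoeff g M) \<Longrightarrow> f = g"
  by transfer auto

lemma mcoeff_Abs_mfps [simp]: "mcoeff (Abs_mfps f) = f"
  by (simp add: Abs_mfps_inverse)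

lemma finite_mset_splits: "finite {(A, B). A + B = (M :: 'v multiset)}"
proof (induction M)
  case empty
  then show ?case by simp
next
  case (add x M)
  let ?S = "{(A, B). A + B = M}"
  have "{(A, B). A + B = add_mset x M} \<subseteq>
      (\<lambda>(A, B). (add_mset x A, B)) ` ?S \<union> (\<lambda>(A, B). (A, add_mset x B)) ` ?S"
  proof
    fix p assume p: "p \<in> {(A, B). A + B = add_mset x M}"
    obtain A B where AB: "p = (A, B)" "A + B = add_mset x M" using p by auto
    have "x \<in># A + B" using AB by simp
    then consider "x \<in># A" | "x \<in># B" by auto
    then show "p \<in> (\<lambda>(A, B). (add_mset x A, B)) ` ?S \<union> (\<lambda>(A, B). (A, add_mset x B)) ` ?S"
    proof cases
      case 1
      then obtain A' where "A = add_mset x A'" by (meson mset_add)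
      with AB show ?thesis by (force simp: image_iff)
    next
      case 2
      then obtain B' where "B = add_mset x B'" by (meson mset_add)
      with AB show ?thesis by (force simp: image_iff)
    qed
  qed
  then show ?case by (rule finite_subset) (use add.IH in simp)
qed

instantiation mfps :: (type, comm_ring_1) comm_ring_1
begin

lift_definition zero_mfps :: "('a, 'b) mfps" is "\<lambda>_. 0" .
lift_definition one_mfps :: "('a, 'b) mfps" is "\<lambda>M. if M = {#} then 1 else 0" .
lift_definition plus_mfps :: "('a, 'b) mfps \<Rightarrow> ('a, 'b) mfps \<Rightarrow> ('a, 'b) mfps"
  is "\<lambda>f g M. f M + g M" .
lift_definition minus_mfps :: "('a, 'b) mfps \<Rightarrow> ('a, 'b) mfps \<Rightarrow> ('a, 'b) mfps"
  is "\<lambda>f g M. f M - g M" .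
lift_definition uminus_mfps :: "('a, 'b) mfps \<Rightarrow> ('a, 'b) mfps"
  is "\<lambda>f M. - f M" .
lift_definition times_mfps :: "('a, 'b) mfps \<Rightarrow> ('a, 'b) mfps \<Rightarrow> ('a, 'b) mfps"
  is "\<lambda>f g M. \<Sum>(A, B) | A + B = M. f A * g B" .

instance
proof
  fix f g h :: "('a, 'b) mfps"
  show "f * g * h = f * (g * h)"
  proof (transfer, rule ext)
    fix f g h :: "'a multiset \<Rightarrow> 'b" and M
    let ?S = "\<lambda>M :: 'a multiset. {(A, B). A + B = M}"
    have "(\<Sum>(P, C)\<in>?S M. (\<Sum>(A, B)\<in>?S P. f A * g B) * h C) =
        (\<Sum>p\<in>?S M. \<Sum>r\<in>?S (fst p). f (fst r) * g (snd r) * h (snd p))"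
      by (simp add: case_prod_unfold sum_distrib_right)
    also have "\<dots> = (\<Sum>(p, r)\<in>Sigma (?S M) (\<lambda>p. ?S (fst p)). f (fst r) * g (snd r) * h (snd p))"
      by (rule sum.Sigma) (auto simp: finite_mset_splits)
    also have "\<dots> = (\<Sum>(p, r)\<in>Sigma (?S M) (\<lambda>p. ?S (snd p)). f (fst p) * (g (fst r) * h (snd r)))"
      by (rule sum.reindex_bij_witness[of _
            "\<lambda>((A, R), (B, C)). ((A + B, C), (A, B))" "\<lambda>((P, C), (A, B)). ((A, B + C), (B, C))"])
         (auto simp: add.assoc mult.assoc)
    also have "\<dots> = (\<Sum>p\<in>?S M. \<Sum>r\<in>?S (snd p). f (fst p) * (g (fst r) * h (snd r)))"
      by (rule sum.Sigma [symmetric]) (auto simp: finite_mset_splits)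
    also have "\<dots> = (\<Sum>(A, R)\<in>?S M. f A * (\<Sum>(B, C)\<in>?S R. g B * h C))"
      by (simp add: case_prod_unfold sum_distrib_left)
    finally show "(\<Sum>(P, C)\<in>?S M. (\<Sum>(A, B)\<in>?S P. f A * g B) * h C) =
        (\<Sum>(A, R)\<in>?S M. f A * (\<Sum>(B, C)\<in>?S R. g B * h C))" .
  qed
  show "f * g = g * f"
  proof (transfer, rule ext)
    fix f g :: "'a multiset \<Rightarrow> 'b" and M
    show "(\<Sum>(A, B) | A + B = M. f A * g B) = (\<Sum>(A, B) | A + B = M. g A * f B)"
      by (rule sum.reindex_bij_witness[of _ prod.swap prod.swap])
         (auto simp: add.commute mult.commute)
  qed
  show "1 * f = f"
  proof (transfer, rule ext)
    fix f :: "'a multiset \<Rightarrow> 'b" and M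
    have "(\<Sum>(A, B) | A + B = M. (if A = {#} then 1 else 0) * f B) =
        (\<Sum>(A, B)\<in>{({#} :: 'a multiset, M)}. (if A = {#} then 1 else 0) * f B)"
      by (rule sum.mono_neutral_right) (auto simp: finite_mset_splits split: if_splits)
    then show "(\<Sum>(A, B) | A + B = M. (if A = {#} then 1 else 0) * f B) = f M"
      by simp
  qed
  show "(f + g) * h = f * h + g * h"
    by transfer (auto simp: case_prod_unfold distrib_right sum.distrib)
  show "(0 :: ('a, 'b) mfps) \<noteq> 1"
    by transfer (metis zero_neq_one)
qed (transfer; auto simp: algebra_simps)+

end

instantiation mfps :: (type, comm_ring_1) inverse
begin

text \<open>The multiplicative inverse of a unit; 0 for non-units.\<close>

definition inverse_mfps :: "('a, 'b) mfps \<Rightarrow> ('a, 'b) mfps" where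
  "inverse_mfps f = (if f dvd 1 then (THE g. f * g = 1) else 0)"

definition divide_mfps :: "('a, 'b) mfps \<Rightarrow> ('a, 'b) mfps \<Rightarrow> ('a, 'b) mfps" where
  "divide_mfps f g = f * inverse g"

instance ..

end

definition mconst :: "'a \<Rightarrow> ('v, 'a::comm_ring_1) mfps" where
  "mconst c = Abs_mfps (\<lambda>M. if M = {#} then c else 0)"

definition mvar :: "'v \<Rightarrow> ('v, 'a::comm_ring_1) mfps" where
  "mvar v = Abs_mfps (\<lambda>M. if M = {#v#} then 1 else 0)"

text \<open>
  Sum of a family of formal power series, taken coefficientwise. It is used only for families in
  which every monomial has nonzero coefficient in finitely many members.
\<close>

definition msum :: "('i \<Rightarrow> ('v, 'a::comm_ring_1) mfps) \<Rightarrow> 'i set \<Rightarrow> ('v, 'a) mfps" where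
  "msum F I = Abs_mfps (\<lambda>M. \<Sum>i | i \<in> I \<and> mcoeff (F i) M \<noteq> 0. mcoeff (F i) M)"

definition mexp :: "('v, 'a::field) mfps \<Rightarrow> ('v, 'a) mfps" where
  "mexp F = msum (\<lambda>n. mconst (1 / of_nat (fact n)) * F ^ n) UNIV"


section \<open>Partitions\<close>

typedef partition = "{\<mu> :: nat \<Rightarrow> nat. antimono \<mu> \<and> finite {i. \<mu> i \<noteq> 0}}"
  morphisms parts_of Abs_partition
  by (rule exI[of _ "\<lambda>_. 0"]) (simp add: antimono_def)

setup_lifting type_definition_partition

text \<open>The representing function is indexed from 0; \<open>part \<mu> i\<close> is $\mu_i$, for $i \ge 1$.\<close>

definition part :: "partition \<Rightarrow> nat \<Rightarrow> nat" where
  "part \<mu> i = parts_of \<mu> (i - 1)"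

definition plen :: "partition \<Rightarrow> nat" where
  "plen \<mu> = card {i. 1 \<le> i \<and> part \<mu> i \<noteq> 0}"

definition psize :: "partition \<Rightarrow> nat" where
  "psize \<mu> = (\<Sum>i=1..plen \<mu>. part \<mu> i)"

lift_definition empty_partition :: partition is "\<lambda>_. 0"
  by (simp add: antimono_def)

lift_definition conjugate :: "partition \<Rightarrow> partition" is "\<lambda>\<mu> j. card {i. j < \<mu> i}"
proof
  fix \<mu> :: "nat \<Rightarrow> nat"
  assume "antimono \<mu> \<and> finite {i. \<mu> i \<noteq> 0}"
  then have anti: "antimono \<mu>" and fin: "finite {i. \<mu> i \<noteq> 0}" by auto
  have fin': "finite {i. j < \<mu> i}" for j
    by (rule finite_subset[OF _ fin]) auto
  show "antimono (\<lambda>j. card {i. j < \<mu> i})"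
    by (intro antimonoI card_mono fin') auto
  have "{j. card {i. j < \<mu> i} \<noteq> 0} \<subseteq> {..<\<mu> 0}"
  proof
    fix j assume "j \<in> {j. card {i. j < \<mu> i} \<noteq> 0}"
    then obtain i where "j < \<mu> i" by (auto simp: card_eq_0_iff)
    also have "\<mu> i \<le> \<mu> 0" using anti by (auto simp: antimono_def)
    finally show "j \<in> {..<\<mu> 0}" by simp
  qed
  then show "finite {j. card {i. j < \<mu> i} \<noteq> 0}"
    by (rule finite_subset) simp
qed

definition kappa :: "partition \<Rightarrow> int" where
  "kappa \<mu> = (\<Sum>i=1..plen \<mu>. int (part \<mu> i) * (int (part \<mu> i) - 2 * int i + 1))"

lemma even_kappa: "even (kappa \<mu>)"
  unfolding kappa_def by (intro dvd_sum) auto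


section \<open>Schur functions and Littlewood--Richardson coefficients\<close>

text \<open>Symmetric functions are series in the variables $x_1, x_2, \dots$; the index 0 is not used.\<close>

definition diagram :: "partition \<Rightarrow> (nat \<times> nat) set" where
  "diagram \<mu> = {(i, j). 1 \<le> i \<and> 1 \<le> j \<and> j \<le> part \<mu> i}"

text \<open>Tableaux are 0 outside the diagram, so that each tableau is one function.\<close>

definition semistandard :: "partition \<Rightarrow> (nat \<times> nat \<Rightarrow> nat) \<Rightarrow> bool" where
  "semistandard \<mu> T \<longleftrightarrow>
     (\<forall>c. c \<in> diagram \<mu> \<longleftrightarrow> 1 \<le> T c) \<and>
     (\<forall>i j. (i, j) \<in> diagram \<mu> \<and> (i, j + 1) \<in> diagram \<mu> \<longrightarrow> T (i, j) \<le> T (i, j + 1)) \<and>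
     (\<forall>i j. (i, j) \<in> diagram \<mu> \<and> (i + 1, j) \<in> diagram \<mu> \<longrightarrow> T (i, j) < T (i + 1, j))"

definition schur :: "partition \<Rightarrow> (nat, int) mfps" where
  "schur \<mu> = Abs_mfps (\<lambda>M.
     int (card {T. semistandard \<mu> T \<and> image_mset T (mset_set (diagram \<mu>)) = M}))"

text \<open>\<open>lr \<mu> \<nu> \<rho>\<close> is $c^\mu_{\nu\rho}$.\<close>

definition lr :: "partition \<Rightarrow> partition \<Rightarrow> partition \<Rightarrow> int" where
  "lr \<mu> \<nu> \<rho> = (THE c. finite {\<alpha>. c \<alpha> \<noteq> 0} \<and>
     schur \<nu> * schur \<rho> = (\<Sum>\<alpha> | c \<alpha> \<noteq> 0. mconst (c \<alpha>) * schur \<alpha>)) \<mu>"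


section \<open>Rational functions of $q^{1/2}$ and evaluation at $q^{\mu+\rho}$\<close>

type_synonym qrat = "rat poly fract"

text \<open>The indeterminate $q^{1/2}$; thus $q^{k/2}$ is \<open>qhalf powi k\<close>.\<close>

definition qhalf :: qrat where
  "qhalf = Fract [:0, 1:] 1"

definition qbr :: "int \<Rightarrow> qrat" where
  "qbr m = qhalf powi m - qhalf powi (- m)"

text \<open>
  Series in $q^{1/2}$ that are summed for $|q| > 1$ are formal Laurent series in $q^{-1/2}$, which is
  the variable of all \<^typ>\<open>'a fls\<close> below; \<open>qhalf_fls k\<close> is $q^{k/2}$. Infinite sums of
  formal Laurent series are taken in the metric topology of \<^typ>\<open>'a fls\<close>.
\<close>

definition qhalf_fls :: "int \<Rightarrow> 'a::comm_ring_1 fls" where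
  "qhalf_fls k = fls_X_intpow (- k)"

text \<open>The Laurent expansion of a rational function at $q^{1/2} = \infty$.\<close>

definition expand_inf :: "qrat \<Rightarrow> rat fls" where
  "expand_inf R = (case quot_of_fract R of (a, b) \<Rightarrow>
     poly (map_poly fls_const a) (qhalf_fls 1) / poly (map_poly fls_const b) (qhalf_fls 1))"

text \<open>
  $F(q^{\mu+\rho})$: the rational function whose expansion is the value of $F$ at
  $x_i = q^{\mu_i - i + 1/2}$, $i \ge 1$.
\<close>

definition eval_rho :: "(nat, int) mfps \<Rightarrow> partition \<Rightarrow> qrat" where
  "eval_rho F \<mu> = (THE R.
     ((\<lambda>M. of_int (mcoeff F M) *
         (\<Prod>i\<in>#M. qhalf_fls (2 * int (part \<mu> i) - 2 * int i + 1)))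
       has_sum expand_inf R) {M. 0 \<notin># M})"


section \<open>The topological vertex\<close>

definition W1 :: "partition \<Rightarrow> qrat" where
  "W1 \<mu> = qhalf powi (kappa \<mu> div 2) *
     (\<Prod>(i, j) | 1 \<le> i \<and> i < j \<and> j \<le> plen \<mu>.
        qbr (int (part \<mu> i) - int (part \<mu> j) + int j - int i) / qbr (int j - int i)) *
     (\<Prod>i=1..plen \<mu>. \<Prod>v=1..part \<mu> i. 1 / qbr (int v - int i + int (plen \<mu>)))"

definition W2 :: "partition \<Rightarrow> partition \<Rightarrow> qrat" where
  "W2 \<mu> \<nu> = W1 \<mu> * eval_rho (schur \<nu>) \<mu>"

definition W3 :: "partition \<Rightarrow> partition \<Rightarrow> partition \<Rightarrow> qrat" where
  "W3 \<mu>1 \<mu>2 \<mu>3 = Sum_any (\<lambda>(\<rho>1, \<rho>3).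
     of_int (Sum_any (\<lambda>\<eta>. lr \<mu>1 \<eta> \<rho>1 * lr (conjugate \<mu>3) \<eta> (conjugate \<rho>3))) *
     qhalf powi (kappa \<mu>2 + kappa \<mu>3) *
     (W2 (conjugate \<mu>2) \<rho>1 * W2 \<mu>2 (conjugate \<rho>3) / W2 \<mu>2 empty_partition))"

text \<open>
  \<open>K00 x\<close> is $K_{(0)(0)}$ with the series \<open>x\<close>, which must have constant term 0, substituted for $Q$.
\<close>

definition K00 :: "(nat, qrat) mfps \<Rightarrow> (nat, qrat) mfps" where
  "K00 x = msum (\<lambda>\<nu>. x ^ psize \<nu> *
     mconst (W2 empty_partition \<nu> * W2 \<nu> empty_partition)) UNIV"

text \<open>
  The variable $Q_k$ is \<open>mvar k\<close>. Families $\nu^1, \dots, \nu^{N-1}$ are functions that are empty at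
  every other index, in particular at 0 and $N$.
\<close>

definition Ktilde :: "nat \<Rightarrow> (nat \<Rightarrow> partition) \<Rightarrow> (nat, qrat) mfps" where
  "Ktilde N \<mu> = msum (\<lambda>\<nu>. \<Prod>k=1..N.
       mconst (qhalf powi kappa (\<nu> k) * W3 (\<nu> (k - 1)) (\<mu> k) (conjugate (\<nu> k))) *
       (if k = N then 1 else mvar k) ^ psize (\<nu> k))
     {\<nu>. \<forall>k. k \<notin> {1..<N} \<longrightarrow> \<nu> k = empty_partition}"

definition Qprod :: "nat \<Rightarrow> nat \<Rightarrow> (nat, qrat) mfps" where
  "Qprod k l = (\<Prod>j=k..<l. mvar j)"


section \<open>The Laurent polynomials $f_{\alpha\mu}$\<close>

definition f_series :: "partition \<Rightarrow> partition \<Rightarrow> int fls" where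
  "f_series \<alpha> \<mu> = qhalf_fls 2 *
     ((\<Sum>\<^sub>\<infinity>i\<in>{1..}. qhalf_fls (2 * (int (part \<alpha> i) - int i))) *
      (\<Sum>\<^sub>\<infinity>j\<in>{1..}. qhalf_fls (2 * (int (part \<mu> j) - int j))) -
      (\<Sum>\<^sub>\<infinity>i\<in>{1::nat..}. qhalf_fls (2 * (- int i))) *
      (\<Sum>\<^sub>\<infinity>j\<in>{1::nat..}. qhalf_fls (2 * (- int j))))"

text \<open>The coefficient $C_k(\alpha,\mu)$ of $q^k$, that is, of $(q^{-1/2})^{-2k}$.\<close>

definition f_coeff :: "int \<Rightarrow> partition \<Rightarrow> partition \<Rightarrow> int" where
  "f_coeff k \<alpha> \<mu> = fls_nth (f_series \<alpha> \<mu>) (- 2 * k)"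

text \<open>$f_{\alpha\mu}(q^n)$\<close>

definition f_at :: "partition \<Rightarrow> partition \<Rightarrow> nat \<Rightarrow> qrat" where
  "f_at \<alpha> \<mu> n = Sum_any (\<lambda>k. of_int (f_coeff k \<alpha> \<mu>) * qhalf powi (2 * int n * k))"

end

theory Submission
  imports "Jordan_Normal_Form.Determinant" "HOL-Library.Function_Algebras" Defs
begin

text \<open>
  For a partition \<open>\<alpha>\<close> write $e_\alpha(\nu) = s_\nu(q^{\alpha+\rho})$. The proof reads the chain of
  vertices as a product of transfer operators, in the manner of a Schur process.

  The powers of $q$ in $q^{\kappa_\nu/2} \mathcal{W}_{\kappa\mu\nu^t}$ cancel, because
  $\mathcal{W}_{\mu^t} = q^{-\kappa_\mu/2}\mathcal{W}_\mu$; what is left is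
  $\mathcal{W}_\mu \sum_{\eta,\rho,\sigma} c^\kappa_{\eta\rho} c^\nu_{\eta\sigma} e_{\mu^t}(\rho) e_\mu(\sigma)$
  (\<open>W3_vertex_sum\<close>). Suppose that the amplitudes $T_\kappa$ with which the partition \<open>\<kappa>\<close> enters the
  vertex multiply like Schur functions, $T_\eta T_\rho = \sum_\nu c^\nu_{\eta\rho} T_\nu$; this is the
  predicate \<open>schur_hom\<close>. Then the sum over \<open>\<kappa>\<close> factorizes: it is the scalar
  $\sum_\rho T_\rho e_{\mu^t}(\rho)$ times the convolution of $T$ and $e_\mu$ along the
  Littlewood-Richardson coefficients (\<open>vertex_transfer\<close>). The convolution of two multiplicative
  functionals is again multiplicative (\<open>schur_hom_conv\<close>; it is evaluation at the union of two
  alphabets), and so is its rescaling by $Q^{|\nu|}$. Hence the hypothesis propagates along the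
  chain. After the last vertex only the amplitude of the empty partition remains, which is 1, and
  $\tilde K$ is the product of the $\mathcal{W}_{\mu^k}$ and of the scalars that were split off.
  By the same principle each of these scalars is a product of Cauchy sums
  $\sum_\rho (Q_k \cdots Q_{l-1})^{|\rho|} e_{\mu^k}(\rho) e_{(\mu^l)^t}(\rho)$ (\<open>conv_cauchy\<close>,
  \<open>transfer_cauchy\<close>, \<open>Ktilde_kernel_product\<close>).

  A Cauchy sum with parameter $w$ equals $\exp \sum_n p_n(q^{\alpha+\rho}) p_n(q^{\beta+\rho}) w^n / n$
  (\<open>newton_cauchy_eval_rho\<close>, \<open>cauchy_mexp\<close>). For two empty partitions it is $K_{(0)(0)}(w)$, because
  $\mathcal{W}_\nu = s_\nu(q^\rho)$ (\<open>W1_eq_eval_rho\<close>). In the quotient the exponents subtract, and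
  $p_n(q^{\alpha+\rho}) p_n(q^{\beta+\rho}) - p_n(q^\rho)^2 = f_{\alpha\beta}(q^n)$
  (\<open>f_at_eq_power_rho\<close>). This is the exponential formula, and as $f_{\alpha\beta}$ is a Laurent
  polynomial with integer coefficients, $\exp \sum_n (q^k w)^n / n = (1 - q^k w)^{-1}$ turns it into
  the product formula.

  Apart from homogeneity, only two rules on Schur functions are needed, and both concern horizontal strips: the
  branching rule, which peels off the last variable of a tableau, and the Pieri rule, which is
  derived from it by commuting the two operations (\<open>pieri_commute\<close>). Values at the infinite
  alphabets $q^{\alpha+\rho}$ are $q$-adic limits of values at finite alphabets.
\<close>

section \<open>Partitions and horizontal strips\<close>

lemma parts_of_antimono: "i \<le> j \<Longrightarrow> parts_of \<mu> j \<le> parts_of \<mu> i"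
  using parts_of[of \<mu>] by (auto simp: antimono_def)

lemma finite_parts_of: "finite {i. parts_of \<mu> i \<noteq> 0}"
  using parts_of[of \<mu>] by auto

lemma partition_eqI: "(\<And>i. parts_of \<mu> i = parts_of \<nu> i) \<Longrightarrow> \<mu> = \<nu>"
  by (metis parts_of_inject ext)

lemma parts_of_Abs:
  assumes "\<And>i. f (Suc i) \<le> f i" and "\<And>i. n \<le> i \<Longrightarrow> f i = 0"
  shows "parts_of (Abs_partition f) = f"
proof (rule Abs_partition_inverse)
  have "antimono f"
    using assms(1) by (rule decseq_SucI)
  moreover have "i < n" if "f i \<noteq> 0" for i
    using that assms(2)[of i] by (cases "n \<le> i") auto
  then have "{i. f i \<noteq> 0} \<subseteq> {..<n}" by auto
  then have "finite {i. f i \<noteq> 0}" by (rule finite_subset) simp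
  ultimately show "f \<in> {\<mu>. antimono \<mu> \<and> finite {i. \<mu> i \<noteq> 0}}" by simp
qed

lemma parts_of_empty [simp]: "parts_of empty_partition i = 0"
  by transfer simp

lemma parts_of_eq_0_iff: "parts_of \<mu> i = 0 \<longleftrightarrow> plen \<mu> \<le> i"
proof -
  obtain n where n: "parts_of \<mu> n = 0"
  proof -
    have "{i. parts_of \<mu> i \<noteq> 0} \<noteq> UNIV" using finite_parts_of[of \<mu>] by (metis infinite_UNIV_nat)
    then show ?thesis using that by auto
  qed
  define l where "l = (LEAST n. parts_of \<mu> n = 0)"
  have l0: "parts_of \<mu> l = 0" unfolding l_def by (rule LeastI[of _ n]) (rule n)
  have ll: "parts_of \<mu> i \<noteq> 0 \<longleftrightarrow> i < l" for i
  proof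
    assume "parts_of \<mu> i \<noteq> 0"
    then show "i < l" using parts_of_antimono[of l i \<mu>] l0 by (metis le_zero_eq not_le)
  next
    assume "i < l" then show "parts_of \<mu> i \<noteq> 0" unfolding l_def by (rule not_less_Least)
  qed
  have "1 \<le> i \<and> part \<mu> i \<noteq> 0 \<longleftrightarrow> i \<in> {1..l}" for i
    using ll[of "i - 1"] by (cases i) (auto simp: part_def)
  then have "{i. 1 \<le> i \<and> part \<mu> i \<noteq> 0} = {1..l}" by blast
  then have "plen \<mu> = l" by (simp add: plen_def)
  then show ?thesis using ll[of i] by auto
qed

lemma psize_sum:
  assumes "plen \<mu> \<le> n"
  shows "psize \<mu> = (\<Sum>i<n. parts_of \<mu> i)"
proof -
  have "psize \<mu> = (\<Sum>i<plen \<mu>. parts_of \<mu> i)"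
    unfolding psize_def part_def
    by (rule sum.reindex_bij_witness[of _ Suc "\<lambda>i. i - 1"]) auto
  also have "\<dots> = (\<Sum>i<n. parts_of \<mu> i)"
    by (rule sum.mono_neutral_left) (use assms parts_of_eq_0_iff in auto)
  finally show ?thesis .
qed

lemma psize_empty [simp]: "psize empty_partition = 0"
  by (simp add: psize_def part_def)

lemma parts_of_le_psize: "parts_of \<mu> i \<le> psize \<mu>"
proof -
  have "psize \<mu> = (\<Sum>j<max (plen \<mu>) (Suc i). parts_of \<mu> j)" by (rule psize_sum) simp
  also have "parts_of \<mu> i \<le> \<dots>" by (rule member_le_sum) auto
  finally show ?thesis .
qed

lemma plen_le_psize: "plen \<mu> \<le> psize \<mu>"
proof -
  have "1 \<le> parts_of \<mu> i" if "i < plen \<mu>" for i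
    using that parts_of_eq_0_iff[of \<mu> i] by linarith
  then have "(\<Sum>i<plen \<mu>. 1) \<le> (\<Sum>i<plen \<mu>. parts_of \<mu> i)"
    by (intro sum_mono) auto
  then show ?thesis by (simp add: psize_sum[of \<mu> "plen \<mu>"])
qed

lemma psize_eq_0_iff: "psize \<mu> = 0 \<longleftrightarrow> \<mu> = empty_partition"
proof
  assume "psize \<mu> = 0"
  then show "\<mu> = empty_partition"
    by (intro partition_eqI) (metis parts_of_le_psize le_zero_eq parts_of_empty)
qed simp

lemma finite_psize_le: "finite {\<mu>. psize \<mu> \<le> n}"
proof -
  have "finite {f. \<forall>x. (x \<in> {..<n} \<longrightarrow> f x \<in> {..n}) \<and> (x \<notin> {..<n} \<longrightarrow> f x = (0::nat))}"
    by (rule finite_set_of_finite_funs) auto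
  moreover have "parts_of ` {\<mu>. psize \<mu> \<le> n} \<subseteq>
      {f. \<forall>x. (x \<in> {..<n} \<longrightarrow> f x \<in> {..n}) \<and> (x \<notin> {..<n} \<longrightarrow> f x = (0::nat))}"
  proof clarify
    fix \<mu> x assume "psize \<mu> \<le> n"
    then show "(x \<in> {..<n} \<longrightarrow> parts_of \<mu> x \<in> {..n}) \<and> (x \<notin> {..<n} \<longrightarrow> parts_of \<mu> x = 0)"
      using parts_of_le_psize[of \<mu> x] plen_le_psize[of \<mu>] parts_of_eq_0_iff[of \<mu> x] by auto
  qed
  ultimately have "finite (parts_of ` {\<mu>. psize \<mu> \<le> n})" by (rule finite_subset[rotated])
  then show ?thesis by (rule finite_imageD) (auto simp: inj_on_def parts_of_inject)
qed

lemma finite_psize_eq: "finite {\<mu>. psize \<mu> = n}"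
  by (rule finite_subset[OF _ finite_psize_le[of n]]) auto

text \<open>
  The rows of \<open>\<nu>\<close> and \<open>\<kappa>\<close> interlace; equivalently, the skew diagram of \<open>\<nu>\<close> over \<open>\<kappa>\<close> is a
  horizontal strip, with at most one cell in each column.
\<close>

definition hstrip :: "partition \<Rightarrow> partition \<Rightarrow> bool" where
  "hstrip \<nu> \<kappa> \<longleftrightarrow> (\<forall>i. parts_of \<kappa> i \<le> parts_of \<nu> i \<and> parts_of \<nu> (Suc i) \<le> parts_of \<kappa> i)"

definition pieri_up :: "nat \<Rightarrow> partition \<Rightarrow> partition set" where
  "pieri_up r \<kappa> = {\<nu>. hstrip \<nu> \<kappa> \<and> psize \<nu> = psize \<kappa> + r}"

definition pieri_down :: "nat \<Rightarrow> partition \<Rightarrow> partition set" where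
  "pieri_down r \<nu> = {\<kappa>. hstrip \<nu> \<kappa> \<and> psize \<nu> = psize \<kappa> + r}"

lemma pieri_up_down: "\<nu> \<in> pieri_up r \<kappa> \<longleftrightarrow> \<kappa> \<in> pieri_down r \<nu>"
  by (simp add: pieri_up_def pieri_down_def)

lemma finite_pieri_up [simp]: "finite (pieri_up r \<kappa>)"
  by (rule finite_subset[OF _ finite_psize_eq[of "psize \<kappa> + r"]]) (auto simp: pieri_up_def)

lemma finite_pieri_down [simp]: "finite (pieri_down r \<kappa>)"
  by (rule finite_subset[OF _ finite_psize_le[of "psize \<kappa>"]]) (auto simp: pieri_down_def)

lemma hstrip_plen:
  assumes "hstrip \<nu> \<kappa>"
  shows "plen \<nu> \<le> Suc (plen \<kappa>)" "plen \<kappa> \<le> plen \<nu>"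
proof -
  have "parts_of \<nu> (Suc (plen \<kappa>)) \<le> parts_of \<kappa> (plen \<kappa>)" "parts_of \<kappa> (plen \<nu>) \<le> parts_of \<nu> (plen \<nu>)"
    using assms by (auto simp: hstrip_def)
  moreover have "parts_of \<kappa> (plen \<kappa>) = 0" "parts_of \<nu> (plen \<nu>) = 0"
    by (simp_all add: parts_of_eq_0_iff)
  ultimately show "plen \<nu> \<le> Suc (plen \<kappa>)" "plen \<kappa> \<le> plen \<nu>"
    by (simp_all add: parts_of_eq_0_iff)
qed

lemma hstrip_psize_le: "hstrip \<nu> \<kappa> \<Longrightarrow> psize \<kappa> \<le> psize \<nu>"
  using hstrip_plen[of \<nu> \<kappa>] psize_sum[of \<nu> "plen \<nu>"] psize_sum[of \<kappa> "plen \<nu>"]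
  by (auto simp: hstrip_def intro!: sum_mono)

text \<open>
  The two maps that commute adding a strip with removing one. Fix \<open>\<kappa>\<close> and \<open>\<theta>\<close>, and count rows from 0. A partition
  \<open>\<eta>\<close> lies a strip below both exactly if its row $i$ is in the interval from
  $\max(\kappa_{i+1}, \theta_{i+1})$ to $\min(\kappa_i, \theta_i)$, and a partition \<open>\<nu>\<close> lies a strip
  above both exactly if its row $i + 1$ is in the same interval and its first row is at least
  $\max(\kappa_0, \theta_0)$. Reflecting each interval in its centre exchanges the two kinds; the excess
  of the first row of \<open>\<nu>\<close> is the additional number \<open>j\<close>.
\<close>

definition toggle :: "partition \<Rightarrow> partition \<Rightarrow> nat \<times> partition \<Rightarrow> partition" where
  "toggle \<kappa> \<theta> = (\<lambda>(j, \<eta>). Abs_partition (\<lambda>i. case i of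
     0 \<Rightarrow> max (parts_of \<kappa> 0) (parts_of \<theta> 0) + j
   | Suc i \<Rightarrow> max (parts_of \<kappa> (Suc i)) (parts_of \<theta> (Suc i)) +
       min (parts_of \<kappa> i) (parts_of \<theta> i) - parts_of \<eta> i))"

definition untoggle :: "partition \<Rightarrow> partition \<Rightarrow> partition \<Rightarrow> nat \<times> partition" where
  "untoggle \<kappa> \<theta> \<nu> = (parts_of \<nu> 0 - max (parts_of \<kappa> 0) (parts_of \<theta> 0),
     Abs_partition (\<lambda>i. max (parts_of \<kappa> (Suc i)) (parts_of \<theta> (Suc i)) +
       min (parts_of \<kappa> i) (parts_of \<theta> i) - parts_of \<nu> (Suc i)))"

context
  fixes \<kappa> \<theta> :: partition
begin

private abbreviation mx where "mx i \<equiv> max (parts_of \<kappa> i) (parts_of \<theta> i)"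
private abbreviation mn where "mn i \<equiv> min (parts_of \<kappa> i) (parts_of \<theta> i)"

lemma hstrip_both_up:
  "hstrip \<nu> \<kappa> \<and> hstrip \<nu> \<theta> \<longleftrightarrow> (\<forall>i. mx i \<le> parts_of \<nu> i \<and> parts_of \<nu> (Suc i) \<le> mn i)"
  by (auto simp: hstrip_def)

lemma hstrip_both_down:
  "hstrip \<kappa> \<eta> \<and> hstrip \<theta> \<eta> \<longleftrightarrow> (\<forall>i. mx (Suc i) \<le> parts_of \<eta> i \<and> parts_of \<eta> i \<le> mn i)"
  by (auto simp: hstrip_def)

lemma parts_of_toggle:
  assumes "hstrip \<kappa> \<eta>" "hstrip \<theta> \<eta>"
  shows "parts_of (toggle \<kappa> \<theta> (j, \<eta>)) 0 = mx 0 + j"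
    and "parts_of (toggle \<kappa> \<theta> (j, \<eta>)) (Suc i) = mx (Suc i) + mn i - parts_of \<eta> i"
proof -
  have h: "mx (Suc i) \<le> parts_of \<eta> i" "parts_of \<eta> i \<le> mn i" for i
    using assms hstrip_both_down by auto
  let ?f = "\<lambda>i. case i of 0 \<Rightarrow> mx 0 + j | Suc i \<Rightarrow> mx (Suc i) + mn i - parts_of \<eta> i"
  have "parts_of (toggle \<kappa> \<theta> (j, \<eta>)) = ?f"
    unfolding toggle_def prod.case
  proof (rule parts_of_Abs[where n = "Suc (max (plen \<kappa>) (plen \<theta>))"])
    fix i show "?f (Suc i) \<le> ?f i"
    proof (cases i)
      case 0 then show ?thesis using h[of 0] by auto
    next
      case (Suc k)
      have "mx (Suc i) + mn i - parts_of \<eta> i \<le> mn i" using h[of i] by auto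
      also have "\<dots> \<le> mx i" by simp
      also have "\<dots> \<le> mx i + mn k - parts_of \<eta> k" using h[of k] by auto
      finally show ?thesis using Suc by simp
    qed
  next
    fix i assume "Suc (max (plen \<kappa>) (plen \<theta>)) \<le> i"
    then obtain k where k: "i = Suc k" "max (plen \<kappa>) (plen \<theta>) \<le> k" by (cases i) auto
    have "parts_of \<kappa> k = 0" "parts_of \<theta> k = 0" "parts_of \<kappa> (Suc k) = 0" "parts_of \<theta> (Suc k) = 0"
      using k by (auto simp: parts_of_eq_0_iff)
    then show "?f i = 0" using k by simp
  qed
  then show "parts_of (toggle \<kappa> \<theta> (j, \<eta>)) 0 = mx 0 + j"
    "parts_of (toggle \<kappa> \<theta> (j, \<eta>)) (Suc i) = mx (Suc i) + mn i - parts_of \<eta> i" by auto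
qed

lemma parts_of_untoggle:
  assumes "hstrip \<nu> \<kappa>" "hstrip \<nu> \<theta>"
  shows "parts_of (snd (untoggle \<kappa> \<theta> \<nu>)) i = mx (Suc i) + mn i - parts_of \<nu> (Suc i)"
proof -
  have h: "mx i \<le> parts_of \<nu> i" "parts_of \<nu> (Suc i) \<le> mn i" for i
    using assms hstrip_both_up by auto
  have "parts_of (snd (untoggle \<kappa> \<theta> \<nu>)) = (\<lambda>i. mx (Suc i) + mn i - parts_of \<nu> (Suc i))"
    unfolding untoggle_def snd_conv
  proof (rule parts_of_Abs[where n = "max (plen \<kappa>) (plen \<theta>)"])
    fix i
    have "mx (Suc (Suc i)) + mn (Suc i) - parts_of \<nu> (Suc (Suc i)) \<le> mn (Suc i)"
      using h(1)[of "Suc (Suc i)"] by auto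
    also have "\<dots> \<le> mx (Suc i)" by simp
    also have "\<dots> \<le> mx (Suc i) + mn i - parts_of \<nu> (Suc i)" using h(2)[of i] by auto
    finally show "mx (Suc (Suc i)) + mn (Suc i) - parts_of \<nu> (Suc (Suc i)) \<le> \<dots>" .
  next
    fix k assume k: "max (plen \<kappa>) (plen \<theta>) \<le> k"
    have "parts_of \<kappa> k = 0" "parts_of \<theta> k = 0" "parts_of \<kappa> (Suc k) = 0" "parts_of \<theta> (Suc k) = 0"
      using k by (auto simp: parts_of_eq_0_iff)
    then show "mx (Suc k) + mn k - parts_of \<nu> (Suc k) = 0" by simp
  qed
  then show ?thesis by simp
qed

text \<open>
  In the statement on sizes the reflections contribute the sum of all interval ends, and the maximum
  and the minimum of two rows add up to the two rows.
\<close>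

lemma toggle_hstrip:
  assumes "hstrip \<kappa> \<eta>" "hstrip \<theta> \<eta>"
  shows "hstrip (toggle \<kappa> \<theta> (j, \<eta>)) \<kappa>" "hstrip (toggle \<kappa> \<theta> (j, \<eta>)) \<theta>"
    "untoggle \<kappa> \<theta> (toggle \<kappa> \<theta> (j, \<eta>)) = (j, \<eta>)"
    "psize (toggle \<kappa> \<theta> (j, \<eta>)) + psize \<eta> = psize \<kappa> + psize \<theta> + j"
proof -
  let ?\<nu> = "toggle \<kappa> \<theta> (j, \<eta>)"
  have h: "mx (Suc i) \<le> parts_of \<eta> i" "parts_of \<eta> i \<le> mn i" for i
    using assms hstrip_both_down by auto
  note p = parts_of_toggle[OF assms, of j]
  have "\<forall>i. mx i \<le> parts_of ?\<nu> i \<and> parts_of ?\<nu> (Suc i) \<le> mn i"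
  proof
    fix i
    have "mx i \<le> parts_of ?\<nu> i"
    proof (cases i)
      case (Suc k) show ?thesis unfolding Suc p(2) using h[of k] by linarith
    next
      case 0 show ?thesis unfolding 0 p(1) by simp
    qed
    moreover have "parts_of ?\<nu> (Suc i) \<le> mn i" using h[of i] unfolding p(2) by linarith
    ultimately show "mx i \<le> parts_of ?\<nu> i \<and> parts_of ?\<nu> (Suc i) \<le> mn i" ..
  qed
  then have hs: "hstrip ?\<nu> \<kappa> \<and> hstrip ?\<nu> \<theta>" using hstrip_both_up by blast
  then show "hstrip ?\<nu> \<kappa>" "hstrip ?\<nu> \<theta>" by auto
  have "parts_of (snd (untoggle \<kappa> \<theta> ?\<nu>)) i = parts_of \<eta> i" for i
    using parts_of_untoggle[of ?\<nu> i] hs h[of i] by (simp only: p; auto)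
  then have "snd (untoggle \<kappa> \<theta> ?\<nu>) = \<eta>" by (rule partition_eqI)
  moreover have "fst (untoggle \<kappa> \<theta> ?\<nu>) = j"
    unfolding untoggle_def fst_conv p(1) by simp
  ultimately show "untoggle \<kappa> \<theta> ?\<nu> = (j, \<eta>)" by (metis prod.collapse)
  define n where "n = plen \<kappa> + plen \<theta> + plen \<eta> + plen ?\<nu>"
  have s1: "psize ?\<nu> = (\<Sum>i<Suc n. parts_of ?\<nu> i)" "psize \<eta> = (\<Sum>i<n. parts_of \<eta> i)"
    "psize \<kappa> = (\<Sum>i<Suc n. parts_of \<kappa> i)" "psize \<theta> = (\<Sum>i<Suc n. parts_of \<theta> i)"
    by (auto simp only: n_def intro!: psize_sum)
  have "psize ?\<nu> + psize \<eta> = mx 0 + j + (\<Sum>i<n. parts_of ?\<nu> (Suc i) + parts_of \<eta> i)"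
    unfolding s1 sum.lessThan_Suc_shift by (simp only: p sum.distrib add.assoc)
  also have "(\<Sum>i<n. parts_of ?\<nu> (Suc i) + parts_of \<eta> i) = (\<Sum>i<n. mx (Suc i) + mn i)"
  proof (rule sum.cong)
    fix i show "parts_of ?\<nu> (Suc i) + parts_of \<eta> i = mx (Suc i) + mn i"
      using h[of i] by (simp only: p; auto)
  qed simp
  also have "mx 0 + j + \<dots> = (\<Sum>i<Suc n. mx i) + (\<Sum>i<n. mn i) + j"
    by (simp only: sum.distrib sum.lessThan_Suc_shift[of mx]; simp)
  also have "(\<Sum>i<n. mn i) = (\<Sum>i<Suc n. mn i)"
  proof -
    have "parts_of \<kappa> n = 0" by (auto simp: n_def parts_of_eq_0_iff)
    then have "mn n = 0" by simp
    then show ?thesis by simp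
  qed
  also have "(\<Sum>i<Suc n. mx i) + (\<Sum>i<Suc n. mn i) = (\<Sum>i<Suc n. parts_of \<kappa> i + parts_of \<theta> i)"
    unfolding sum.distrib[symmetric] by (rule sum.cong) auto
  finally show "psize ?\<nu> + psize \<eta> = psize \<kappa> + psize \<theta> + j"
    by (simp only: s1 sum.distrib)
qed

lemma untoggle_hstrip:
  assumes "hstrip \<nu> \<kappa>" "hstrip \<nu> \<theta>"
  shows "hstrip \<kappa> (snd (untoggle \<kappa> \<theta> \<nu>))" "hstrip \<theta> (snd (untoggle \<kappa> \<theta> \<nu>))"
    "toggle \<kappa> \<theta> (untoggle \<kappa> \<theta> \<nu>) = \<nu>"
proof -
  let ?\<eta> = "snd (untoggle \<kappa> \<theta> \<nu>)"
  have h: "mx i \<le> parts_of \<nu> i" "parts_of \<nu> (Suc i) \<le> mn i" for i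
    using assms hstrip_both_up by auto
  note p = parts_of_untoggle[OF assms]
  have "\<forall>i. mx (Suc i) \<le> parts_of ?\<eta> i \<and> parts_of ?\<eta> i \<le> mn i"
  proof
    fix i show "mx (Suc i) \<le> parts_of ?\<eta> i \<and> parts_of ?\<eta> i \<le> mn i"
      using h(1)[of "Suc i"] h(2)[of i] by (simp only: p; auto)
  qed
  then have hs: "hstrip \<kappa> ?\<eta> \<and> hstrip \<theta> ?\<eta>" using hstrip_both_down by blast
  then show "hstrip \<kappa> ?\<eta>" "hstrip \<theta> ?\<eta>" by auto
  have e: "untoggle \<kappa> \<theta> \<nu> = (parts_of \<nu> 0 - mx 0, ?\<eta>)" by (simp add: untoggle_def)
  show "toggle \<kappa> \<theta> (untoggle \<kappa> \<theta> \<nu>) = \<nu>"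
  proof (rule partition_eqI)
    fix i show "parts_of (toggle \<kappa> \<theta> (untoggle \<kappa> \<theta> \<nu>)) i = parts_of \<nu> i"
    proof (cases i)
      case 0 then show ?thesis using h(1)[of 0] hs by (subst e) (simp add: parts_of_toggle)
    next
      case (Suc k) then show ?thesis using h(1)[of i] h(2)[of k] hs
        by (subst e) (simp add: parts_of_toggle p del: min.bounded_iff max.bounded_iff)
    qed
  qed
qed

end

text \<open>
  The commutation relation between the operators that add and remove strips, applied to a function of
  the resulting partition \<open>\<theta>\<close>: for fixed \<open>\<theta>\<close> both sides count what \<open>toggle\<close> matches.
\<close>

lemma pieri_commute:
  fixes g :: "partition \<Rightarrow> 'a::comm_monoid_add"
  shows "(\<Sum>\<nu>\<in>pieri_up r \<kappa>. \<Sum>\<theta>\<in>pieri_down a \<nu>. g \<theta>) =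
    (\<Sum>j\<le>min a r. \<Sum>\<eta>\<in>pieri_down (a - j) \<kappa>. \<Sum>\<theta>\<in>pieri_up (r - j) \<eta>. g \<theta>)"
proof -
  have "(\<Sum>\<nu>\<in>pieri_up r \<kappa>. \<Sum>\<theta>\<in>pieri_down a \<nu>. g \<theta>) =
      (\<Sum>(\<nu>, \<theta>)\<in>Sigma (pieri_up r \<kappa>) (pieri_down a). g \<theta>)"
    by (rule sum.Sigma) auto
  also have "\<dots> = (\<Sum>(j, \<eta>, \<theta>)\<in>Sigma {..min a r} (\<lambda>j. Sigma (pieri_down (a - j) \<kappa>) (pieri_up (r - j))). g \<theta>)"
  proof (rule sum.reindex_bij_witness[where i = "\<lambda>(j, \<eta>, \<theta>). (toggle \<kappa> \<theta> (j, \<eta>), \<theta>)"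
        and j = "\<lambda>(\<nu>, \<theta>). (fst (untoggle \<kappa> \<theta> \<nu>), snd (untoggle \<kappa> \<theta> \<nu>), \<theta>)"], goal_cases)
    case (1 x)
    then show ?case by (auto simp: pieri_up_def pieri_down_def untoggle_hstrip)
  next
    case (2 x)
    obtain \<nu> \<theta> where x: "x = (\<nu>, \<theta>)" by force
    obtain j \<eta> where u: "untoggle \<kappa> \<theta> \<nu> = (j, \<eta>)" by force
    have hs: "hstrip \<nu> \<kappa>" "hstrip \<nu> \<theta>" "psize \<nu> = psize \<kappa> + r" "psize \<nu> = psize \<theta> + a"
      using 2 x by (auto simp: pieri_up_def pieri_down_def)
    have d: "hstrip \<kappa> \<eta>" "hstrip \<theta> \<eta>" "toggle \<kappa> \<theta> (j, \<eta>) = \<nu>"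
      using untoggle_hstrip[OF hs(1,2)] u by auto
    have "psize \<nu> + psize \<eta> = psize \<kappa> + psize \<theta> + j"
      using toggle_hstrip(4)[OF d(1,2), of j] d(3) by simp
    moreover have "psize \<eta> \<le> psize \<kappa>" "psize \<eta> \<le> psize \<theta>" using d hstrip_psize_le by auto
    ultimately show ?case using x u hs d
      by (auto simp: pieri_up_def pieri_down_def)
  next
    case (3 x)
    then show ?case by (auto simp: pieri_up_def pieri_down_def toggle_hstrip)
  next
    case (4 x)
    obtain j \<eta> \<theta> where x: "x = (j, \<eta>, \<theta>)" by (metis prod.collapse)
    have hs: "hstrip \<kappa> \<eta>" "hstrip \<theta> \<eta>" "psize \<kappa> = psize \<eta> + (a - j)" "psize \<theta> = psize \<eta> + (r - j)" "j \<le> min a r"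
      using 4 x by (auto simp: pieri_up_def pieri_down_def)
    then show ?case using x toggle_hstrip[OF hs(1,2), of j]
      by (auto simp: pieri_up_def pieri_down_def)
  qed auto
  also have "\<dots> = (\<Sum>j\<le>min a r. \<Sum>(\<eta>, \<theta>)\<in>Sigma (pieri_down (a - j) \<kappa>) (pieri_up (r - j)). g \<theta>)"
    by (rule sum.Sigma [symmetric]) auto
  also have "\<dots> = (\<Sum>j\<le>min a r. \<Sum>\<eta>\<in>pieri_down (a - j) \<kappa>. \<Sum>\<theta>\<in>pieri_up (r - j) \<eta>. g \<theta>)"
    by (intro sum.cong refl sum.Sigma [symmetric]) auto
  finally show ?thesis .
qed

text \<open>
  An induction principle that replaces determinantal formulas. Let \<open>\<kappa>\<close> be \<open>\<rho>\<close> without its last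
  row, and \<open>r\<close> the length of that row. Then \<open>\<rho>\<close> is one of the partitions \<open>\<nu>\<close> in \<open>pieri_up r \<kappa>\<close>, and every
  other one has a shorter row in that place, so \<open>e \<rho>\<close> is the sum for \<open>\<kappa>\<close> minus terms that are in
  \<open>V\<close> by induction on the number of rows and then on the length of the last one.
\<close>

lemma pieri_induct:
  fixes e :: "partition \<Rightarrow> 'a::ab_group_add"
  assumes diff: "\<And>x y. x \<in> V \<Longrightarrow> y \<in> V \<Longrightarrow> x - y \<in> V"
    and base: "e empty_partition \<in> V"
    and step: "\<And>\<kappa> r. e \<kappa> \<in> V \<Longrightarrow> (\<Sum>\<nu>\<in>pieri_up r \<kappa>. e \<nu>) \<in> V"
  shows "e \<rho> \<in> V"
proof -
  have zero: "0 \<in> V" using diff[OF base base] by simp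
  have plus: "x + y \<in> V" if "x \<in> V" "y \<in> V" for x y
    using diff[OF that(1) diff[OF zero that(2)]] by simp
  have sumV: "(\<Sum>i\<in>A. f i) \<in> V" if "\<And>i. i \<in> A \<Longrightarrow> f i \<in> V" for A :: "partition set" and f
    using that by (induction A rule: infinite_finite_induct) (auto simp: zero plus)
  have "\<forall>\<rho>. plen \<rho> \<le> l \<longrightarrow> e \<rho> \<in> V" for l
  proof (induction l)
    case 0
    have "e \<rho> \<in> V" if "plen \<rho> \<le> 0" for \<rho>
    proof -
      have "\<rho> = empty_partition"
        using that by (intro partition_eqI) (auto simp: parts_of_eq_0_iff)
      then show ?thesis using base by simp
    qed
    then show ?case by blast
  next
    case (Suc l)
    have "plen \<rho> \<le> Suc l \<longrightarrow> e \<rho> \<in> V" for \<rho>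
    proof (induction "parts_of \<rho> l" arbitrary: \<rho> rule: less_induct)
      case less
      show ?case
      proof
        assume len: "plen \<rho> \<le> Suc l"
        define \<kappa> where "\<kappa> = Abs_partition (\<lambda>i. if i < l then parts_of \<rho> i else 0)"
        have pk: "parts_of \<kappa> i = (if i < l then parts_of \<rho> i else 0)" for i
          unfolding \<kappa>_def by (subst parts_of_Abs[where n = l]) (auto simp: parts_of_antimono)
        have lk: "plen \<kappa> \<le> l" using parts_of_eq_0_iff[of \<kappa> l] by (simp add: pk)
        have r0: "parts_of \<rho> i = 0" if "i > l" for i
          using that len parts_of_eq_0_iff[of \<rho> i] by auto
        have sk: "psize \<kappa> = (\<Sum>i<l. parts_of \<rho> i)"
          using psize_sum[OF lk] by (simp add: pk)
        have "hstrip \<rho> \<kappa>" using r0 by (auto simp: hstrip_def pk parts_of_antimono)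
        moreover have "psize \<rho> = psize \<kappa> + parts_of \<rho> l"
          using psize_sum[OF len] sk by simp
        ultimately have mem: "\<rho> \<in> pieri_up (parts_of \<rho> l) \<kappa>" by (simp add: pieri_up_def)
        have "e \<nu> \<in> V" if nu: "\<nu> \<in> pieri_up (parts_of \<rho> l) \<kappa> - {\<rho>}" for \<nu>
        proof -
          have hs: "hstrip \<nu> \<kappa>" and sz: "psize \<nu> = psize \<kappa> + parts_of \<rho> l" and ne: "\<nu> \<noteq> \<rho>"
            using nu by (auto simp: pieri_up_def)
          have ln: "plen \<nu> \<le> Suc l" using hstrip_plen[OF hs] lk by simp
          have ge: "parts_of \<rho> i \<le> parts_of \<nu> i" if "i < l" for i
            using hs that pk[of i] unfolding hstrip_def by (metis)
          have sn: "(\<Sum>i<l. parts_of \<nu> i) + parts_of \<nu> l = (\<Sum>i<l. parts_of \<rho> i) + parts_of \<rho> l"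
            using psize_sum[OF ln] sz sk by simp
          have le: "(\<Sum>i<l. parts_of \<rho> i) \<le> (\<Sum>i<l. parts_of \<nu> i)"
            by (rule sum_mono) (use ge in auto)
          have "parts_of \<nu> l \<noteq> parts_of \<rho> l"
          proof
            assume eq: "parts_of \<nu> l = parts_of \<rho> l"
            have "\<forall>i\<in>{..<l}. parts_of \<rho> i = parts_of \<nu> i"
            proof (rule ccontr)
              assume "\<not> ?thesis"
              then obtain i where "i < l" "parts_of \<rho> i < parts_of \<nu> i" using ge by force
              then have "(\<Sum>i<l. parts_of \<rho> i) < (\<Sum>i<l. parts_of \<nu> i)"
                by (intro sum_strict_mono_ex1) (use ge in auto)
              then show False using sn eq by simp
            qed
            moreover have "parts_of \<nu> i = parts_of \<rho> i" if "i > l" for i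
              using that ln r0[OF that] by (simp add: parts_of_eq_0_iff[of \<nu>])
            ultimately have "\<nu> = \<rho>" using eq
              by (intro partition_eqI) (metis lessThan_iff linorder_neqE_nat)
            then show False using ne by simp
          qed
          then have "parts_of \<nu> l < parts_of \<rho> l" using sn le by simp
          then show ?thesis using less ln by blast
        qed
        then have "(\<Sum>\<nu>\<in>pieri_up (parts_of \<rho> l) \<kappa> - {\<rho>}. e \<nu>) \<in> V" by (rule sumV)
        moreover have "(\<Sum>\<nu>\<in>pieri_up (parts_of \<rho> l) \<kappa>. e \<nu>) \<in> V"
          using Suc lk by (intro step) blast
        moreover have "(\<Sum>\<nu>\<in>pieri_up (parts_of \<rho> l) \<kappa>. e \<nu>) =
            e \<rho> + (\<Sum>\<nu>\<in>pieri_up (parts_of \<rho> l) \<kappa> - {\<rho>}. e \<nu>)"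
          by (rule sum.remove) (use mem in auto)
        ultimately show "e \<rho> \<in> V" by (metis add_diff_cancel_right' diff)
      qed
    qed
    then show ?case by blast
  qed
  then show ?thesis by blast
qed

section \<open>The branching rule for tableaux\<close>

lemma mem_diagram: "(i, j) \<in> diagram \<mu> \<longleftrightarrow> 1 \<le> i \<and> 1 \<le> j \<and> j \<le> parts_of \<mu> (i - 1)"
  by (auto simp: diagram_def part_def)

lemma diagram_Sigma: "diagram \<mu> = (SIGMA i:{1..plen \<mu>}. {1..part \<mu> i})"
proof (rule Set.set_eqI)
  fix c :: "nat \<times> nat"
  obtain i j where c: "c = (i, j)" by force
  show "c \<in> diagram \<mu> \<longleftrightarrow> c \<in> (SIGMA i:{1..plen \<mu>}. {1..part \<mu> i})"
    using parts_of_eq_0_iff[of \<mu> "i - 1"] unfolding c mem_diagram by (auto simp: part_def)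
qed

lemma finite_diagram [simp]: "finite (diagram \<mu>)"
  by (simp add: diagram_Sigma)

lemma card_diagram: "card (diagram \<mu>) = psize \<mu>"
  by (simp add: diagram_Sigma psize_def)

lemma diagram_mono: "hstrip \<nu> \<kappa> \<Longrightarrow> diagram \<kappa> \<subseteq> diagram \<nu>"
  by (auto simp: mem_diagram hstrip_def) (meson order_trans)

definition ssyt :: "partition \<Rightarrow> nat multiset \<Rightarrow> (nat \<times> nat \<Rightarrow> nat) set" where
  "ssyt \<mu> M = {T. semistandard \<mu> T \<and> image_mset T (mset_set (diagram \<mu>)) = M}"

lemma mcoeff_schur: "mcoeff (schur \<mu>) M = int (card (ssyt \<mu> M))"
  by (simp add: schur_def ssyt_def)

lemma semistandard_cell: "semistandard \<mu> T \<Longrightarrow> c \<in> diagram \<mu> \<longleftrightarrow> 1 \<le> T c"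
  unfolding semistandard_def by blast

lemma ssyt_zero: "T \<in> ssyt \<mu> M \<Longrightarrow> c \<notin> diagram \<mu> \<Longrightarrow> T c = 0"
  using semistandard_cell[of \<mu> T c] by (simp add: ssyt_def)

lemma ssyt_pos: "T \<in> ssyt \<mu> M \<Longrightarrow> c \<in> diagram \<mu> \<Longrightarrow> 1 \<le> T c"
  using semistandard_cell[of \<mu> T c] by (simp add: ssyt_def)

lemma ssyt_in: "T \<in> ssyt \<mu> M \<Longrightarrow> c \<in> diagram \<mu> \<Longrightarrow> T c \<in># M"
  by (auto simp: ssyt_def)

lemma finite_ssyt: "finite (ssyt \<mu> M)"
proof (rule finite_subset)
  show "ssyt \<mu> M \<subseteq> {T. \<forall>c. (c \<in> diagram \<mu> \<longrightarrow> T c \<in> set_mset M) \<and> (c \<notin> diagram \<mu> \<longrightarrow> T c = 0)}"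
    using ssyt_zero ssyt_in by blast
qed (rule finite_set_of_finite_funs; simp)

lemma mcoeff_schur_size: "mcoeff (schur \<mu>) M \<noteq> 0 \<Longrightarrow> size M = psize \<mu>"
  by (auto simp: mcoeff_schur card_eq_0_iff ssyt_def card_diagram)

lemma mcoeff_schur_0: "0 \<in># M \<Longrightarrow> mcoeff (schur \<mu>) M = 0"
proof (rule ccontr)
  assume "0 \<in># M" "mcoeff (schur \<mu>) M \<noteq> 0"
  then obtain T where "T \<in> ssyt \<mu> M" by (auto simp: mcoeff_schur card_eq_0_iff)
  with \<open>0 \<in># M\<close> obtain c where "c \<in> diagram \<mu>" "T c = 0" by (auto simp: ssyt_def)
  then show False using ssyt_pos[OF \<open>T \<in> ssyt \<mu> M\<close>, of c] by simp
qed

lemma mcoeff_schur_empty_mset: "mcoeff (schur \<mu>) {#} = (if \<mu> = empty_partition then 1 else 0)"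
proof (cases "\<mu> = empty_partition")
  case True
  have d: "diagram \<mu> = {}" by (auto simp: True diagram_def part_def)
  have "ssyt \<mu> {#} = {\<lambda>_. 0}"
    by (auto simp: ssyt_def semistandard_def d fun_eq_iff Suc_le_eq)
  then show ?thesis using True by (simp add: mcoeff_schur)
next
  case False
  then show ?thesis using mcoeff_schur_size[of \<mu> "{#}"] by (metis psize_eq_0_iff size_empty)
qed

text \<open>
  Rows increase weakly and columns strictly, so the cells with entries at most \<open>m\<close> form the diagram
  of a partition. If no entry exceeds \<open>m + 1\<close>, the other cells all contain \<open>m + 1\<close>; they are then in
  different columns and form a horizontal strip.
\<close>

context
  fixes \<mu> :: partition and T :: "nat \<times> nat \<Rightarrow> nat" and m :: nat
  assumes ss: "semistandard \<mu> T"
begin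

lemma ss_row: "(i, j') \<in> diagram \<mu> \<Longrightarrow> 1 \<le> j \<Longrightarrow> j \<le> j' \<Longrightarrow> T (i, j) \<le> T (i, j')"
proof (induction j')
  case (Suc j')
  show ?case
  proof (cases "j = Suc j'")
    case False
    then have d: "(i, j') \<in> diagram \<mu>" "j \<le> j'" using Suc.prems by (auto simp: mem_diagram)
    have "T (i, j') \<le> T (i, j' + 1)" using ss d(1) Suc.prems(1) by (auto simp: semistandard_def)
    then show ?thesis using Suc.IH[OF d(1) Suc.prems(2) d(2)] by simp
  qed simp
qed simp

lemma ss_col:
  assumes "(i + 1, j) \<in> diagram \<mu>" "1 \<le> i"
  shows "T (i, j) < T (i + 1, j)" "(i, j) \<in> diagram \<mu>"
proof -
  show d: "(i, j) \<in> diagram \<mu>" using assms parts_of_antimono[of "i - 1" i \<mu>] by (auto simp: mem_diagram)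
  then show "T (i, j) < T (i + 1, j)" using ss assms by (auto simp: semistandard_def)
qed

definition inner_row :: "nat \<Rightarrow> nat" where
  "inner_row i = card {j. (Suc i, j) \<in> diagram \<mu> \<and> T (Suc i, j) \<le> m}"

lemma inner_row: "(Suc i, j) \<in> diagram \<mu> \<and> T (Suc i, j) \<le> m \<longleftrightarrow> 1 \<le> j \<and> j \<le> inner_row i"
proof -
  let ?S = "{j. (Suc i, j) \<in> diagram \<mu> \<and> T (Suc i, j) \<le> m}"
  have fin: "finite ?S" by (rule finite_subset[of _ "{..parts_of \<mu> i}"]) (auto simp: mem_diagram)
  have pos: "1 \<le> j" if "j \<in> ?S" for j using that by (auto simp: mem_diagram)
  have down: "j \<in> ?S" if "j' \<in> ?S" "1 \<le> j" "j \<le> j'" for j j'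
    using that ss_row[of "Suc i" j' j] by (auto simp: mem_diagram)
  have "?S = {1..card ?S}"
  proof (cases "?S = {}")
    case False
    define k where "k = Max ?S"
    have kS: "k \<in> ?S" unfolding k_def by (rule Max_in[OF fin False])
    have "j \<in> ?S" if "j \<in> {1..k}" for j by (rule down[OF kS]) (use that in auto)
    moreover have "j \<in> {1..k}" if "j \<in> ?S" for j
      unfolding k_def using Max_ge[OF fin that] pos[OF that] by simp
    ultimately have "?S = {1..k}" by blast
    then show ?thesis by simp
  next
    case True then show ?thesis by (simp only: True) simp
  qed
  then have "j \<in> ?S \<longleftrightarrow> j \<in> {1..card ?S}" by blast
  then show ?thesis by (simp add: inner_row_def)
qed

definition inner_shape :: partition where "inner_shape = Abs_partition inner_row"

lemma parts_of_inner_shape: "parts_of inner_shape i = inner_row i"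
proof -
  have "parts_of inner_shape = inner_row"
    unfolding inner_shape_def
  proof (rule parts_of_Abs[where n = "plen \<mu>"])
    fix i
    show "inner_row (Suc i) \<le> inner_row i"
    proof (cases "inner_row (Suc i) = 0")
      case False
      then have "(Suc (Suc i), inner_row (Suc i)) \<in> diagram \<mu>" "T (Suc (Suc i), inner_row (Suc i)) \<le> m"
        using inner_row[of "Suc i" "inner_row (Suc i)"] by auto
      then show ?thesis using ss_col[of "Suc i" "inner_row (Suc i)"] inner_row[of i "inner_row (Suc i)"] by auto
    qed simp
  next
    fix i assume "plen \<mu> \<le> i"
    then show "inner_row i = 0" using inner_row[of i "inner_row i"] parts_of_eq_0_iff[of \<mu> i]
      by (auto simp: mem_diagram)
  qed
  then show ?thesis by simp
qed

lemma diagram_inner_shape: "diagram inner_shape = {c \<in> diagram \<mu>. T c \<le> m}"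
proof -
  have "(i, j) \<in> diagram inner_shape \<longleftrightarrow> (i, j) \<in> diagram \<mu> \<and> T (i, j) \<le> m" for i j
    using inner_row[of "i - 1" j] by (cases i) (auto simp: mem_diagram parts_of_inner_shape)
  then show ?thesis by auto
qed

lemma hstrip_inner_shape:
  assumes "\<And>c. c \<in> diagram \<mu> \<Longrightarrow> T c \<le> Suc m"
  shows "hstrip \<mu> inner_shape"
  unfolding hstrip_def
proof (intro allI conjI)
  fix i
  show "parts_of inner_shape i \<le> parts_of \<mu> i"
    using inner_row[of i "inner_row i"] by (cases "inner_row i = 0") (auto simp: mem_diagram parts_of_inner_shape)
  show "parts_of \<mu> (Suc i) \<le> parts_of inner_shape i"
  proof (cases "parts_of \<mu> (Suc i) = 0")
    case False
    then have d: "(Suc i + 1, parts_of \<mu> (Suc i)) \<in> diagram \<mu>" by (auto simp: mem_diagram)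
    then show ?thesis using ss_col[OF d] assms[OF d] inner_row[of i "parts_of \<mu> (Suc i)"]
      by (auto simp: parts_of_inner_shape)
  qed simp
qed

end

lemma diagram_inject: "diagram \<mu> = diagram \<nu> \<Longrightarrow> \<mu> = \<nu>"
proof (rule partition_eqI)
  fix i assume eq: "diagram \<mu> = diagram \<nu>"
  have "1 \<le> j \<and> j \<le> parts_of \<mu> i \<longleftrightarrow> 1 \<le> j \<and> j \<le> parts_of \<nu> i" for j
    using arg_cong[OF eq, of "\<lambda>D. (Suc i, j) \<in> D"] by (simp add: mem_diagram)
  from this[of "parts_of \<mu> i"] this[of "parts_of \<nu> i"] show "parts_of \<mu> i = parts_of \<nu> i" by linarith
qed

definition glue :: "partition \<Rightarrow> nat \<Rightarrow> partition \<times> (nat \<times> nat \<Rightarrow> nat) \<Rightarrow> nat \<times> nat \<Rightarrow> nat" where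
  "glue \<mu> z = (\<lambda>(\<kappa>, T) c. if c \<in> diagram \<kappa> then T c else if c \<in> diagram \<mu> then z else 0)"

text \<open>
  Filling a horizontal strip with a new largest entry and cutting the cells of the largest entry off
  again are mutually inverse; \<open>restrict_ssyt\<close> is the other half of the bijection.
\<close>

lemma glue_ssyt:
  assumes hs: "hstrip \<mu> \<kappa>" and sz: "psize \<mu> = psize \<kappa> + r" and T: "T \<in> ssyt \<kappa> M"
    and M: "set_mset M \<subseteq> {1..m}"
  shows "glue \<mu> (Suc m) (\<kappa>, T) \<in> ssyt \<mu> (M + replicate_mset r (Suc m))"
    and "inner_shape \<mu> (glue \<mu> (Suc m) (\<kappa>, T)) m = \<kappa>"
    and "(\<lambda>c. if glue \<mu> (Suc m) (\<kappa>, T) c \<le> m then glue \<mu> (Suc m) (\<kappa>, T) c else 0) = T"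
proof -
  let ?G = "glue \<mu> (Suc m) (\<kappa>, T)"
  have sub: "diagram \<kappa> \<subseteq> diagram \<mu>" using hs by (rule diagram_mono)
  have T1: "c \<in> diagram \<kappa> \<Longrightarrow> 1 \<le> T c" "c \<in> diagram \<kappa> \<Longrightarrow> T c \<le> m" "c \<notin> diagram \<kappa> \<Longrightarrow> T c = 0" for c
    using ssyt_pos[OF T] ssyt_in[OF T] ssyt_zero[OF T] M by (auto simp: subset_iff)
  have G: "?G c = (if c \<in> diagram \<kappa> then T c else if c \<in> diagram \<mu> then Suc m else 0)" for c
    by (simp add: glue_def)
  have G1: "?G c \<le> Suc m" for c using T1[of c] by (auto simp: G)
  have ssT: "semistandard \<kappa> T" using T by (simp add: ssyt_def)
  have ss: "semistandard \<mu> ?G"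
    unfolding semistandard_def
  proof (intro conjI allI impI)
    fix c show "c \<in> diagram \<mu> \<longleftrightarrow> 1 \<le> ?G c" using sub T1[of c] by (auto simp: G)
  next
    fix i j assume d: "(i, j) \<in> diagram \<mu> \<and> (i, j + 1) \<in> diagram \<mu>"
    show "?G (i, j) \<le> ?G (i, j + 1)"
    proof (cases "(i, j + 1) \<in> diagram \<kappa>")
      case True
      then have "(i, j) \<in> diagram \<kappa>" using d by (auto simp: mem_diagram)
      then show ?thesis using True ssT by (auto simp: G semistandard_def)
    next
      case False
      then have "?G (i, j + 1) = Suc m" using d by (simp add: G)
      then show ?thesis using G1[of "(i, j)"] by simp
    qed
  next
    fix i j assume d: "(i, j) \<in> diagram \<mu> \<and> (i + 1, j) \<in> diagram \<mu>"
    have "parts_of \<mu> (Suc (i - 1)) \<le> parts_of \<kappa> (i - 1)" using hs by (simp add: hstrip_def)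
    then have k: "(i, j) \<in> diagram \<kappa>" using d by (auto simp: mem_diagram)
    show "?G (i, j) < ?G (i + 1, j)"
    proof (cases "(i + 1, j) \<in> diagram \<kappa>")
      case True
      then show ?thesis using k ssT by (auto simp: G semistandard_def)
    next
      case False
      then have "?G (i + 1, j) = Suc m" using d by (simp add: G)
      then show ?thesis using k T1(2)[OF k] by (simp add: G)
    qed
  qed
  have "mset_set (diagram \<mu>) = mset_set (diagram \<kappa>) + mset_set (diagram \<mu> - diagram \<kappa>)"
    using sub by (subst mset_set_Union [symmetric]) (auto simp: Un_absorb1)
  moreover have "image_mset ?G (mset_set (diagram \<kappa>)) = image_mset T (mset_set (diagram \<kappa>))"
    by (rule image_mset_cong) (simp add: G)
  moreover have "image_mset ?G (mset_set (diagram \<mu> - diagram \<kappa>)) =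
      image_mset (\<lambda>_. Suc m) (mset_set (diagram \<mu> - diagram \<kappa>))"
    by (rule image_mset_cong) (simp add: G)
  moreover have "card (diagram \<mu> - diagram \<kappa>) = r"
    using sub sz by (simp add: card_Diff_subset card_diagram)
  ultimately have "image_mset ?G (mset_set (diagram \<mu>)) = M + replicate_mset r (Suc m)"
    using T by (simp add: ssyt_def image_mset_const_eq)
  with ss show "?G \<in> ssyt \<mu> (M + replicate_mset r (Suc m))" by (simp add: ssyt_def)
  have "diagram (inner_shape \<mu> ?G m) = diagram \<kappa>"
    unfolding diagram_inner_shape[OF ss] using sub T1 by (auto simp: G)
  then show "inner_shape \<mu> ?G m = \<kappa>" by (rule diagram_inject)
  show "(\<lambda>c. if ?G c \<le> m then ?G c else 0) = T"
    using T1 by (auto simp: G fun_eq_iff)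
qed

lemma restrict_ssyt:
  assumes T: "T \<in> ssyt \<mu> (M + replicate_mset r (Suc m))" and M: "set_mset M \<subseteq> {1..m}"
  defines "\<kappa> \<equiv> inner_shape \<mu> T m" and "T' \<equiv> \<lambda>c. if T c \<le> m then T c else 0"
  shows "hstrip \<mu> \<kappa>" "psize \<mu> = psize \<kappa> + r" "T' \<in> ssyt \<kappa> M" "glue \<mu> (Suc m) (\<kappa>, T') = T"
proof -
  have ss: "semistandard \<mu> T" and im: "image_mset T (mset_set (diagram \<mu>)) = M + replicate_mset r (Suc m)"
    using T by (auto simp: ssyt_def)
  have le: "T c \<le> Suc m" if "c \<in> diagram \<mu>" for c
    using ssyt_in[OF T that] M by (auto simp: subset_iff split: if_splits)
  have dk: "diagram \<kappa> = {c \<in> diagram \<mu>. T c \<le> m}"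
    unfolding \<kappa>_def by (rule diagram_inner_shape[OF ss])
  show hs: "hstrip \<mu> \<kappa>" unfolding \<kappa>_def by (rule hstrip_inner_shape[OF ss]) (rule le)
  have ss': "semistandard \<kappa> T'"
    using ss unfolding semistandard_def dk T'_def by auto
  have "image_mset T' (mset_set (diagram \<kappa>)) = image_mset T (mset_set (diagram \<kappa>))"
    by (rule image_mset_cong) (simp add: dk T'_def)
  also have "\<dots> = filter_mset (\<lambda>x. x \<le> m) (image_mset T (mset_set (diagram \<mu>)))"
    by (simp add: dk flip: image_mset_filter_mset_swap)
  also have "\<dots> = M"
  proof -
    have "filter_mset (\<lambda>x. x \<le> m) M = filter_mset (\<lambda>_. True) M"
      by (rule filter_mset_cong) (use M in auto)
    moreover have "filter_mset (\<lambda>x. x \<le> m) (replicate_mset r (Suc m)) = {#}"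
      by (induction r) simp_all
    ultimately show ?thesis unfolding im by simp
  qed
  finally show T': "T' \<in> ssyt \<kappa> M" using ss' by (simp add: ssyt_def)
  have "psize \<kappa> = size M" using T' by (auto simp: ssyt_def card_diagram)
  moreover have "psize \<mu> = size M + r" using arg_cong[OF im, of size] by (simp add: card_diagram)
  ultimately show "psize \<mu> = psize \<kappa> + r" by simp
  show "glue \<mu> (Suc m) (\<kappa>, T') = T"
  proof
    fix c show "glue \<mu> (Suc m) (\<kappa>, T') c = T c"
      using le[of c] ssyt_zero[OF T, of c] by (auto simp: glue_def dk T'_def)
  qed
qed

text \<open>
  Tableaux of content \<open>M\<close> with \<open>r\<close> further entries \<open>m + 1\<close> are sorted by the shape \<open>\<kappa>\<close> of the part with
  entries at most \<open>m\<close>. From here on, apart from homogeneity, tableaux enter only through this rule.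
\<close>

lemma schur_branching:
  assumes M: "set_mset M \<subseteq> {1..m}"
  shows "mcoeff (schur \<mu>) (M + replicate_mset r (Suc m)) = (\<Sum>\<kappa>\<in>pieri_down r \<mu>. mcoeff (schur \<kappa>) M)"
proof -
  let ?N = "M + replicate_mset r (Suc m)"
  have "bij_betw (glue \<mu> (Suc m)) (Sigma (pieri_down r \<mu>) (\<lambda>\<kappa>. ssyt \<kappa> M)) (ssyt \<mu> ?N)"
  proof (rule bij_betw_byWitness[where f' = "\<lambda>T. (inner_shape \<mu> T m, \<lambda>c. if T c \<le> m then T c else 0)"])
    show "\<forall>p\<in>Sigma (pieri_down r \<mu>) (\<lambda>\<kappa>. ssyt \<kappa> M).
        (inner_shape \<mu> (glue \<mu> (Suc m) p) m, \<lambda>c. if glue \<mu> (Suc m) p c \<le> m then glue \<mu> (Suc m) p c else 0) = p"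
      using glue_ssyt(2,3)[OF _ _ _ M] by (auto simp: pieri_down_def)
    show "\<forall>T\<in>ssyt \<mu> ?N. glue \<mu> (Suc m) (inner_shape \<mu> T m, \<lambda>c. if T c \<le> m then T c else 0) = T"
      using restrict_ssyt(4)[OF _ M] by blast
    show "glue \<mu> (Suc m) ` Sigma (pieri_down r \<mu>) (\<lambda>\<kappa>. ssyt \<kappa> M) \<subseteq> ssyt \<mu> ?N"
      using glue_ssyt(1)[OF _ _ _ M] by (auto simp: pieri_down_def)
    show "(\<lambda>T. (inner_shape \<mu> T m, \<lambda>c. if T c \<le> m then T c else 0)) ` ssyt \<mu> ?N
        \<subseteq> Sigma (pieri_down r \<mu>) (\<lambda>\<kappa>. ssyt \<kappa> M)"
      using restrict_ssyt(1-3)[OF _ M] by (auto simp: pieri_down_def)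
  qed
  then have "card (ssyt \<mu> ?N) = card (Sigma (pieri_down r \<mu>) (\<lambda>\<kappa>. ssyt \<kappa> M))"
    by (metis bij_betw_same_card)
  also have "\<dots> = (\<Sum>\<kappa>\<in>pieri_down r \<mu>. card (ssyt \<kappa> M))"
    by (rule card_SigmaI) (auto simp: finite_ssyt)
  finally show ?thesis by (simp add: mcoeff_schur)
qed

section \<open>The Pieri rule and Littlewood--Richardson coefficients\<close>

lemma mcoeff_simps [simp]:
  "mcoeff 0 M = 0" "mcoeff (f + g) M = mcoeff f M + mcoeff g M"
  "mcoeff (f - g) M = mcoeff f M - mcoeff g M" "mcoeff (- f) M = - mcoeff f M"
  "mcoeff (mconst c) M = (if M = {#} then c else 0)"
  "mcoeff 1 M = (if M = {#} then 1 else 0)"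
  by (simp_all add: zero_mfps.rep_eq plus_mfps.rep_eq minus_mfps.rep_eq uminus_mfps.rep_eq
      mconst_def one_mfps.rep_eq)

lemma mcoeff_times: "mcoeff (f * g) M = (\<Sum>(A, B) | A + B = M. mcoeff f A * mcoeff g B)"
  by (simp add: times_mfps.rep_eq)

lemma mcoeff_sum [simp]: "mcoeff (\<Sum>i\<in>I. F i) M = (\<Sum>i\<in>I. mcoeff (F i) M)"
  by (induction I rule: infinite_finite_induct) auto

lemma mcoeff_mconst_times [simp]:
  fixes f :: "('v, 'a::comm_ring_1) mfps"
  shows "mcoeff (mconst c * f) M = c * mcoeff f M"
proof -
  have "mcoeff (mconst c * f) M = (\<Sum>(A, B)\<in>{({#} :: 'v multiset, M)}. mcoeff (mconst c) A * mcoeff f B)"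
    unfolding mcoeff_times
    by (rule sum.mono_neutral_right) (auto simp: finite_mset_splits split: if_splits)
  then show ?thesis by simp
qed

lemma mconst_arith:
  "mconst (a + b) = mconst a + mconst b" "mconst (a * b) = mconst a * mconst b"
  "mconst (a - b) = mconst a - mconst b" "mconst 0 = 0" "mconst 1 = 1"
  by (rule mfps_eqI; simp)+

lemma mset_split_off: "filter_mset (\<lambda>x. x \<noteq> z) M + replicate_mset (count M z) z = M"
  by (rule multiset_eqI) auto

text \<open>
  Expands a product in powers of a single variable \<open>z\<close>, so that coefficient identities can be proved by
  induction on the number of variables.
\<close>

lemma mcoeff_times_replicate:
  assumes z: "z \<notin># M"
  shows "mcoeff (F * G) (M + replicate_mset a z) =
    (\<Sum>j\<le>a. \<Sum>(A, B) | A + B = M.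
       mcoeff F (A + replicate_mset j z) * mcoeff G (B + replicate_mset (a - j) z))"
proof -
  let ?f = "\<lambda>x. x \<noteq> z"
  have filt: "filter_mset ?f X = X" if "z \<notin># X" for X
    by (rule multiset_eqI) (use that in \<open>auto simp: not_in_iff\<close>)
  note fM = filt[OF z]
  have fr: "filter_mset ?f (replicate_mset k z) = {#}" for k by (induction k) auto
  have "mcoeff (F * G) (M + replicate_mset a z) =
      (\<Sum>(j, (A, B))\<in>{..a} \<times> {(A, B). A + B = M}.
        mcoeff F (A + replicate_mset j z) * mcoeff G (B + replicate_mset (a - j) z))"
    unfolding mcoeff_times
  proof (rule sum.reindex_bij_witness[where
        i = "\<lambda>(j, (A, B)). (A + replicate_mset j z, B + replicate_mset (a - j) z)" and
        j = "\<lambda>(A, B). (count A z, (filter_mset ?f A, filter_mset ?f B))"], goal_cases)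
    case (1 p)
    obtain A B where p: "p = (A, B)" "A + B = M + replicate_mset a z" using 1 by auto
    have "count A z + count B z = a" using arg_cong[OF p(2), of "\<lambda>X. count X z"] z
      by (simp add: not_in_iff)
    then have "a - count A z = count B z" by simp
    then show ?case by (simp add: p mset_split_off)
  next
    case (2 p)
    obtain A B where p: "p = (A, B)" "A + B = M + replicate_mset a z" using 2 by auto
    have "count A z + count B z = a" using arg_cong[OF p(2), of "\<lambda>X. count X z"] z
      by (simp add: not_in_iff)
    moreover have "filter_mset ?f A + filter_mset ?f B = M"
      using arg_cong[OF p(2), of "filter_mset ?f"] by (simp add: fM fr)
    ultimately show ?case by (simp add: p)
  next
    case (3 p)
    then obtain j A B where p: "p = (j, (A, B))" "A + B = M" "j \<le> a" by auto
    then have "z \<notin># A" "z \<notin># B" using z by auto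
    then have "filter_mset ?f A = A" "filter_mset ?f B = B" "count A z = 0"
      using filt by (auto simp: not_in_iff)
    then show ?case by (simp add: p fr)
  next
    case (4 p)
    then obtain j A B where p: "p = (j, (A, B))" "A + B = M" "j \<le> a" by auto
    have "replicate_mset a z = replicate_mset j z + replicate_mset (a - j) z"
      by (rule multiset_eqI) (use p(3) in auto)
    then show ?case using p by (auto simp: ac_simps)
  next
    case (5 p)
    obtain A B where p: "p = (A, B)" "A + B = M + replicate_mset a z" using 5 by auto
    have "count A z + count B z = a" using arg_cong[OF p(2), of "\<lambda>X. count X z"] z
      by (simp add: not_in_iff)
    then have "a - count A z = count B z" by simp
    then show ?case by (simp add: p mset_split_off)
  qed
  also have "\<dots> = (\<Sum>j\<le>a. \<Sum>(A, B) | A + B = M.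
       mcoeff F (A + replicate_mset j z) * mcoeff G (B + replicate_mset (a - j) z))"
    by (simp add: sum.cartesian_product case_prod_unfold)
  finally show ?thesis .
qed

lemma mset_bounded:
  fixes M :: "nat multiset"
  assumes "0 \<notin># M"
  obtains m where "set_mset M \<subseteq> {1..m}"
proof -
  have "set_mset M \<subseteq> {1..Max (insert 0 (set_mset M))}"
  proof
    fix x assume "x \<in># M"
    moreover from this have "x \<noteq> 0" using assms by (cases "x = 0") auto
    ultimately show "x \<in> {1..Max (insert 0 (set_mset M))}" by (auto intro: Max_ge)
  qed
  then show ?thesis using that by blast
qed

text \<open>
  All copies of the largest variable are added in one step, which is how the branching rule peels it
  off.
\<close>

lemma mset_bounded_induct [consumes 1, case_names empty step]:
  fixes M :: "nat multiset"
  assumes "set_mset M \<subseteq> {1..m}"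
    and "P 0 {#}"
    and "\<And>m M a. set_mset M \<subseteq> {1..m} \<Longrightarrow> P m M \<Longrightarrow> P (Suc m) (M + replicate_mset a (Suc m))"
  shows "P m M"
  using assms(1)
proof (induction m arbitrary: M)
  case 0
  then show ?case using assms(2) by simp
next
  case (Suc m)
  let ?M = "filter_mset (\<lambda>x. x \<noteq> Suc m) M"
  have sub: "set_mset ?M \<subseteq> {1..m}" using Suc.prems by (auto simp: le_Suc_eq)
  from assms(3)[OF this Suc.IH[OF this], of "count M (Suc m)"] show ?case
    by (simp only: mset_split_off)
qed

text \<open>
  The complete homogeneous symmetric function $h_r$.
\<close>

definition hfun :: "nat \<Rightarrow> (nat, int) mfps" where
  "hfun r = Abs_mfps (\<lambda>M. if 0 \<notin># M \<and> size M = r then 1 else 0)"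

lemma mcoeff_hfun: "mcoeff (hfun r) M = (if 0 \<notin># M \<and> size M = r then 1 else 0)"
  by (simp add: hfun_def)

lemma empty_in_pieri_up: "empty_partition \<in> pieri_up r \<kappa> \<longleftrightarrow> \<kappa> = empty_partition \<and> r = 0"
  by (auto simp: pieri_up_def hstrip_def psize_eq_0_iff)

text \<open>
  The Pieri rule, by induction on the number of variables. By the branching rule the coefficient of
  the power \<open>a\<close> of a new variable on the left is a sum over first adding a strip of size \<open>r\<close> and then
  removing one of size \<open>a\<close>. After commuting the two, the size \<open>j\<close> of the excess is the exponent that
  the new variable has in $h_r$.
\<close>

lemma schur_pieri: "(\<Sum>\<nu>\<in>pieri_up r \<kappa>. schur \<nu>) = hfun r * schur \<kappa>"
proof (rule mfps_eqI)
  fix M :: "nat multiset"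
  show "mcoeff (\<Sum>\<nu>\<in>pieri_up r \<kappa>. schur \<nu>) M = mcoeff (hfun r * schur \<kappa>) M"
  proof (cases "0 \<in># M")
    case True
    then have "mcoeff (hfun r) A * mcoeff (schur \<kappa>) B = 0" if "A + B = M" for A B
      using that mcoeff_schur_0[of B \<kappa>] by (auto simp: mcoeff_hfun)
    then have "mcoeff (hfun r * schur \<kappa>) M = 0" unfolding mcoeff_times by (intro sum.neutral) auto
    then show ?thesis using True by (simp add: mcoeff_schur_0)
  next
    case False
    then obtain m where "set_mset M \<subseteq> {1..m}" by (rule mset_bounded)
    then have "\<forall>r \<kappa>. (\<Sum>\<nu>\<in>pieri_up r \<kappa>. mcoeff (schur \<nu>) M) = mcoeff (hfun r * schur \<kappa>) M"
    proof (induction rule: mset_bounded_induct)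
      case empty
      have s: "{(A, B). A + B = {#}} = {({#}, {#} :: nat multiset)}" by auto
      show ?case
        by (auto simp: mcoeff_times s mcoeff_schur_empty_mset mcoeff_hfun empty_in_pieri_up
            sum.delta if_distrib cong: if_cong)
    next
      case (step m M a)
      let ?z = "Suc m"
      have z: "?z \<notin># M" using step(1) by auto
      show ?case
      proof (intro allI)
        fix r \<kappa>
        have "(\<Sum>\<nu>\<in>pieri_up r \<kappa>. mcoeff (schur \<nu>) (M + replicate_mset a ?z)) =
            (\<Sum>\<nu>\<in>pieri_up r \<kappa>. \<Sum>\<theta>\<in>pieri_down a \<nu>. mcoeff (schur \<theta>) M)"
          by (simp only: schur_branching[OF step(1)])
        also have "\<dots> = (\<Sum>j\<le>min a r. \<Sum>\<eta>\<in>pieri_down (a - j) \<kappa>. mcoeff (hfun (r - j) * schur \<eta>) M)"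
          unfolding pieri_commute using step(2) by simp
        also have "\<dots> = (\<Sum>j\<le>min a r. \<Sum>(A, B) | A + B = M.
            mcoeff (hfun (r - j)) A * (\<Sum>\<eta>\<in>pieri_down (a - j) \<kappa>. mcoeff (schur \<eta>) B))"
          unfolding mcoeff_times case_prod_unfold sum_distrib_left
          by (rule sum.cong[OF refl], rule sum.swap)
        also have "\<dots> = (\<Sum>j\<le>min a r. \<Sum>(A, B) | A + B = M.
            mcoeff (hfun r) (A + replicate_mset j ?z) * mcoeff (schur \<kappa>) (B + replicate_mset (a - j) ?z))"
        proof (intro sum.cong refl, goal_cases)
          case (1 j p)
          then obtain A B where M: "M = A + B" and p: "p = (A, B)" and j: "j \<in> {..min a r}" by auto
          have "set_mset B \<subseteq> {1..m}" using step(1) M by auto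
          from schur_branching[OF this] show ?case
            using j by (auto simp: p mcoeff_hfun)
        qed
        also have "\<dots> = (\<Sum>j\<le>a. \<Sum>(A, B) | A + B = M.
            mcoeff (hfun r) (A + replicate_mset j ?z) * mcoeff (schur \<kappa>) (B + replicate_mset (a - j) ?z))"
          by (rule sum.mono_neutral_left) (auto simp: mcoeff_hfun intro!: sum.neutral)
        also have "\<dots> = mcoeff (hfun r * schur \<kappa>) (M + replicate_mset a ?z)"
          by (rule mcoeff_times_replicate[OF z, symmetric])
        finally show "(\<Sum>\<nu>\<in>pieri_up r \<kappa>. mcoeff (schur \<nu>) (M + replicate_mset a ?z)) =
          mcoeff (hfun r * schur \<kappa>) (M + replicate_mset a ?z)" .
      qed
    qed
    then show ?thesis by simp
  qed
qed

abbreviation partitions :: "nat \<Rightarrow> partition set" where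
  "partitions n \<equiv> {\<mu>. psize \<mu> = n}"

lemma sum_fun_apply: "(\<Sum>i\<in>I. f i) x = (\<Sum>i\<in>I. f i x :: 'b::comm_monoid_add)"
  by (induction I rule: infinite_finite_induct) auto

text \<open>
  The coefficient of $x_{m+1}^r$ in a linear relation \<open>c\<close> between Schur functions is again such a
  relation, with coefficients $c'_\kappa = \sum_{\nu} c_\nu$ over the strips of size \<open>r\<close> on \<open>\<kappa>\<close>. So if the
  coefficient at \<open>\<kappa>\<close> vanishes in every relation, then so does that sum, and \<open>pieri_induct\<close> applies.
\<close>

lemma schur_independent:
  fixes c :: "partition \<Rightarrow> int"
  assumes S: "finite S" "\<And>\<rho>. \<rho> \<notin> S \<Longrightarrow> c \<rho> = 0"
    and zero: "\<And>M. 0 \<notin># M \<Longrightarrow> (\<Sum>\<rho>\<in>S. c \<rho> * mcoeff (schur \<rho>) M) = 0"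
  shows "c \<rho> = 0"
proof -
  define relS where "relS = (\<lambda>S (c :: partition \<Rightarrow> int). finite S \<and> (\<forall>\<rho>. \<rho> \<notin> S \<longrightarrow> c \<rho> = 0) \<and>
    (\<forall>M. 0 \<notin># M \<longrightarrow> (\<Sum>\<rho>\<in>S. c \<rho> * mcoeff (schur \<rho>) M) = 0))"
  define rel where "rel = (\<lambda>c. \<exists>S. relS S c)"
  \<comment> \<open>The functional that reads off the coefficient at \<open>\<rho>\<close>, restricted to relations; \<open>pieri_induct\<close> is
    used in the group of functions under pointwise subtraction.\<close>
  define e :: "partition \<Rightarrow> (partition \<Rightarrow> int) \<Rightarrow> int" where "e = (\<lambda>\<rho> c. if rel c then c \<rho> else 0)"
  have "e \<rho> \<in> {0}"
  proof (rule pieri_induct)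
    have "c empty_partition = 0" if rc: "rel c" for c
    proof -
      obtain S where "relS S c" using rc unfolding rel_def by blast
      then have S: "finite S" "\<forall>\<rho>. \<rho> \<notin> S \<longrightarrow> c \<rho> = 0"
        "\<forall>M. 0 \<notin># M \<longrightarrow> (\<Sum>\<rho>\<in>S. c \<rho> * mcoeff (schur \<rho>) M) = 0"
        unfolding relS_def by blast+
      have "(\<Sum>\<rho>\<in>S. c \<rho> * mcoeff (schur \<rho>) {#}) = 0"
        by (rule S(3)[rule_format]) simp
      also have "(\<Sum>\<rho>\<in>S. c \<rho> * mcoeff (schur \<rho>) {#}) = (\<Sum>\<rho>\<in>S. if \<rho> = empty_partition then c \<rho> else 0)"
        by (rule sum.cong) (auto simp: mcoeff_schur_empty_mset)
      finally show ?thesis using S(1,2) by (auto simp: sum.delta split: if_splits)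
    qed
    then show "e empty_partition \<in> {0}" by (auto simp: e_def fun_eq_iff)
  next
    fix \<kappa> r assume "e \<kappa> \<in> {0}"
    then have IH: "rel c \<Longrightarrow> c \<kappa> = 0" for c by (auto simp: e_def fun_eq_iff split: if_splits)
    have "(\<Sum>\<nu>\<in>pieri_up r \<kappa>. c \<nu>) = 0" if rc: "rel c" for c
    proof -
      obtain S where "relS S c" using rc unfolding rel_def by blast
      then have S: "finite S" "\<forall>\<rho>. \<rho> \<notin> S \<longrightarrow> c \<rho> = 0"
        "\<forall>M. 0 \<notin># M \<longrightarrow> (\<Sum>\<rho>\<in>S. c \<rho> * mcoeff (schur \<rho>) M) = 0"
        unfolding relS_def by blast+
      define S' where "S' = (\<Union>\<rho>\<in>S. pieri_down r \<rho>)"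
      define c' where "c' = (\<lambda>\<kappa>. \<Sum>\<nu>\<in>pieri_up r \<kappa>. c \<nu>)"
      have c'S: "c' \<kappa> = (\<Sum>\<rho>\<in>S. if \<kappa> \<in> pieri_down r \<rho> then c \<rho> else 0)" for \<kappa>
      proof -
        have "c' \<kappa> = (\<Sum>\<nu>\<in>pieri_up r \<kappa> \<inter> S. c \<nu>)"
          unfolding c'_def by (rule sum.mono_neutral_right) (use S in auto)
        also have "\<dots> = (\<Sum>\<rho>\<in>{\<rho>\<in>S. \<kappa> \<in> pieri_down r \<rho>}. c \<rho>)"
          by (rule sum.cong) (auto simp: pieri_up_down)
        also have "\<dots> = (\<Sum>\<rho>\<in>S. if \<kappa> \<in> pieri_down r \<rho> then c \<rho> else 0)"
          using S(1) by (rule sum.inter_filter)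
        finally show ?thesis .
      qed
      have "finite S'" using S(1) by (simp add: S'_def)
      moreover have "c' \<kappa> = 0" if "\<kappa> \<notin> S'" for \<kappa>
        unfolding c'S by (rule sum.neutral) (use that in \<open>auto simp: S'_def\<close>)
      moreover have "(\<Sum>\<kappa>\<in>S'. c' \<kappa> * mcoeff (schur \<kappa>) M) = 0" if M: "0 \<notin># M" for M
      proof -
        obtain m where m: "set_mset M \<subseteq> {1..m}" using M by (rule mset_bounded)
        have "(\<Sum>\<kappa>\<in>S'. c' \<kappa> * mcoeff (schur \<kappa>) M) =
            (\<Sum>\<kappa>\<in>S'. \<Sum>\<rho>\<in>S. if \<kappa> \<in> pieri_down r \<rho> then c \<rho> * mcoeff (schur \<kappa>) M else 0)"
          unfolding c'S sum_distrib_right by (intro sum.cong refl) simp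
        also have "\<dots> = (\<Sum>\<rho>\<in>S. \<Sum>\<kappa>\<in>S'. if \<kappa> \<in> pieri_down r \<rho> then c \<rho> * mcoeff (schur \<kappa>) M else 0)"
          by (rule sum.swap)
        also have "\<dots> = (\<Sum>\<rho>\<in>S. \<Sum>\<kappa>\<in>pieri_down r \<rho>. c \<rho> * mcoeff (schur \<kappa>) M)"
        proof (rule sum.cong[OF refl])
          fix \<rho> assume "\<rho> \<in> S"
          then have "{\<kappa>\<in>S'. \<kappa> \<in> pieri_down r \<rho>} = pieri_down r \<rho>" by (auto simp: S'_def)
          then show "(\<Sum>\<kappa>\<in>S'. if \<kappa> \<in> pieri_down r \<rho> then c \<rho> * mcoeff (schur \<kappa>) M else 0) =
              (\<Sum>\<kappa>\<in>pieri_down r \<rho>. c \<rho> * mcoeff (schur \<kappa>) M)"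
            using \<open>finite S'\<close> by (simp flip: sum.inter_filter)
        qed
        also have "\<dots> = (\<Sum>\<rho>\<in>S. c \<rho> * mcoeff (schur \<rho>) (M + replicate_mset r (Suc m)))"
          by (simp add: schur_branching[OF m] sum_distrib_left)
        also have "\<dots> = 0" by (rule S(3)[rule_format]) (use M in auto)
        finally show ?thesis .
      qed
      ultimately have "relS S' c'" unfolding relS_def by blast
      then have "rel c'" unfolding rel_def by blast
      then show ?thesis using IH[of c'] by (simp add: c'_def)
    qed
    then have "(\<Sum>\<nu>\<in>pieri_up r \<kappa>. e \<nu>) c = 0" for c
      by (cases "rel c") (simp_all add: sum_fun_apply e_def)
    then show "(\<Sum>\<nu>\<in>pieri_up r \<kappa>. e \<nu>) \<in> {0}" by (auto simp: fun_eq_iff)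
  qed auto
  moreover have "relS S c" unfolding relS_def using assms by blast
  then have "rel c" unfolding rel_def by blast
  ultimately show ?thesis by (auto simp: e_def fun_eq_iff split: if_splits)
qed

definition schur_span :: "(nat, int) mfps set" where
  "schur_span = {F. \<exists>c. finite {\<alpha>. c \<alpha> \<noteq> 0} \<and> F = (\<Sum>\<alpha> | c \<alpha> \<noteq> 0. mconst (c \<alpha>) * schur \<alpha>)}"

lemma schur_spanI:
  assumes "finite A"
  shows "(\<Sum>\<alpha>\<in>A. mconst (c \<alpha>) * schur \<alpha>) \<in> schur_span"
proof -
  define d where "d = (\<lambda>\<alpha>. if \<alpha> \<in> A then c \<alpha> else 0)"
  have "finite {\<alpha>. d \<alpha> \<noteq> 0}" by (rule finite_subset[OF _ assms]) (auto simp: d_def)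
  moreover have "(\<Sum>\<alpha>\<in>A. mconst (c \<alpha>) * schur \<alpha>) = (\<Sum>\<alpha> | d \<alpha> \<noteq> 0. mconst (d \<alpha>) * schur \<alpha>)"
    by (rule sum.mono_neutral_cong_right) (use assms in \<open>auto simp: d_def mconst_arith\<close>)
  ultimately show ?thesis unfolding schur_span_def by blast
qed

lemma schur_in_span: "schur \<alpha> \<in> schur_span"
  using schur_spanI[of "{\<alpha>}" "\<lambda>_. 1"] by (simp add: mconst_arith)

lemma schur_span_diff:
  assumes "F \<in> schur_span" "G \<in> schur_span"
  shows "F - G \<in> schur_span"
proof -
  obtain c d where c: "finite {\<alpha>. c \<alpha> \<noteq> 0}" "F = (\<Sum>\<alpha> | c \<alpha> \<noteq> 0. mconst (c \<alpha>) * schur \<alpha>)"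
    and d: "finite {\<alpha>. d \<alpha> \<noteq> 0}" "G = (\<Sum>\<alpha> | d \<alpha> \<noteq> 0. mconst (d \<alpha>) * schur \<alpha>)"
    using assms by (auto simp: schur_span_def)
  let ?A = "{\<alpha>. c \<alpha> \<noteq> 0} \<union> {\<alpha>. d \<alpha> \<noteq> 0}"
  have "F = (\<Sum>\<alpha>\<in>?A. mconst (c \<alpha>) * schur \<alpha>)"
    unfolding c by (rule sum.mono_neutral_left) (use c d in \<open>auto simp: mconst_arith\<close>)
  moreover have "G = (\<Sum>\<alpha>\<in>?A. mconst (d \<alpha>) * schur \<alpha>)"
    unfolding d by (rule sum.mono_neutral_left) (use c d in \<open>auto simp: mconst_arith\<close>)
  ultimately have "F - G = (\<Sum>\<alpha>\<in>?A. mconst (c \<alpha> - d \<alpha>) * schur \<alpha>)"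
    by (simp add: mconst_arith left_diff_distrib flip: sum_subtractf)
  then show ?thesis using schur_spanI[of ?A] c d by auto
qed

lemma schur_span_sum:
  assumes "\<And>i. i \<in> I \<Longrightarrow> F i \<in> schur_span"
  shows "(\<Sum>i\<in>I. F i) \<in> schur_span"
proof -
  have zero: "0 \<in> schur_span" using schur_spanI[of "{}"] by simp
  have "F + G \<in> schur_span" if "F \<in> schur_span" "G \<in> schur_span" for F G
    using schur_span_diff[OF that(1) schur_span_diff[OF zero that(2)]] by simp
  then show ?thesis using assms
    by (induction I rule: infinite_finite_induct) (auto simp: zero)
qed

lemma hfun_times_span:
  assumes "F \<in> schur_span"
  shows "hfun r * F \<in> schur_span"
proof -
  obtain c where c: "finite {\<alpha>. c \<alpha> \<noteq> 0}" "F = (\<Sum>\<alpha> | c \<alpha> \<noteq> 0. mconst (c \<alpha>) * schur \<alpha>)"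
    using assms by (auto simp: schur_span_def)
  have "hfun r * F = (\<Sum>\<alpha> | c \<alpha> \<noteq> 0. \<Sum>\<nu>\<in>pieri_up r \<alpha>. mconst (c \<alpha>) * schur \<nu>)"
    unfolding c sum_distrib_left
    by (intro sum.cong refl) (simp add: mult.left_commute schur_pieri flip: sum_distrib_left)
  also have "\<dots> \<in> schur_span"
    by (intro schur_span_sum schur_spanI) simp
  finally show ?thesis .
qed

lemma schur_empty [simp]: "schur empty_partition = 1"
proof (rule mfps_eqI)
  fix M show "mcoeff (schur empty_partition) M = mcoeff 1 M"
    using mcoeff_schur_size[of empty_partition M]
    by (cases "M = {#}") (auto simp: mcoeff_schur_empty_mset)
qed

text \<open>
  The span is closed under multiplication by each $h_r$, hence by \<open>pieri_induct\<close> under multiplication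
  by each Schur function.
\<close>

lemma schur_times_in_span: "schur \<rho> * schur \<eta> \<in> schur_span"
proof -
  have "schur \<rho> \<in> {F. \<forall>\<eta>. F * schur \<eta> \<in> schur_span}"
  proof (rule pieri_induct)
    fix \<kappa> r assume IH: "schur \<kappa> \<in> {F. \<forall>\<eta>. F * schur \<eta> \<in> schur_span}"
    show "(\<Sum>\<nu>\<in>pieri_up r \<kappa>. schur \<nu>) \<in> {F. \<forall>\<eta>. F * schur \<eta> \<in> schur_span}"
      unfolding schur_pieri using IH hfun_times_span[of "schur \<kappa> * schur _"] by (simp add: mult.assoc)
  qed (auto simp: schur_in_span left_diff_distrib intro: schur_span_diff)
  then show ?thesis by blast
qed

lemma mcoeff_lincomb:
  assumes "finite A" "\<And>\<alpha>. \<alpha> \<notin> A \<Longrightarrow> c \<alpha> = 0"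
  shows "mcoeff (\<Sum>\<alpha> | c \<alpha> \<noteq> 0. mconst (c \<alpha>) * schur \<alpha>) M = (\<Sum>\<alpha>\<in>A. c \<alpha> * mcoeff (schur \<alpha>) M)"
proof -
  have "(\<Sum>\<alpha> | c \<alpha> \<noteq> 0. c \<alpha> * mcoeff (schur \<alpha>) M) = (\<Sum>\<alpha>\<in>A. c \<alpha> * mcoeff (schur \<alpha>) M)"
    by (rule sum.mono_neutral_left) (use assms in auto)
  then show ?thesis by simp
qed

lemma schur_lincomb_inject:
  assumes c: "finite {\<alpha>. c \<alpha> \<noteq> 0}" and d: "finite {\<alpha>. d \<alpha> \<noteq> 0}"
    and eq: "(\<Sum>\<alpha> | c \<alpha> \<noteq> 0. mconst (c \<alpha>) * schur \<alpha>) = (\<Sum>\<alpha> | d \<alpha> \<noteq> 0. mconst (d \<alpha>) * schur \<alpha>)"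
  shows "c = d"
proof
  fix \<rho>
  let ?A = "{\<alpha>. c \<alpha> \<noteq> 0} \<union> {\<alpha>. d \<alpha> \<noteq> 0}"
  have "(\<Sum>\<alpha>\<in>?A. c \<alpha> * mcoeff (schur \<alpha>) M) = (\<Sum>\<alpha>\<in>?A. d \<alpha> * mcoeff (schur \<alpha>) M)" for M
    using arg_cong[OF eq, of "\<lambda>F. mcoeff F M"] c d
    by (subst (asm) (1 2) mcoeff_lincomb[of ?A]) auto
  then have "(\<Sum>\<alpha>\<in>?A. (c \<alpha> - d \<alpha>) * mcoeff (schur \<alpha>) M) = 0" for M
    by (simp add: left_diff_distrib sum_subtractf)
  then have "c \<rho> - d \<rho> = 0"
    by (intro schur_independent[of ?A "\<lambda>\<alpha>. c \<alpha> - d \<alpha>" \<rho>]) (use c d in auto)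
  then show "c \<rho> = d \<rho>" by simp
qed

text \<open>
  The span contains the product, which gives existence, and linear independence gives uniqueness of
  the family that defines \<open>lr\<close>.
\<close>

lemma lr_expansion:
  "finite {\<alpha>. lr \<alpha> \<nu> \<rho> \<noteq> 0}"
  "schur \<nu> * schur \<rho> = (\<Sum>\<alpha> | lr \<alpha> \<nu> \<rho> \<noteq> 0. mconst (lr \<alpha> \<nu> \<rho>) * schur \<alpha>)"
proof -
  let ?P = "\<lambda>c. finite {\<alpha>. c \<alpha> \<noteq> 0} \<and>
     schur \<nu> * schur \<rho> = (\<Sum>\<alpha> | c \<alpha> \<noteq> 0. mconst (c \<alpha>) * schur \<alpha>)"
  have "\<exists>!c. ?P c"
    using schur_times_in_span[of \<nu> \<rho>] by (auto simp: schur_span_def intro!: schur_lincomb_inject)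
  then have "?P (THE c. ?P c)" by (rule theI')
  moreover have "(THE c. ?P c) = (\<lambda>\<alpha>. lr \<alpha> \<nu> \<rho>)" by (simp add: lr_def fun_eq_iff)
  ultimately have "?P (\<lambda>\<alpha>. lr \<alpha> \<nu> \<rho>)" by metis
  then show "finite {\<alpha>. lr \<alpha> \<nu> \<rho> \<noteq> 0}"
    "schur \<nu> * schur \<rho> = (\<Sum>\<alpha> | lr \<alpha> \<nu> \<rho> \<noteq> 0. mconst (lr \<alpha> \<nu> \<rho>) * schur \<alpha>)" by auto
qed

lemma mcoeff_schur_times_size: "mcoeff (schur \<nu> * schur \<rho>) M \<noteq> 0 \<Longrightarrow> size M = psize \<nu> + psize \<rho>"
proof -
  assume "mcoeff (schur \<nu> * schur \<rho>) M \<noteq> 0"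
  then obtain A B where "A + B = M" "mcoeff (schur \<nu>) A \<noteq> 0" "mcoeff (schur \<rho>) B \<noteq> 0"
    unfolding mcoeff_times using sum.neutral[of "{(A, B). A + B = M}"
      "\<lambda>(A, B). mcoeff (schur \<nu>) A * mcoeff (schur \<rho>) B"] by force
  then show ?thesis using mcoeff_schur_size by fastforce
qed

text \<open>
  Schur functions are homogeneous, so the part of the expansion in any other degree is a relation
  between Schur functions.
\<close>

lemma lr_size:
  assumes "lr \<alpha> \<nu> \<rho> \<noteq> 0"
  shows "psize \<alpha> = psize \<nu> + psize \<rho>"
proof (rule ccontr)
  assume ne: "psize \<alpha> \<noteq> psize \<nu> + psize \<rho>"
  let ?A = "{\<alpha>. lr \<alpha> \<nu> \<rho> \<noteq> 0}"
  define c where "c = (\<lambda>\<alpha>. if psize \<alpha> = psize \<nu> + psize \<rho> then 0 else lr \<alpha> \<nu> \<rho>)"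
  have "c \<alpha> = 0"
  proof (rule schur_independent[of ?A])
    fix M :: "nat multiset"
    show "(\<Sum>\<alpha>\<in>?A. c \<alpha> * mcoeff (schur \<alpha>) M) = 0"
    proof (cases "size M = psize \<nu> + psize \<rho>")
      case True
      then have "c \<alpha> * mcoeff (schur \<alpha>) M = 0" for \<alpha>
        using mcoeff_schur_size[of \<alpha> M] by (auto simp: c_def)
      then show ?thesis by (intro sum.neutral) simp
    next
      case False
      then have "c \<alpha> * mcoeff (schur \<alpha>) M = lr \<alpha> \<nu> \<rho> * mcoeff (schur \<alpha>) M" for \<alpha>
        using mcoeff_schur_size[of \<alpha> M] by (cases "mcoeff (schur \<alpha>) M = 0") (auto simp: c_def)
      then have "(\<Sum>\<alpha>\<in>?A. c \<alpha> * mcoeff (schur \<alpha>) M) = mcoeff (schur \<nu> * schur \<rho>) M"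
        by (simp only: lr_expansion(2) mcoeff_sum mcoeff_mconst_times)
      then show ?thesis using False mcoeff_schur_times_size by metis
    qed
  qed (auto simp: lr_expansion(1) c_def)
  then show False using ne assms by (simp add: c_def)
qed

lemma mcoeff_schur_times:
  "mcoeff (schur \<nu> * schur \<rho>) M = (\<Sum>\<alpha>\<in>partitions (psize \<nu> + psize \<rho>). lr \<alpha> \<nu> \<rho> * mcoeff (schur \<alpha>) M)"
  unfolding lr_expansion(2)
  by (rule mcoeff_lincomb) (use lr_size finite_psize_eq in auto)

lemma schur_coeffs_eqI:
  fixes c d :: "partition \<Rightarrow> int"
  assumes "\<And>M. 0 \<notin># M \<Longrightarrow> (\<Sum>\<alpha>\<in>partitions n. c \<alpha> * mcoeff (schur \<alpha>) M) =
      (\<Sum>\<alpha>\<in>partitions n. d \<alpha> * mcoeff (schur \<alpha>) M)"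
    and "psize \<alpha> = n"
  shows "c \<alpha> = d \<alpha>"
proof -
  let ?c = "\<lambda>\<alpha>. if psize \<alpha> = n then c \<alpha> - d \<alpha> else 0"
  have "?c \<alpha> = 0"
  proof (rule schur_independent[of "partitions n"])
    fix M :: "nat multiset" assume "0 \<notin># M"
    then show "(\<Sum>\<alpha>\<in>partitions n. ?c \<alpha> * mcoeff (schur \<alpha>) M) = 0"
      using assms(1)[of M] by (simp add: left_diff_distrib sum_subtractf)
  qed (auto simp: finite_psize_eq)
  then show ?thesis using assms(2) by simp
qed

lemma lr_empty: "lr \<alpha> \<nu> empty_partition = (if \<alpha> = \<nu> then 1 else 0)"
proof (cases "psize \<alpha> = psize \<nu>")
  case True
  show ?thesis
  proof (rule schur_coeffs_eqI[where \<alpha> = \<alpha> and c = "\<lambda>\<alpha>. lr \<alpha> \<nu> empty_partition"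
        and d = "\<lambda>\<alpha>. if \<alpha> = \<nu> then 1 else 0", OF _ True])
    fix M
    show "(\<Sum>\<alpha>\<in>partitions (psize \<nu>). lr \<alpha> \<nu> empty_partition * mcoeff (schur \<alpha>) M) =
        (\<Sum>\<alpha>\<in>partitions (psize \<nu>). (if \<alpha> = \<nu> then 1 else 0) * mcoeff (schur \<alpha>) M)"
      using mcoeff_schur_times[of \<nu> empty_partition M]
      by (simp add: sum.delta finite_psize_eq if_distrib[of "\<lambda>x. x * _"] cong: if_cong)
  qed
next
  case False
  then show ?thesis using lr_size[of \<alpha> \<nu> empty_partition] by auto
qed

lemma sum_up_down_swap:
  fixes f :: "partition \<Rightarrow> partition \<Rightarrow> 'a::comm_monoid_add"
  shows "(\<Sum>\<kappa>\<in>partitions n. \<Sum>\<nu>\<in>pieri_up r \<kappa>. f \<nu> \<kappa>) =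
    (\<Sum>\<nu>\<in>partitions (n + r). \<Sum>\<kappa>\<in>pieri_down r \<nu>. f \<nu> \<kappa>)"
proof -
  have "(\<Sum>\<kappa>\<in>partitions n. \<Sum>\<nu>\<in>pieri_up r \<kappa>. f \<nu> \<kappa>) = (\<Sum>(\<kappa>, \<nu>)\<in>Sigma (partitions n) (pieri_up r). f \<nu> \<kappa>)"
    by (rule sum.Sigma) (auto simp: finite_psize_eq)
  also have "\<dots> = (\<Sum>(\<nu>, \<kappa>)\<in>Sigma (partitions (n + r)) (pieri_down r). f \<nu> \<kappa>)"
    by (rule sum.reindex_bij_witness[of _ prod.swap prod.swap]) (auto simp: pieri_up_def pieri_down_def)
  also have "\<dots> = (\<Sum>\<nu>\<in>partitions (n + r). \<Sum>\<kappa>\<in>pieri_down r \<nu>. f \<nu> \<kappa>)"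
    by (rule sum.Sigma [symmetric]) (auto simp: finite_psize_eq)
  finally show ?thesis .
qed

text \<open>
  Both sides are expansion coefficients of the coefficient of $x_{m+1}^r$ in $s_\eta s_\rho$: on the left the
  product is expanded first, on the right each factor is branched separately. In other words, the
  operator adjoint to multiplication by $h_r$ obeys the Leibniz rule of a divided power.
\<close>

lemma lr_skew_leibniz:
  "(\<Sum>\<nu>\<in>pieri_up r \<kappa>. lr \<nu> \<eta> \<rho>) =
   (\<Sum>j\<le>r. \<Sum>a\<in>pieri_down j \<eta>. \<Sum>b\<in>pieri_down (r - j) \<rho>. lr \<kappa> a b)"
proof (cases "psize \<kappa> + r = psize \<eta> + psize \<rho>")
  case True
  show ?thesis
  proof (rule schur_coeffs_eqI[where \<alpha> = \<kappa> and c = "\<lambda>\<kappa>. \<Sum>\<nu>\<in>pieri_up r \<kappa>. lr \<nu> \<eta> \<rho>"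
        and d = "\<lambda>\<kappa>. \<Sum>j\<le>r. \<Sum>a\<in>pieri_down j \<eta>. \<Sum>b\<in>pieri_down (r - j) \<rho>. lr \<kappa> a b", OF _ refl])
    fix M :: "nat multiset" assume "0 \<notin># M"
    then obtain m where m: "set_mset M \<subseteq> {1..m}" by (rule mset_bounded)
    then have z: "Suc m \<notin># M" by auto
    let ?n = "psize \<kappa>"
    have "(\<Sum>\<kappa>\<in>partitions ?n. (\<Sum>\<nu>\<in>pieri_up r \<kappa>. lr \<nu> \<eta> \<rho>) * mcoeff (schur \<kappa>) M) =
        (\<Sum>\<nu>\<in>partitions (?n + r). \<Sum>\<kappa>\<in>pieri_down r \<nu>. lr \<nu> \<eta> \<rho> * mcoeff (schur \<kappa>) M)"
      unfolding sum_distrib_right by (rule sum_up_down_swap)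
    also have "\<dots> = mcoeff (schur \<eta> * schur \<rho>) (M + replicate_mset r (Suc m))"
      unfolding mcoeff_schur_times True by (simp add: schur_branching[OF m] sum_distrib_left)
    also have "\<dots> = (\<Sum>j\<le>r. \<Sum>(A, B) | A + B = M.
       mcoeff (schur \<eta>) (A + replicate_mset j (Suc m)) *
       mcoeff (schur \<rho>) (B + replicate_mset (r - j) (Suc m)))"
      by (rule mcoeff_times_replicate[OF z])
    also have "\<dots> = (\<Sum>j\<le>r. \<Sum>(A, B) | A + B = M. \<Sum>a\<in>pieri_down j \<eta>. \<Sum>b\<in>pieri_down (r - j) \<rho>.
       mcoeff (schur a) A * mcoeff (schur b) B)"
    proof (intro sum.cong refl, goal_cases)
      case (1 j p)
      then obtain A B where M: "M = A + B" and p: "p = (A, B)" by auto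
      then have "set_mset A \<subseteq> {1..m}" "set_mset B \<subseteq> {1..m}" using m by auto
      then show ?case by (simp add: p schur_branching sum_product)
    qed
    also have "\<dots> = (\<Sum>j\<le>r. \<Sum>a\<in>pieri_down j \<eta>. \<Sum>b\<in>pieri_down (r - j) \<rho>. mcoeff (schur a * schur b) M)"
      unfolding mcoeff_times case_prod_unfold
      by (rule sum.cong[OF refl], subst sum.swap, rule sum.cong[OF refl], rule sum.swap)
    also have "\<dots> = (\<Sum>j\<le>r. \<Sum>a\<in>pieri_down j \<eta>. \<Sum>b\<in>pieri_down (r - j) \<rho>.
        \<Sum>\<kappa>\<in>partitions ?n. lr \<kappa> a b * mcoeff (schur \<kappa>) M)"
    proof (intro sum.cong refl)
      fix j a b assume "j \<in> {..r}" "a \<in> pieri_down j \<eta>" "b \<in> pieri_down (r - j) \<rho>"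
      then have "psize a + psize b = ?n" using True by (auto simp: pieri_down_def)
      then show "mcoeff (schur a * schur b) M = (\<Sum>\<kappa>\<in>partitions ?n. lr \<kappa> a b * mcoeff (schur \<kappa>) M)"
        unfolding mcoeff_schur_times by simp
    qed
    also have "\<dots> = (\<Sum>\<kappa>\<in>partitions ?n. \<Sum>j\<le>r. \<Sum>a\<in>pieri_down j \<eta>. \<Sum>b\<in>pieri_down (r - j) \<rho>.
        lr \<kappa> a b * mcoeff (schur \<kappa>) M)"
      by (simp only: sum.swap[of _ "partitions ?n"])
    finally show "(\<Sum>\<kappa>\<in>partitions ?n. (\<Sum>\<nu>\<in>pieri_up r \<kappa>. lr \<nu> \<eta> \<rho>) * mcoeff (schur \<kappa>) M) =
      (\<Sum>\<kappa>\<in>partitions ?n. (\<Sum>j\<le>r. \<Sum>a\<in>pieri_down j \<eta>. \<Sum>b\<in>pieri_down (r - j) \<rho>. lr \<kappa> a b) *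
        mcoeff (schur \<kappa>) M)"
      by (simp only: sum_distrib_right)
  qed
next
  case False
  then have "lr \<nu> \<eta> \<rho> = 0" if "\<nu> \<in> pieri_up r \<kappa>" for \<nu>
    using that lr_size[of \<nu> \<eta> \<rho>] by (auto simp: pieri_up_def)
  moreover have "lr \<kappa> a b = 0" if "j \<le> r" "a \<in> pieri_down j \<eta>" "b \<in> pieri_down (r - j) \<rho>" for j a b
    using that lr_size[of \<kappa> a b] False by (auto simp: pieri_down_def)
  ultimately show ?thesis by simp
qed

text \<open>
  Two expansions of $s_\eta s_\kappa h_r$.
\<close>

lemma lr_pieri:
  "(\<Sum>\<nu>\<in>pieri_up r \<kappa>. lr \<alpha> \<eta> \<nu>) = (\<Sum>\<zeta>\<in>pieri_down r \<alpha>. lr \<zeta> \<eta> \<kappa>)"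
proof (cases "psize \<alpha> = psize \<eta> + psize \<kappa> + r")
  case True
  show ?thesis
  proof (rule schur_coeffs_eqI[where \<alpha> = \<alpha> and c = "\<lambda>\<alpha>. \<Sum>\<nu>\<in>pieri_up r \<kappa>. lr \<alpha> \<eta> \<nu>"
        and d = "\<lambda>\<alpha>. \<Sum>\<zeta>\<in>pieri_down r \<alpha>. lr \<zeta> \<eta> \<kappa>", OF _ True])
    fix M :: "nat multiset"
    let ?n = "psize \<eta> + psize \<kappa>"
    have "(\<Sum>\<alpha>\<in>partitions (?n + r). (\<Sum>\<nu>\<in>pieri_up r \<kappa>. lr \<alpha> \<eta> \<nu>) * mcoeff (schur \<alpha>) M) =
        (\<Sum>\<nu>\<in>pieri_up r \<kappa>. \<Sum>\<alpha>\<in>partitions (?n + r). lr \<alpha> \<eta> \<nu> * mcoeff (schur \<alpha>) M)"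
      unfolding sum_distrib_right by (rule sum.swap)
    also have "\<dots> = (\<Sum>\<nu>\<in>pieri_up r \<kappa>. mcoeff (schur \<eta> * schur \<nu>) M)"
      by (intro sum.cong refl) (auto simp: mcoeff_schur_times pieri_up_def add.assoc)
    also have "\<dots> = mcoeff (schur \<eta> * (hfun r * schur \<kappa>)) M"
      by (simp flip: schur_pieri add: sum_distrib_left)
    also have "schur \<eta> * (hfun r * schur \<kappa>) = hfun r * (schur \<eta> * schur \<kappa>)"
      by (rule mult.left_commute)
    also have "schur \<eta> * schur \<kappa> = (\<Sum>\<zeta>\<in>partitions ?n. mconst (lr \<zeta> \<eta> \<kappa>) * schur \<zeta>)"
      by (rule mfps_eqI) (simp add: mcoeff_schur_times)
    also have "hfun r * \<dots> = (\<Sum>\<zeta>\<in>partitions ?n. mconst (lr \<zeta> \<eta> \<kappa>) * (\<Sum>\<alpha>\<in>pieri_up r \<zeta>. schur \<alpha>))"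
      by (simp add: sum_distrib_left schur_pieri mult.left_commute)
    also have "mcoeff \<dots> M = (\<Sum>\<zeta>\<in>partitions ?n. \<Sum>\<alpha>\<in>pieri_up r \<zeta>. lr \<zeta> \<eta> \<kappa> * mcoeff (schur \<alpha>) M)"
      by (simp add: sum_distrib_left)
    also have "\<dots> = (\<Sum>\<alpha>\<in>partitions (?n + r). (\<Sum>\<zeta>\<in>pieri_down r \<alpha>. lr \<zeta> \<eta> \<kappa>) * mcoeff (schur \<alpha>) M)"
      unfolding sum_distrib_right by (rule sum_up_down_swap)
    finally show "(\<Sum>\<alpha>\<in>partitions (?n + r). (\<Sum>\<nu>\<in>pieri_up r \<kappa>. lr \<alpha> \<eta> \<nu>) * mcoeff (schur \<alpha>) M) =
        (\<Sum>\<alpha>\<in>partitions (?n + r). (\<Sum>\<zeta>\<in>pieri_down r \<alpha>. lr \<zeta> \<eta> \<kappa>) * mcoeff (schur \<alpha>) M)" .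
  qed
next
  case False
  then have "lr \<alpha> \<eta> \<nu> = 0" if "\<nu> \<in> pieri_up r \<kappa>" for \<nu>
    using that lr_size[of \<alpha> \<eta> \<nu>] by (auto simp: pieri_up_def)
  moreover have "lr \<zeta> \<eta> \<kappa> = 0" if "\<zeta> \<in> pieri_down r \<alpha>" for \<zeta>
    using that lr_size[of \<zeta> \<eta> \<kappa>] False by (auto simp: pieri_down_def)
  ultimately show ?thesis by simp
qed

section \<open>Multiplicative functionals on Schur functions\<close>

abbreviation partitions_upto :: "nat \<Rightarrow> partition set" where
  "partitions_upto n \<equiv> {\<mu>. psize \<mu> \<le> n}"

definition row_partition :: "nat \<Rightarrow> partition" where
  "row_partition r = Abs_partition (\<lambda>i. if i = 0 then r else 0)"

lemma parts_of_row_partition: "parts_of (row_partition r) i = (if i = 0 then r else 0)"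
  unfolding row_partition_def by (subst parts_of_Abs[where n = 1]) auto

lemma psize_row_partition [simp]: "psize (row_partition r) = r"
proof -
  have "plen (row_partition r) \<le> 1" using parts_of_eq_0_iff[of "row_partition r" 1] by (simp add: parts_of_row_partition)
  from psize_sum[OF this] show ?thesis by (simp add: parts_of_row_partition)
qed

lemma row_partition_0 [simp]: "row_partition 0 = empty_partition"
  using psize_eq_0_iff[of "row_partition 0"] by simp

lemma pieri_up_empty: "pieri_up r empty_partition = {row_partition r}"
proof -
  have u: "\<nu> = row_partition r" if "hstrip \<nu> empty_partition" "psize \<nu> = r" for \<nu>
  proof (rule partition_eqI)
    fix i
    have z: "parts_of \<nu> (Suc i) = 0" for i using that(1) by (simp add: hstrip_def)
    then have "plen \<nu> \<le> 1" using parts_of_eq_0_iff[of \<nu> 1] by simp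
    from psize_sum[OF this] have r: "parts_of \<nu> 0 = r" unfolding that(2) by simp
    show "parts_of \<nu> i = parts_of (row_partition r) i"
    proof (cases i)
      case 0 then show ?thesis using r by (simp add: parts_of_row_partition)
    next
      case (Suc k) show ?thesis unfolding Suc z by (simp add: parts_of_row_partition)
    qed
  qed
  have "hstrip (row_partition r) empty_partition" by (simp add: hstrip_def parts_of_row_partition)
  then show ?thesis by (auto simp: pieri_up_def dest: u)
qed

lemma pieri_down_empty: "r > psize \<rho> \<Longrightarrow> pieri_down r \<rho> = {}"
  by (auto simp: pieri_down_def)

lemma lr_row_partition: "lr \<alpha> \<kappa> (row_partition r) = (if \<alpha> \<in> pieri_up r \<kappa> then 1 else 0)"
  using lr_pieri[of \<alpha> \<kappa> r empty_partition]
  by (simp add: pieri_up_empty lr_empty pieri_up_down sum.delta')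

text \<open>
  Ring homomorphisms out of the ring of symmetric functions, given by their values on the basis of
  Schur functions.
\<close>

definition schur_hom :: "(partition \<Rightarrow> 'a::comm_ring_1) \<Rightarrow> bool" where
  "schur_hom T \<longleftrightarrow> T empty_partition = 1 \<and>
     (\<forall>\<eta> \<rho>. T \<eta> * T \<rho> = (\<Sum>\<nu>\<in>partitions (psize \<eta> + psize \<rho>). of_int (lr \<nu> \<eta> \<rho>) * T \<nu>))"

lemma schur_hom_empty: "schur_hom T \<Longrightarrow> T empty_partition = 1"
  by (simp add: schur_hom_def)

lemma schur_hom_times:
  "schur_hom T \<Longrightarrow> T \<eta> * T \<rho> = (\<Sum>\<nu>\<in>partitions (psize \<eta> + psize \<rho>). of_int (lr \<nu> \<eta> \<rho>) * T \<nu>)"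
  by (simp add: schur_hom_def)

lemma schur_hom_pieri:
  assumes "schur_hom T"
  shows "T (row_partition r) * T \<kappa> = (\<Sum>\<nu>\<in>pieri_up r \<kappa>. T \<nu>)"
proof -
  have "T (row_partition r) * T \<kappa> = T \<kappa> * T (row_partition r)" by (rule mult.commute)
  also have "\<dots> = (\<Sum>\<nu>\<in>partitions (psize \<kappa> + r). if \<nu> \<in> pieri_up r \<kappa> then T \<nu> else 0)"
    unfolding schur_hom_times[OF assms] by (intro sum.cong) (auto simp: lr_row_partition)
  also have "\<dots> = (\<Sum>\<nu>\<in>{\<nu>\<in>partitions (psize \<kappa> + r). \<nu> \<in> pieri_up r \<kappa>}. T \<nu>)"
    by (rule sum.inter_filter [symmetric]) (rule finite_psize_eq)
  also have "{\<nu>\<in>partitions (psize \<kappa> + r). \<nu> \<in> pieri_up r \<kappa>} = pieri_up r \<kappa>"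
    by (auto simp: pieri_up_def)
  finally show ?thesis .
qed

text \<open>
  The elements $h_r$ generate the ring, so it suffices to test multiplication by them; the induction is
  on the second factor, and \<open>lr_pieri\<close> is its step.
\<close>

lemma schur_homI:
  assumes empty: "T empty_partition = 1"
    and pieri: "\<And>r \<kappa>. T (row_partition r) * T \<kappa> = (\<Sum>\<nu>\<in>pieri_up r \<kappa>. T \<nu>)"
  shows "schur_hom T"
  unfolding schur_hom_def
proof (intro conjI allI)
  fix \<eta> \<rho>
  define e where "e = (\<lambda>\<rho>. T \<eta> * T \<rho> - (\<Sum>\<nu>\<in>partitions (psize \<eta> + psize \<rho>). of_int (lr \<nu> \<eta> \<rho>) * T \<nu>))"
  have "e \<rho> \<in> {0}"
  proof (rule pieri_induct)
    show "e empty_partition \<in> {0}"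
      by (simp add: e_def empty lr_empty if_distrib[of of_int] if_distrib[of "\<lambda>x. x * _"]
          finite_psize_eq sum.delta cong: if_cong)
  next
    fix \<kappa> r assume "e \<kappa> \<in> {0}"
    then have IH: "T \<eta> * T \<kappa> = (\<Sum>\<zeta>\<in>partitions (psize \<eta> + psize \<kappa>). of_int (lr \<zeta> \<eta> \<kappa>) * T \<zeta>)"
      by (simp add: e_def)
    let ?n = "psize \<eta> + psize \<kappa>"
    have "(\<Sum>\<nu>\<in>pieri_up r \<kappa>. \<Sum>\<alpha>\<in>partitions (psize \<eta> + psize \<nu>). of_int (lr \<alpha> \<eta> \<nu>) * T \<alpha>) =
        (\<Sum>\<nu>\<in>pieri_up r \<kappa>. \<Sum>\<alpha>\<in>partitions (?n + r). of_int (lr \<alpha> \<eta> \<nu>) * T \<alpha>)"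
      by (intro sum.cong refl) (auto simp: pieri_up_def add.assoc)
    also have "\<dots> = (\<Sum>\<alpha>\<in>partitions (?n + r). of_int (\<Sum>\<nu>\<in>pieri_up r \<kappa>. lr \<alpha> \<eta> \<nu>) * T \<alpha>)"
      by (subst sum.swap) (simp add: sum_distrib_right)
    also have "\<dots> = (\<Sum>\<alpha>\<in>partitions (?n + r). \<Sum>\<zeta>\<in>pieri_down r \<alpha>. of_int (lr \<zeta> \<eta> \<kappa>) * T \<alpha>)"
      unfolding lr_pieri by (simp add: sum_distrib_right)
    also have "\<dots> = (\<Sum>\<zeta>\<in>partitions ?n. \<Sum>\<alpha>\<in>pieri_up r \<zeta>. of_int (lr \<zeta> \<eta> \<kappa>) * T \<alpha>)"
      by (rule sum_up_down_swap [symmetric])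
    also have "\<dots> = T (row_partition r) * (T \<eta> * T \<kappa>)"
      by (simp only: IH sum_distrib_left mult.left_commute[of "T (row_partition r)"] pieri)
    also have "\<dots> = (\<Sum>\<nu>\<in>pieri_up r \<kappa>. T \<eta> * T \<nu>)"
      by (simp only: mult.left_commute[of "T (row_partition r)"] pieri sum_distrib_left)
    finally show "(\<Sum>\<nu>\<in>pieri_up r \<kappa>. e \<nu>) \<in> {0}"
      by (simp add: e_def sum_subtractf)
  qed auto
  then show "T \<eta> * T \<rho> = (\<Sum>\<nu>\<in>partitions (psize \<eta> + psize \<rho>). of_int (lr \<nu> \<eta> \<rho>) * T \<nu>)"
    by (simp add: e_def)
qed (rule empty)

text \<open>
  The convolution of functionals that is dual to the coproduct of symmetric functions: if \<open>T\<close> and \<open>T'\<close>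
  evaluate at two alphabets, this evaluates at their union. The bounds on the sizes only make the sums
  finite.
\<close>

definition conv :: "(partition \<Rightarrow> 'a::comm_ring_1) \<Rightarrow> (partition \<Rightarrow> 'a) \<Rightarrow> partition \<Rightarrow> 'a" where
  "conv T T' \<nu> = (\<Sum>\<eta>\<in>partitions_upto (psize \<nu>). \<Sum>\<rho>\<in>partitions_upto (psize \<nu>).
     of_int (lr \<nu> \<eta> \<rho>) * (T \<eta> * T' \<rho>))"

lemma conv_upto:
  assumes "psize \<nu> \<le> n"
  shows "conv T T' \<nu> = (\<Sum>\<eta>\<in>partitions_upto n. \<Sum>\<rho>\<in>partitions_upto n.
     of_int (lr \<nu> \<eta> \<rho>) * (T \<eta> * T' \<rho>))"
proof -
  have lr0: "lr \<nu> \<eta> \<rho> = 0" if "psize \<eta> > psize \<nu> \<or> psize \<rho> > psize \<nu>" for \<eta> \<rho>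
    using that lr_size[of \<nu> \<eta> \<rho>] by linarith
  show ?thesis
    unfolding conv_def sum.cartesian_product
  proof (rule sum.mono_neutral_left)
    show "\<forall>i\<in>partitions_upto n \<times> partitions_upto n - partitions_upto (psize \<nu>) \<times> partitions_upto (psize \<nu>).
        (case i of (\<eta>, \<rho>) \<Rightarrow> of_int (lr \<nu> \<eta> \<rho>) * (T \<eta> * T' \<rho>)) = 0"
    proof (intro ballI, goal_cases)
      case (1 i)
      then have "lr \<nu> (fst i) (snd i) = 0" by (intro lr0) auto
      then show ?case by (simp add: case_prod_unfold)
    qed
  qed (use assms in \<open>auto simp: finite_psize_le\<close>)
qed

lemma sum_down_up_swap_upto:
  fixes f :: "partition \<Rightarrow> partition \<Rightarrow> 'a::comm_monoid_add"
  assumes "n + j \<le> N" and "\<And>\<eta> a. psize a > n \<Longrightarrow> f \<eta> a = 0"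
  shows "(\<Sum>\<eta>\<in>partitions_upto N. \<Sum>a\<in>pieri_down j \<eta>. f \<eta> a) =
    (\<Sum>a\<in>partitions_upto n. \<Sum>\<eta>\<in>pieri_up j a. f \<eta> a)"
proof -
  have "(\<Sum>\<eta>\<in>partitions_upto N. \<Sum>a\<in>pieri_down j \<eta>. f \<eta> a) =
      (\<Sum>(\<eta>, a)\<in>Sigma (partitions_upto N) (pieri_down j). f \<eta> a)"
    by (rule sum.Sigma) (auto simp: finite_psize_le)
  also have "\<dots> = (\<Sum>(\<eta>, a)\<in>prod.swap ` Sigma (partitions_upto n) (pieri_up j). f \<eta> a)"
    by (rule sum.mono_neutral_right)
       (use assms in \<open>auto simp: finite_psize_le pieri_up_def image_iff not_le
         simp flip: pieri_up_down intro!: finite_SigmaI\<close>)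
  also have "\<dots> = (\<Sum>(a, \<eta>)\<in>Sigma (partitions_upto n) (pieri_up j). f \<eta> a)"
    by (subst sum.reindex) (auto simp: case_prod_unfold)
  also have "\<dots> = (\<Sum>a\<in>partitions_upto n. \<Sum>\<eta>\<in>pieri_up j a. f \<eta> a)"
    by (rule sum.Sigma [symmetric]) (auto simp: finite_psize_le)
  finally show ?thesis .
qed

text \<open>
  The Leibniz rule splits the strip on \<open>\<kappa>\<close> into a strip for each factor, and the Pieri rule for \<open>T\<close> and
  \<open>T'\<close> then collects the factors $T(h_j) T'(h_{r-j})$.
\<close>

lemma conv_pieri:
  assumes T: "schur_hom T" and T': "schur_hom T'"
  shows "(\<Sum>\<nu>\<in>pieri_up r \<kappa>. conv T T' \<nu>) = (\<Sum>j\<le>r. T (row_partition j) * T' (row_partition (r - j))) * conv T T' \<kappa>"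
proof -
  let ?n = "psize \<kappa>"
  let ?A = "partitions_upto (?n + r)" and ?B = "partitions_upto ?n"
  have big: "lr \<kappa> a b = 0" if "psize a > ?n \<or> psize b > ?n" for a b
    using that lr_size[of \<kappa> a b] by linarith
  have "(\<Sum>\<nu>\<in>pieri_up r \<kappa>. conv T T' \<nu>) =
      (\<Sum>\<nu>\<in>pieri_up r \<kappa>. \<Sum>\<eta>\<in>?A. \<Sum>\<rho>\<in>?A. of_int (lr \<nu> \<eta> \<rho>) * (T \<eta> * T' \<rho>))"
    by (intro sum.cong refl conv_upto) (auto simp: pieri_up_def)
  also have "\<dots> = (\<Sum>\<eta>\<in>?A. \<Sum>\<rho>\<in>?A. of_int (\<Sum>\<nu>\<in>pieri_up r \<kappa>. lr \<nu> \<eta> \<rho>) * (T \<eta> * T' \<rho>))"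
    by (subst sum.swap, rule sum.cong[OF refl], subst sum.swap) (simp add: sum_distrib_right)
  also have "\<dots> = (\<Sum>\<eta>\<in>?A. \<Sum>\<rho>\<in>?A. \<Sum>j\<le>r. \<Sum>a\<in>pieri_down j \<eta>. \<Sum>b\<in>pieri_down (r - j) \<rho>.
      of_int (lr \<kappa> a b) * (T \<eta> * T' \<rho>))"
    unfolding lr_skew_leibniz by (simp add: sum_distrib_right)
  also have "\<dots> = (\<Sum>j\<le>r. \<Sum>\<eta>\<in>?A. \<Sum>a\<in>pieri_down j \<eta>. \<Sum>\<rho>\<in>?A. \<Sum>b\<in>pieri_down (r - j) \<rho>.
      of_int (lr \<kappa> a b) * (T \<eta> * T' \<rho>))"
  proof -
    have "(\<Sum>\<eta>\<in>?A. \<Sum>\<rho>\<in>?A. \<Sum>j\<le>r. \<Sum>a\<in>pieri_down j \<eta>. \<Sum>b\<in>pieri_down (r - j) \<rho>. g j \<eta> \<rho> a b) =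
      (\<Sum>j\<le>r. \<Sum>\<eta>\<in>?A. \<Sum>a\<in>pieri_down j \<eta>. \<Sum>\<rho>\<in>?A. \<Sum>b\<in>pieri_down (r - j) \<rho>. g j \<eta> \<rho> a b)"
      for g :: "nat \<Rightarrow> partition \<Rightarrow> partition \<Rightarrow> partition \<Rightarrow> partition \<Rightarrow> 'a"
    proof -
      have "(\<Sum>\<eta>\<in>?A. \<Sum>\<rho>\<in>?A. \<Sum>j\<le>r. \<Sum>a\<in>pieri_down j \<eta>. \<Sum>b\<in>pieri_down (r - j) \<rho>. g j \<eta> \<rho> a b) =
          (\<Sum>\<eta>\<in>?A. \<Sum>j\<le>r. \<Sum>\<rho>\<in>?A. \<Sum>a\<in>pieri_down j \<eta>. \<Sum>b\<in>pieri_down (r - j) \<rho>. g j \<eta> \<rho> a b)"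
        by (rule sum.cong[OF refl], rule sum.swap)
      also have "\<dots> = (\<Sum>\<eta>\<in>?A. \<Sum>j\<le>r. \<Sum>a\<in>pieri_down j \<eta>. \<Sum>\<rho>\<in>?A. \<Sum>b\<in>pieri_down (r - j) \<rho>. g j \<eta> \<rho> a b)"
        by (rule sum.cong[OF refl], rule sum.cong[OF refl], rule sum.swap)
      also have "\<dots> = (\<Sum>j\<le>r. \<Sum>\<eta>\<in>?A. \<Sum>a\<in>pieri_down j \<eta>. \<Sum>\<rho>\<in>?A. \<Sum>b\<in>pieri_down (r - j) \<rho>. g j \<eta> \<rho> a b)"
        by (rule sum.swap)
      finally show ?thesis .
    qed
    then show ?thesis .
  qed
  also have "\<dots> = (\<Sum>j\<le>r. \<Sum>a\<in>?B. \<Sum>\<eta>\<in>pieri_up j a. \<Sum>b\<in>?B. \<Sum>\<rho>\<in>pieri_up (r - j) b.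
      of_int (lr \<kappa> a b) * (T \<eta> * T' \<rho>))"
  proof (rule sum.cong[OF refl])
    fix j assume j: "j \<in> {..r}"
    have "(\<Sum>\<eta>\<in>?A. \<Sum>a\<in>pieri_down j \<eta>. \<Sum>\<rho>\<in>?A. \<Sum>b\<in>pieri_down (r - j) \<rho>. of_int (lr \<kappa> a b) * (T \<eta> * T' \<rho>)) =
        (\<Sum>\<eta>\<in>?A. \<Sum>a\<in>pieri_down j \<eta>. \<Sum>b\<in>?B. \<Sum>\<rho>\<in>pieri_up (r - j) b. of_int (lr \<kappa> a b) * (T \<eta> * T' \<rho>))"
      by (rule sum.cong[OF refl], rule sum.cong[OF refl], rule sum_down_up_swap_upto) (use j big in auto)
    also have "\<dots> = (\<Sum>a\<in>?B. \<Sum>\<eta>\<in>pieri_up j a. \<Sum>b\<in>?B. \<Sum>\<rho>\<in>pieri_up (r - j) b. of_int (lr \<kappa> a b) * (T \<eta> * T' \<rho>))"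
      by (rule sum_down_up_swap_upto) (use j big in auto)
    finally show "(\<Sum>\<eta>\<in>?A. \<Sum>a\<in>pieri_down j \<eta>. \<Sum>\<rho>\<in>?A. \<Sum>b\<in>pieri_down (r - j) \<rho>. of_int (lr \<kappa> a b) * (T \<eta> * T' \<rho>)) =
      (\<Sum>a\<in>?B. \<Sum>\<eta>\<in>pieri_up j a. \<Sum>b\<in>?B. \<Sum>\<rho>\<in>pieri_up (r - j) b. of_int (lr \<kappa> a b) * (T \<eta> * T' \<rho>))" .
  qed
  also have "\<dots> = (\<Sum>j\<le>r. \<Sum>a\<in>?B. \<Sum>b\<in>?B. (T (row_partition j) * T' (row_partition (r - j))) * (of_int (lr \<kappa> a b) * (T a * T' b)))"
  proof (rule sum.cong[OF refl], rule sum.cong[OF refl])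
    fix j a
    have "(\<Sum>\<eta>\<in>pieri_up j a. \<Sum>b\<in>?B. \<Sum>\<rho>\<in>pieri_up (r - j) b. of_int (lr \<kappa> a b) * (T \<eta> * T' \<rho>)) =
        (\<Sum>b\<in>?B. \<Sum>\<eta>\<in>pieri_up j a. \<Sum>\<rho>\<in>pieri_up (r - j) b. of_int (lr \<kappa> a b) * (T \<eta> * T' \<rho>))"
      by (rule sum.swap)
    also have "\<dots> = (\<Sum>b\<in>?B. of_int (lr \<kappa> a b) * ((\<Sum>\<eta>\<in>pieri_up j a. T \<eta>) * (\<Sum>\<rho>\<in>pieri_up (r - j) b. T' \<rho>)))"
      by (simp only: sum_product) (simp only: sum_distrib_left)
    also have "\<dots> = (\<Sum>b\<in>?B. (T (row_partition j) * T' (row_partition (r - j))) * (of_int (lr \<kappa> a b) * (T a * T' b)))"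
      by (simp flip: schur_hom_pieri[OF T] schur_hom_pieri[OF T'] add: mult_ac)
    finally show "(\<Sum>\<eta>\<in>pieri_up j a. \<Sum>b\<in>?B. \<Sum>\<rho>\<in>pieri_up (r - j) b. of_int (lr \<kappa> a b) * (T \<eta> * T' \<rho>)) = \<dots>" .
  qed
  also have "\<dots> = (\<Sum>j\<le>r. T (row_partition j) * T' (row_partition (r - j))) * conv T T' \<kappa>"
    by (subst sum_distrib_right) (simp only: conv_def sum_distrib_left)
  finally show ?thesis .
qed

lemma partitions_upto_0: "partitions_upto 0 = {empty_partition}"
  using psize_eq_0_iff by auto

lemma schur_hom_conv:
  assumes T: "schur_hom T" and T': "schur_hom T'"
  shows "schur_hom (conv T T')"
proof (rule schur_homI)
  show e: "conv T T' empty_partition = 1"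
    by (simp add: conv_def partitions_upto_0 [unfolded le_zero_eq] lr_empty schur_hom_empty[OF T] schur_hom_empty[OF T'])
  fix r \<kappa>
  have "conv T T' (row_partition r) = (\<Sum>j\<le>r. T (row_partition j) * T' (row_partition (r - j)))"
    using conv_pieri[OF T T', of r empty_partition] e by (simp add: pieri_up_empty)
  then show "conv T T' (row_partition r) * conv T T' \<kappa> = (\<Sum>\<nu>\<in>pieri_up r \<kappa>. conv T T' \<nu>)"
    using conv_pieri[OF T T', of r \<kappa>] by simp
qed

lemma schur_hom_scale:
  assumes "schur_hom T"
  shows "schur_hom (\<lambda>\<nu>. u ^ psize \<nu> * T \<nu>)"
  unfolding schur_hom_def
proof (intro conjI allI)
  fix \<eta> \<rho>
  have "u ^ psize \<eta> * T \<eta> * (u ^ psize \<rho> * T \<rho>) = u ^ (psize \<eta> + psize \<rho>) * (T \<eta> * T \<rho>)"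
    by (simp add: power_add mult_ac)
  also have "\<dots> = (\<Sum>\<nu>\<in>partitions (psize \<eta> + psize \<rho>). of_int (lr \<nu> \<eta> \<rho>) * (u ^ psize \<nu> * T \<nu>))"
    unfolding schur_hom_times[OF assms] sum_distrib_left by (intro sum.cong refl) (auto simp: mult_ac)
  finally show "u ^ psize \<eta> * T \<eta> * (u ^ psize \<rho> * T \<rho>) = \<dots>" .
qed (simp add: schur_hom_empty[OF assms])

text \<open>
  The value of a Schur function at $x_1, \dots, x_m$, in the form that the branching rule gives to it;
  \<open>evs_eq_sum_monomials\<close> is the agreement with the sum over tableaux.
\<close>

fun evs :: "(nat \<Rightarrow> 'a::comm_ring_1) \<Rightarrow> nat \<Rightarrow> partition \<Rightarrow> 'a" where
  "evs x 0 \<rho> = (if \<rho> = empty_partition then 1 else 0)"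
| "evs x (Suc m) \<rho> = (\<Sum>r\<le>psize \<rho>. \<Sum>\<kappa>\<in>pieri_down r \<rho>. x (Suc m) ^ r * evs x m \<kappa>)"

lemma sum_branch_upto:
  fixes f :: "nat \<Rightarrow> partition \<Rightarrow> 'a::comm_monoid_add"
  assumes "psize \<rho> \<le> N"
  shows "(\<Sum>r\<le>psize \<rho>. \<Sum>\<kappa>\<in>pieri_down r \<rho>. f r \<kappa>) = (\<Sum>r\<le>N. \<Sum>\<kappa>\<in>pieri_down r \<rho>. f r \<kappa>)"
  by (rule sum.mono_neutral_left) (use assms in \<open>auto simp: pieri_down_empty\<close>)

text \<open>
  Adding a variable preserves multiplicativity, by the Leibniz rule again: the strip removed from a
  product is distributed over the two factors.
\<close>

lemma schur_hom_evs: "schur_hom (evs x m)"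
proof (induction m)
  case 0
  have "(if \<eta> = empty_partition then 1 else 0) * (if \<rho> = empty_partition then 1 else 0) =
     (\<Sum>\<nu>\<in>partitions (psize \<eta> + psize \<rho>). of_int (lr \<nu> \<eta> \<rho>) * (if \<nu> = empty_partition then 1 else (0::'a)))"
    for \<eta> \<rho>
  proof (cases "\<eta> = empty_partition \<and> \<rho> = empty_partition")
    case True
    then have "partitions (psize \<eta> + psize \<rho>) = {empty_partition}" by (auto simp: psize_eq_0_iff)
    then show ?thesis using True by (simp add: lr_empty)
  next
    case False
    then have "psize \<eta> + psize \<rho> \<noteq> 0" by (auto simp: psize_eq_0_iff)
    then have "\<nu> \<noteq> empty_partition" if "\<nu> \<in> partitions (psize \<eta> + psize \<rho>)" for \<nu>
      using that psize_empty by auto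
    then show ?thesis using False by auto
  qed
  then show ?case unfolding schur_hom_def by auto
next
  case (Suc m)
  show ?case
    unfolding schur_hom_def
  proof (intro conjI allI)
    have "pieri_down 0 empty_partition = {empty_partition}"
      by (auto simp: pieri_down_def psize_eq_0_iff hstrip_def)
    then show "evs x (Suc m) empty_partition = 1"
      using schur_hom_empty[OF Suc] by simp
    fix \<eta> \<rho>
    let ?N = "psize \<eta> + psize \<rho>" and ?x = "x (Suc m)"
    define g where "g i l = (\<Sum>a\<in>pieri_down i \<eta>. \<Sum>b\<in>pieri_down l \<rho>. ?x ^ (i + l) * (evs x m a * evs x m b))" for i l
    have g0: "g i l = 0" if "i + l > ?N" for i l
    proof -
      have "i > psize \<eta> \<or> l > psize \<rho>" using that by linarith
      then show ?thesis by (auto simp: g_def pieri_down_empty)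
    qed
    have "evs x (Suc m) \<eta> * evs x (Suc m) \<rho> =
        (\<Sum>i\<le>?N. \<Sum>a\<in>pieri_down i \<eta>. ?x ^ i * evs x m a) * (\<Sum>l\<le>?N. \<Sum>b\<in>pieri_down l \<rho>. ?x ^ l * evs x m b)"
      by (simp add: sum_branch_upto[of \<eta> ?N] sum_branch_upto[of \<rho> ?N])
    also have "\<dots> = (\<Sum>i\<le>?N. \<Sum>l\<le>?N. g i l)"
      unfolding sum_product g_def by (intro sum.cong refl) (simp add: power_add mult_ac)
    also have "\<dots> = (\<Sum>(i, l)\<in>{..?N} \<times> {..?N}. g i l)"
      by (simp add: sum.cartesian_product)
    also have "\<dots> = (\<Sum>(i, l)\<in>{(i, l). i + l \<le> ?N}. g i l)"
      by (rule sum.mono_neutral_right) (auto intro!: g0)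
    also have "\<dots> = (\<Sum>r\<le>?N. \<Sum>j\<le>r. g j (r - j))" by (rule sum.triangle_reindex_eq)
    also have "\<dots> = (\<Sum>r\<le>?N. \<Sum>\<kappa>\<in>partitions (?N - r). of_int (\<Sum>\<nu>\<in>pieri_up r \<kappa>. lr \<nu> \<eta> \<rho>) * (?x ^ r * evs x m \<kappa>))"
    proof (rule sum.cong[OF refl])
      fix r assume r: "r \<in> {..?N}"
      have "(\<Sum>j\<le>r. g j (r - j)) = (\<Sum>j\<le>r. \<Sum>a\<in>pieri_down j \<eta>. \<Sum>b\<in>pieri_down (r - j) \<rho>.
          \<Sum>\<kappa>\<in>partitions (?N - r). of_int (lr \<kappa> a b) * (?x ^ r * evs x m \<kappa>))"
        unfolding g_def
      proof (intro sum.cong refl)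
        fix j a b assume *: "j \<in> {..r}" "a \<in> pieri_down j \<eta>" "b \<in> pieri_down (r - j) \<rho>"
        then have "psize a + psize b = ?N - r" by (auto simp: pieri_down_def)
        then show "?x ^ (j + (r - j)) * (evs x m a * evs x m b) =
            (\<Sum>\<kappa>\<in>partitions (?N - r). of_int (lr \<kappa> a b) * (?x ^ r * evs x m \<kappa>))"
          using *(1) unfolding schur_hom_times[OF Suc] by (simp add: sum_distrib_left mult_ac)
      qed
      also have "\<dots> = (\<Sum>\<kappa>\<in>partitions (?N - r). \<Sum>j\<le>r. \<Sum>a\<in>pieri_down j \<eta>. \<Sum>b\<in>pieri_down (r - j) \<rho>.
          of_int (lr \<kappa> a b) * (?x ^ r * evs x m \<kappa>))"
        by (simp only: sum.swap[of _ "partitions (?N - r)"])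
      finally show "(\<Sum>j\<le>r. g j (r - j)) =
          (\<Sum>\<kappa>\<in>partitions (?N - r). of_int (\<Sum>\<nu>\<in>pieri_up r \<kappa>. lr \<nu> \<eta> \<rho>) * (?x ^ r * evs x m \<kappa>))"
        unfolding lr_skew_leibniz by (simp add: sum_distrib_right)
    qed
    also have "\<dots> = (\<Sum>r\<le>?N. \<Sum>\<kappa>\<in>partitions (?N - r). \<Sum>\<nu>\<in>pieri_up r \<kappa>. of_int (lr \<nu> \<eta> \<rho>) * (?x ^ r * evs x m \<kappa>))"
      by (simp add: sum_distrib_right)
    also have "\<dots> = (\<Sum>r\<le>?N. \<Sum>\<nu>\<in>partitions ?N. \<Sum>\<kappa>\<in>pieri_down r \<nu>. of_int (lr \<nu> \<eta> \<rho>) * (?x ^ r * evs x m \<kappa>))"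
      unfolding sum_up_down_swap by (intro sum.cong) auto
    also have "\<dots> = (\<Sum>\<nu>\<in>partitions ?N. \<Sum>r\<le>?N. \<Sum>\<kappa>\<in>pieri_down r \<nu>. of_int (lr \<nu> \<eta> \<rho>) * (?x ^ r * evs x m \<kappa>))"
      by (rule sum.swap)
    also have "\<dots> = (\<Sum>\<nu>\<in>partitions ?N. of_int (lr \<nu> \<eta> \<rho>) * evs x (Suc m) \<nu>)"
      by (intro sum.cong refl) (auto simp: sum_distrib_left)
    finally show "evs x (Suc m) \<eta> * evs x (Suc m) \<rho> = (\<Sum>\<nu>\<in>partitions ?N. of_int (lr \<nu> \<eta> \<rho>) * evs x (Suc m) \<nu>)" .
  qed
qed

section \<open>Newton's identities and the Cauchy identity\<close>

text \<open>
  Newton's identities between power sums \<open>p\<close> and complete symmetric functions \<open>h\<close>. They express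
  $\sum_n h_n t^n = \exp \sum_n p_n t^n / n$ by polynomial identities, which pass to coefficientwise
  limits and make sense in every commutative ring.
\<close>

definition newton :: "(nat \<Rightarrow> 'a::comm_ring_1) \<Rightarrow> (nat \<Rightarrow> 'a) \<Rightarrow> bool" where
  "newton p h \<longleftrightarrow> h 0 = 1 \<and> (\<forall>n. of_nat n * h n = (\<Sum>k=1..n. p k * h (n - k)))"

text \<open>
  The logarithmic derivative of the generating function of \<open>h\<close>.
\<close>

lemma newton_fps:
  "newton p h \<longleftrightarrow> h 0 = 1 \<and>
     fps_X * fps_deriv (Abs_fps h) = Abs_fps (\<lambda>k. if k = 0 then 0 else p k) * Abs_fps h"
proof -
  have "fps_nth (fps_X * fps_deriv (Abs_fps h)) n = of_nat n * h n" for n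
    by (cases n) auto
  moreover have "fps_nth (Abs_fps (\<lambda>k. if k = 0 then 0 else p k) * Abs_fps h) n = (\<Sum>k=1..n. p k * h (n - k))" for n
    unfolding fps_mult_nth by (rule sum.mono_neutral_cong_right) auto
  ultimately show ?thesis by (auto simp: newton_def fps_eq_iff)
qed

lemma newton_scale:
  assumes "newton p h"
  shows "newton (\<lambda>k. p k * u ^ k) (\<lambda>k. h k * u ^ k)"
  unfolding newton_def
proof (intro conjI allI)
  show "h 0 * u ^ 0 = 1" using assms by (simp add: newton_def)
  fix n
  have e: "of_nat n * h n = (\<Sum>k=1..n. p k * h (n - k))"
    using assms unfolding newton_def by blast
  have "of_nat n * (h n * u ^ n) = (\<Sum>k=1..n. p k * h (n - k)) * u ^ n"
    by (simp only: e flip: mult.assoc)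
  also have "\<dots> = (\<Sum>k=1..n. p k * u ^ k * (h (n - k) * u ^ (n - k)))"
    unfolding sum_distrib_right
  proof (rule sum.cong[OF refl])
    fix k assume "k \<in> {1..n}"
    then have "u ^ n = u ^ k * u ^ (n - k)" by (simp flip: power_add)
    then show "p k * h (n - k) * u ^ n = p k * u ^ k * (h (n - k) * u ^ (n - k))" by (simp add: mult_ac)
  qed
  finally show "of_nat n * (h n * u ^ n) = \<dots>" .
qed

lemma newton_times:
  assumes "newton p h" "newton p' h'"
  shows "newton (\<lambda>k. p k + p' k) (\<lambda>n. \<Sum>i\<le>n. h i * h' (n - i))"
proof -
  let ?P = "\<lambda>p. Abs_fps (\<lambda>k. if k = 0 then 0 else p k)"
  have a: "Abs_fps (\<lambda>n. \<Sum>i\<le>n. h i * h' (n - i)) = Abs_fps h * Abs_fps h'"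
    by (rule fps_ext) (simp add: fps_mult_nth atMost_atLeast0)
  have b: "?P (\<lambda>k. p k + p' k) = ?P p + ?P p'" by (rule fps_ext) simp
  have "fps_X * fps_deriv (Abs_fps h * Abs_fps h') =
      (fps_X * fps_deriv (Abs_fps h)) * Abs_fps h' + Abs_fps h * (fps_X * fps_deriv (Abs_fps h'))"
    by (simp add: algebra_simps)
  also have "\<dots> = (?P p + ?P p') * (Abs_fps h * Abs_fps h')"
    using assms by (simp add: newton_fps algebra_simps)
  finally show ?thesis using assms unfolding newton_fps a b by simp
qed

text \<open>
  The Cauchy identity, stated through power sums of the product alphabet. By the branching rule and
  the Pieri rule for \<open>T\<close>, one more variable $x_{m+1}$ multiplies the generating function of the sums
  over \<open>\<rho>\<close> by $\sum_i T(h_i) x_{m+1}^i$.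
\<close>

lemma cauchy_newton:
  fixes T :: "partition \<Rightarrow> 'a::comm_ring_1"
  assumes T: "schur_hom T" and p: "newton p (\<lambda>r. T (row_partition r))"
  shows "newton (\<lambda>k. p k * (\<Sum>i=1..m. x i ^ k)) (\<lambda>n. \<Sum>\<rho>\<in>partitions n. T \<rho> * evs x m \<rho>)"
proof (induction m)
  case 0
  have "(\<Sum>\<rho>\<in>partitions n. T \<rho> * evs x 0 \<rho>) = (if n = 0 then 1 else 0)" for n
    using schur_hom_empty[OF T] by (auto simp: if_distrib finite_psize_eq sum.delta cong: if_cong)
  then show ?case by (auto simp: newton_def)
next
  case (Suc m)
  have "(\<Sum>\<rho>\<in>partitions n. T \<rho> * evs x (Suc m) \<rho>) =
      (\<Sum>i\<le>n. (T (row_partition i) * x (Suc m) ^ i) * (\<Sum>\<rho>\<in>partitions (n - i). T \<rho> * evs x m \<rho>))" for n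
  proof -
    have "(\<Sum>\<rho>\<in>partitions n. T \<rho> * evs x (Suc m) \<rho>) =
        (\<Sum>\<rho>\<in>partitions n. \<Sum>r\<le>n. \<Sum>\<kappa>\<in>pieri_down r \<rho>. T \<rho> * (x (Suc m) ^ r * evs x m \<kappa>))"
      by (intro sum.cong refl) (auto simp: sum_distrib_left)
    also have "\<dots> = (\<Sum>r\<le>n. \<Sum>\<rho>\<in>partitions n. \<Sum>\<kappa>\<in>pieri_down r \<rho>. T \<rho> * (x (Suc m) ^ r * evs x m \<kappa>))"
      by (rule sum.swap)
    also have "\<dots> = (\<Sum>r\<le>n. \<Sum>\<kappa>\<in>partitions (n - r). \<Sum>\<rho>\<in>pieri_up r \<kappa>. T \<rho> * (x (Suc m) ^ r * evs x m \<kappa>))"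
      unfolding sum_up_down_swap by (intro sum.cong) auto
    also have "\<dots> = (\<Sum>r\<le>n. \<Sum>\<kappa>\<in>partitions (n - r). (T (row_partition r) * T \<kappa>) * (x (Suc m) ^ r * evs x m \<kappa>))"
      by (simp only: schur_hom_pieri[OF T] sum_distrib_right)
    finally show ?thesis by (simp add: sum_distrib_left mult_ac)
  qed
  moreover have "p k * (\<Sum>i=1..Suc m. x i ^ k) = p k * x (Suc m) ^ k + p k * (\<Sum>i=1..m. x i ^ k)" for k
    by (simp add: algebra_simps)
  ultimately show ?case
    using newton_times[OF newton_scale[OF p, of "x (Suc m)"] Suc] by simp
qed

text \<open>
  The case of the Cauchy identity in which one of the alphabets is the single letter 1: a Schur function
  of one variable vanishes unless its partition has at most one row.
\<close>

lemma evs_row_newton: "newton (\<lambda>k. \<Sum>i=1..m. x i ^ k) (\<lambda>n. evs x m (row_partition n))"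
proof -
  define T :: "partition \<Rightarrow> 'a" where "T = evs (\<lambda>_. 1) (Suc 0)"
  have "T \<rho> = (if \<rho> = row_partition (psize \<rho>) then 1 else 0)" for \<rho>
  proof -
    have "T \<rho> = (\<Sum>r\<le>psize \<rho>. \<Sum>\<kappa>\<in>pieri_down r \<rho>. if \<kappa> = empty_partition then 1 else 0)"
      by (simp add: T_def)
    also have "\<dots> = (\<Sum>r\<le>psize \<rho>. if empty_partition \<in> pieri_down r \<rho> then 1 else 0)"
      by (simp add: sum.delta)
    also have "\<dots> = (\<Sum>r\<le>psize \<rho>. if r = psize \<rho> then (if \<rho> = row_partition (psize \<rho>) then 1 else 0) else 0)"
      by (intro sum.cong refl) (auto simp flip: pieri_up_down simp: pieri_up_empty)
    finally show ?thesis by simp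
  qed
  then have Trow: "T \<rho> * z = (if \<rho> = row_partition (psize \<rho>) then z else 0)" for \<rho> z by simp
  have "(\<Sum>\<rho>\<in>partitions n. T \<rho> * evs x m \<rho>) = (\<Sum>\<rho>\<in>partitions n. if \<rho> = row_partition n then evs x m \<rho> else 0)" for n
    unfolding Trow by (intro sum.cong) auto
  then have s: "(\<Sum>\<rho>\<in>partitions n. T \<rho> * evs x m \<rho>) = evs x m (row_partition n)" for n
    by (simp add: finite_psize_eq)
  have "T (row_partition r) = 1" for r using Trow[of "row_partition r" 1] by simp
  then have "newton (\<lambda>_. 1) (\<lambda>r. T (row_partition r))" by (simp add: newton_def)
  from cauchy_newton[OF _ this, where m = m and x = x] show ?thesis
    by (simp add: T_def schur_hom_evs s[unfolded T_def] del: evs.simps)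
qed

lemma newton_unique:
  fixes h :: "nat \<Rightarrow> 'a::field_char_0"
  assumes "newton p h" "newton p h'"
  shows "h n = h' n"
proof (induction n rule: less_induct)
  case (less n)
  show ?case
  proof (cases "n = 0")
    case False
    have "of_nat n * h n = of_nat n * h' n"
      using assms less by (simp add: newton_def)
    then show ?thesis using False by simp
  qed (use assms in \<open>simp add: newton_def\<close>)
qed

section \<open>Coefficientwise limits of Laurent series\<close>

text \<open>
  Convergence in the metric of formal Laurent series, in terms of coefficients: up to any bound the
  coefficients are eventually those of the limit.
\<close>

definition fls_lim :: "(nat \<Rightarrow> 'a::comm_ring_1 fls) \<Rightarrow> 'a fls \<Rightarrow> bool" where
  "fls_lim f L \<longleftrightarrow> (\<forall>B. \<exists>m0. \<forall>m\<ge>m0. \<forall>k\<le>B. fls_nth (f m) k = fls_nth L k)"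

lemma fls_limD: "fls_lim f L \<Longrightarrow> \<exists>m0. \<forall>m\<ge>m0. \<forall>k\<le>B. fls_nth (f m) k = fls_nth L k"
  by (simp add: fls_lim_def)

lemma fls_lim_const [simp]: "fls_lim (\<lambda>_. L) L"
  by (simp add: fls_lim_def)

lemma fls_lim_unique:
  assumes "fls_lim f L" "fls_lim f L'"
  shows "L = L'"
proof (rule fls_eqI)
  fix k
  obtain m0 m1 where "\<forall>m\<ge>m0. \<forall>j\<le>k. fls_nth (f m) j = fls_nth L j"
    "\<forall>m\<ge>m1. \<forall>j\<le>k. fls_nth (f m) j = fls_nth L' j"
    using assms[THEN fls_limD, of k] by blast
  then show "fls_nth L k = fls_nth L' k" by (metis max.cobounded1 max.cobounded2 order_refl)
qed

lemma fls_lim_add: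
  assumes "fls_lim f L" "fls_lim g M"
  shows "fls_lim (\<lambda>m. f m + g m) (L + M)"
  unfolding fls_lim_def
proof
  fix B
  obtain m0 m1 where "\<forall>m\<ge>m0. \<forall>k\<le>B. fls_nth (f m) k = fls_nth L k"
    "\<forall>m\<ge>m1. \<forall>k\<le>B. fls_nth (g m) k = fls_nth M k"
    using assms[THEN fls_limD, of B] by blast
  then have "\<forall>m\<ge>max m0 m1. \<forall>k\<le>B. fls_nth (f m + g m) k = fls_nth (L + M) k" by simp
  then show "\<exists>m0. \<forall>m\<ge>m0. \<forall>k\<le>B. fls_nth (f m + g m) k = fls_nth (L + M) k" by blast
qed

lemma fls_times_nth_bounded:
  fixes f g :: "'a::comm_ring_1 fls"
  assumes "\<And>k. k < a \<Longrightarrow> fls_nth f k = 0" "\<And>k. k < b \<Longrightarrow> fls_nth g k = 0"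
  shows "fls_nth (f * g) n = (\<Sum>i=a..n - b. fls_nth f i * fls_nth g (n - i))"
proof (cases "f = 0 \<or> g = 0")
  case False
  then have "fls_nth f (fls_subdegree f) \<noteq> 0" "fls_nth g (fls_subdegree g) \<noteq> 0" by auto
  then have "a \<le> fls_subdegree f" "b \<le> fls_subdegree g" using assms not_le by blast+
  then show ?thesis unfolding fls_times_nth(2)
    by (intro sum.mono_neutral_left) auto
qed auto

lemma fls_lim_times:
  assumes "fls_lim f L" "fls_lim g M"
  shows "fls_lim (\<lambda>m. f m * g m) (L * M)"
  unfolding fls_lim_def
proof
  fix B
  define a where "a = fls_subdegree L"
  define b where "b = fls_subdegree M"
  define C where "C = \<bar>B\<bar> + \<bar>a\<bar> + \<bar>b\<bar>"
  obtain m0 m1 where m: "\<forall>m\<ge>m0. \<forall>k\<le>C. fls_nth (f m) k = fls_nth L k"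
    "\<forall>m\<ge>m1. \<forall>k\<le>C. fls_nth (g m) k = fls_nth M k"
    using assms[THEN fls_limD, of C] by blast
  have "fls_nth (f m * g m) n = fls_nth (L * M) n" if mm: "m \<ge> max m0 m1" and n: "n \<le> B" for m n
  proof -
    have f: "fls_nth (f m) k = fls_nth L k" "fls_nth (g m) k = fls_nth M k" if "k \<le> C" for k
      using m mm that by auto
    have L0: "fls_nth L k = 0" if "k < a" for k using that by (simp add: a_def)
    have M0: "fls_nth M k = 0" if "k < b" for k using that by (simp add: b_def)
    have f0: "fls_nth (f m) k = 0" if "k < a" for k using f(1)[of k] L0 that by (auto simp: C_def)
    have g0: "fls_nth (g m) k = 0" if "k < b" for k using f(2)[of k] M0 that by (auto simp: C_def)
    have "fls_nth (f m * g m) n = (\<Sum>i=a..n - b. fls_nth (f m) i * fls_nth (g m) (n - i))"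
      by (rule fls_times_nth_bounded) (auto simp: f0 g0)
    also have "\<dots> = (\<Sum>i=a..n - b. fls_nth L i * fls_nth M (n - i))"
      using n by (intro sum.cong refl arg_cong2[of _ _ _ _ "(*)"] f) (auto simp: C_def)
    also have "\<dots> = fls_nth (L * M) n"
      by (rule fls_times_nth_bounded [symmetric]) (auto simp: L0 M0)
    finally show ?thesis .
  qed
  then show "\<exists>m0. \<forall>m\<ge>m0. \<forall>k\<le>B. fls_nth (f m * g m) k = fls_nth (L * M) k" by blast
qed

lemma fls_lim_sum:
  assumes "\<And>i. i \<in> I \<Longrightarrow> fls_lim (f i) (L i)"
  shows "fls_lim (\<lambda>m. \<Sum>i\<in>I. f i m) (\<Sum>i\<in>I. L i)"
  using assms by (induction I rule: infinite_finite_induct) (auto intro: fls_lim_add)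

lemma fls_lim_prod:
  assumes "\<And>i. i \<in> I \<Longrightarrow> fls_lim (f i) (L i)"
  shows "fls_lim (\<lambda>m. \<Prod>i\<in>I. f i m) (\<Prod>i\<in>I. L i)"
  using assms by (induction I rule: infinite_finite_induct) (auto intro: fls_lim_times)

lemma dist_fls_less:
  fixes S T :: "'a::comm_ring_1 fls"
  assumes "inverse (2 ^ B) < (e::real)" and "\<forall>k\<le>int B. fls_nth S k = fls_nth T k"
  shows "dist S T < e"
proof (cases "S = T")
  case True
  have "0 < inverse (2 ^ B :: real)" by simp
  then have "0 < e" using assms(1) by linarith
  then show ?thesis using True by simp
next
  case False
  then have "S - T \<noteq> 0" by simp
  then have "fls_nth (S - T) (fls_subdegree (S - T)) \<noteq> 0" by (rule nth_fls_subdegree_nonzero)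
  moreover have "fls_nth (S - T) k = 0" if "k \<le> int B" for k using assms(2) that by simp
  ultimately have d: "int B < fls_subdegree (S - T)" using not_le by blast
  then have "dist S T = inverse (2 ^ nat (fls_subdegree (S - T)))"
    using False by (simp add: dist_fls_def)
  also have "\<dots> \<le> inverse (2 ^ B)"
    using d by (intro le_imp_inverse_le power_increasing) auto
  finally show ?thesis using assms(1) by linarith
qed

lemma fls_nth_sum: "fls_nth (\<Sum>i\<in>I. t i) k = (\<Sum>i\<in>I. fls_nth (t i) k)"
  by (induction I rule: infinite_finite_induct) auto

text \<open>
  A family of which only finitely many members have a nonzero coefficient below any given bound is
  summable, and its sum is computed coefficientwise.
\<close>

lemma fls_has_sum:
  fixes t :: "'i \<Rightarrow> 'a::comm_ring_1 fls"
  assumes fin: "\<And>B. finite {i\<in>I. \<exists>k\<le>B. fls_nth (t i) k \<noteq> 0}"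
  obtains S where "(t has_sum S) I"
    and "\<And>k. fls_nth S k = (\<Sum>i | i \<in> I \<and> fls_nth (t i) k \<noteq> 0. fls_nth (t i) k)"
proof -
  define s where "s k = (\<Sum>i | i \<in> I \<and> fls_nth (t i) k \<noteq> 0. fls_nth (t i) k)" for k
  define X where "X B = {i\<in>I. \<exists>k\<le>B. fls_nth (t i) k \<noteq> 0}" for B
  have s: "s k = (\<Sum>i\<in>Y. fls_nth (t i) k)" if "finite Y" "X B \<subseteq> Y" "Y \<subseteq> I" "k \<le> B" for Y B k
    unfolding s_def by (rule sum.mono_neutral_left) (use that in \<open>auto simp: X_def\<close>)
  have finX: "finite (X B)" for B using fin by (simp add: X_def)
  define N where "N = Min (insert 0 ((\<lambda>i. fls_subdegree (t i)) ` X 0))"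
  have "s k = 0" if "k < N" for k
  proof -
    have N: "N \<le> 0" "i \<in> X 0 \<Longrightarrow> N \<le> fls_subdegree (t i)" for i
      unfolding N_def using finX by auto
    have "s k = (\<Sum>i\<in>X 0. fls_nth (t i) k)"
      by (rule s[of _ 0]) (use finX that N(1) in \<open>auto simp: X_def\<close>)
    also have "\<dots> = 0" using that N(2) by (intro sum.neutral) fastforce
    finally show ?thesis .
  qed
  then have nth: "fls_nth (Abs_fls s) k = s k" for k
    by (intro nth_Abs_fls_lower_bound[of N]) auto
  have "(t has_sum Abs_fls s) I"
    unfolding has_sum_def
  proof (rule tendstoI)
    fix e :: real assume "e > 0"
    then obtain B where B: "inverse (2 ^ B) < e"
      using real_arch_pow_inv[of e "1/2"] by (auto simp: power_one_over inverse_eq_divide)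
    show "eventually (\<lambda>Y. dist (sum t Y) (Abs_fls s) < e) (finite_subsets_at_top I)"
      unfolding eventually_finite_subsets_at_top
    proof (intro exI[of _ "X (int B)"] conjI allI impI)
      show "finite (X (int B))" by (rule finX)
      show "X (int B) \<subseteq> I" by (auto simp: X_def)
      fix Y assume Y: "finite Y \<and> X (int B) \<subseteq> Y \<and> Y \<subseteq> I"
      have "\<forall>k\<le>int B. fls_nth (sum t Y) k = fls_nth (Abs_fls s) k"
        using Y s[of Y "int B"] by (auto simp: nth fls_nth_sum)
      then show "dist (sum t Y) (Abs_fls s) < e" by (rule dist_fls_less[OF B])
    qed
  qed
  then show ?thesis using that nth by (simp add: s_def)
qed

lemma qhalf_fls_nth: "fls_nth (qhalf_fls w :: 'a::comm_ring_1 fls) k = (if k = - w then 1 else 0)"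
  by (auto simp: qhalf_fls_def)

lemma qhalf_fls_0 [simp]: "qhalf_fls 0 = 1"
  by (simp add: qhalf_fls_def)

lemma qhalf_fls_add: "qhalf_fls (a + b) = (qhalf_fls a * qhalf_fls b :: 'a::comm_ring_1 fls)"
  unfolding qhalf_fls_def using fls_X_intpow_times_fls_X_intpow[of "-a" "-b", where 'a = 'a] by simp

lemma qhalf_fls_times_nth: "fls_nth (qhalf_fls w * f :: 'a::comm_ring_1 fls) k = fls_nth f (k + w)"
  unfolding qhalf_fls_def using fls_X_intpow_times_conv_shift(1)[of "- w" f] by simp

lemma qhalf_fls_power: "qhalf_fls a ^ n = (qhalf_fls (int n * a) :: 'a::comm_ring_1 fls)"
  by (induction n) (simp_all add: algebra_simps qhalf_fls_add)

lemma fls_lim_qhalf_0: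
  assumes "a > 0"
  shows "fls_lim (\<lambda>m. qhalf_fls (- (a * int m))) (0 :: 'a::comm_ring_1 fls)"
  unfolding fls_lim_def
proof
  fix B :: int
  have "\<forall>m\<ge>nat (B + 1). \<forall>k\<le>B. fls_nth (qhalf_fls (- (a * int m)) :: 'a fls) k = fls_nth 0 k"
  proof (intro allI impI)
    fix m k assume "nat (B + 1) \<le> m" "k \<le> B"
    then have "k < int m" by linarith
    also have "int m \<le> a * int m" using assms by (simp add: mult_le_cancel_right1)
    finally show "fls_nth (qhalf_fls (- (a * int m)) :: 'a fls) k = fls_nth 0 k"
      by (simp add: qhalf_fls_nth)
  qed
  then show "\<exists>m0. \<forall>m\<ge>m0. \<forall>k\<le>B. fls_nth (qhalf_fls (- (a * int m)) :: 'a fls) k = fls_nth 0 k" ..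
qed

section \<open>The expansion at infinity\<close>

text \<open>
  Negative indices of the Laurent series count powers of $q^{1/2}$, so expansion embeds the polynomials
  without loss (\<open>poly_expand_nth\<close>).
\<close>

definition poly_expand :: "rat poly \<Rightarrow> rat fls" where
  "poly_expand p = poly (map_poly fls_const p) (qhalf_fls 1)"

lemma poly_expand_0 [simp]: "poly_expand 0 = 0"
  by (simp add: poly_expand_def)

lemma poly_expand_pCons [simp]: "poly_expand (pCons c p) = fls_const c + qhalf_fls 1 * poly_expand p"
  by (simp add: poly_expand_def map_poly_pCons)

lemma poly_expand_1 [simp]: "poly_expand 1 = 1"
  by (simp add: one_pCons)

lemma poly_expand_add: "poly_expand (p + q) = poly_expand p + poly_expand q"
proof (induction p arbitrary: q)
  case (pCons c p)
  show ?case
  proof (cases q)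
    case (pCons d r)
    then show ?thesis using pCons.IH[of r] by (simp add: algebra_simps flip: fls_plus_const)
  qed
qed simp

lemma poly_expand_smult: "poly_expand (smult c p) = fls_const c * poly_expand p"
  by (induction p) (simp_all add: algebra_simps flip: fls_const_mult_const)

lemma poly_expand_mult: "poly_expand (p * q) = poly_expand p * poly_expand q"
  by (induction p) (simp_all add: poly_expand_add poly_expand_smult algebra_simps)

lemma poly_expand_nth: "fls_nth (poly_expand p) (- int n) = coeff p n"
proof (induction p arbitrary: n)
  case (pCons c p)
  have "fls_nth (qhalf_fls 1 * poly_expand p) (- int n) = fls_nth (poly_expand p) (1 - int n)"
    by (simp add: qhalf_fls_times_nth)
  moreover have "fls_nth (poly_expand p) 1 = 0"
  proof (induction p)
    case (pCons c p)
    have "fls_nth (poly_expand p) k = 0" if "k > 0" for k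
      using that
    proof (induction p arbitrary: k)
      case (pCons c p)
      then show ?case by (simp add: qhalf_fls_times_nth)
    qed simp
    then show ?case by (simp add: qhalf_fls_times_nth)
  qed simp
  ultimately show ?case using pCons.IH[of "n - 1"] by (cases n) auto
qed simp

lemma poly_expand_eq_0_iff [simp]: "poly_expand p = 0 \<longleftrightarrow> p = 0"
  by (metis poly_expand_nth poly_expand_0 fls_zero_nth poly_eqI coeff_0)

lemma expand_inf_Fract:
  assumes "b \<noteq> 0"
  shows "expand_inf (Fract a b) = poly_expand a / poly_expand b"
proof -
  obtain a' b' where q: "quot_of_fract (Fract a b) = (a', b')" by force
  then have b': "b' \<noteq> 0" using snd_quot_of_fract_nonzero[of "Fract a b"] by simp
  have "Fract a' b' = Fract a b" using Fract_quot_of_fract[of "Fract a b"] q by simp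
  then have "a' * b = a * b'" using assms b' by (simp add: eq_fract)
  then have "poly_expand a' * poly_expand b = poly_expand a * poly_expand b'"
    by (simp flip: poly_expand_mult)
  then show ?thesis using assms b'
    by (simp add: expand_inf_def q frac_eq_eq flip: poly_expand_def)
qed

lemma expand_inf_arith:
  "expand_inf (x + y) = expand_inf x + expand_inf y"
  "expand_inf (x * y) = expand_inf x * expand_inf y"
  "expand_inf (- x) = - expand_inf x"
proof -
  obtain a b where x: "x = Fract a b" "b \<noteq> 0" by (cases x) auto
  obtain c d where y: "y = Fract c d" "d \<noteq> 0" by (cases y) auto
  show "expand_inf (x + y) = expand_inf x + expand_inf y"
    using x y by (simp add: expand_inf_Fract poly_expand_add poly_expand_mult add_frac_eq)
  show "expand_inf (x * y) = expand_inf x * expand_inf y"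
    using x y by (simp add: expand_inf_Fract poly_expand_mult)
  have "poly_expand (- a) = - poly_expand a"
    using poly_expand_add[of a "- a"] by (simp add: eq_neg_iff_add_eq_0 add.commute)
  then show "expand_inf (- x) = - expand_inf x"
    using x by (simp add: expand_inf_Fract)
qed

lemma expand_inf_0 [simp]: "expand_inf 0 = 0"
  using expand_inf_arith(1)[of 0 0] by simp

lemma expand_inf_1 [simp]: "expand_inf 1 = 1"
  using expand_inf_Fract[of 1 1] by (simp add: One_fract_def)

lemma expand_inf_diff: "expand_inf (x - y) = expand_inf x - expand_inf y"
  using expand_inf_arith(1)[of x "- y"] by (simp add: expand_inf_arith)

lemma expand_inf_inverse: "expand_inf (inverse x) = inverse (expand_inf x)"
proof (cases "x = 0")
  case False
  then have "expand_inf x * expand_inf (inverse x) = 1"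
    by (simp flip: expand_inf_arith)
  then show ?thesis by (metis inverse_unique)
qed simp

lemma expand_inf_divide: "expand_inf (x / y) = expand_inf x / expand_inf y"
  by (simp add: divide_inverse expand_inf_arith expand_inf_inverse)

lemma expand_inf_eq_0_iff [simp]: "expand_inf x = 0 \<longleftrightarrow> x = 0"
proof
  assume "expand_inf x = 0"
  then have "expand_inf (x * inverse x) = 0" by (simp add: expand_inf_arith)
  then show "x = 0" by (cases "x = 0") auto
qed simp

text \<open>
  Expansion is an injective homomorphism of fields, so identities between rational functions may be
  proved for their expansions.
\<close>

lemma expand_inf_inject: "expand_inf x = expand_inf y \<longleftrightarrow> x = y"
  using expand_inf_eq_0_iff[of "x - y"] by (simp add: expand_inf_diff del: expand_inf_eq_0_iff)

lemma expand_inf_sum: "expand_inf (\<Sum>i\<in>I. f i) = (\<Sum>i\<in>I. expand_inf (f i))"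
  by (induction I rule: infinite_finite_induct) (auto simp: expand_inf_arith)

lemma expand_inf_prod: "expand_inf (\<Prod>i\<in>I. f i) = (\<Prod>i\<in>I. expand_inf (f i))"
  by (induction I rule: infinite_finite_induct) (auto simp: expand_inf_arith)

lemma expand_inf_of_nat: "expand_inf (of_nat n) = of_nat n"
  by (induction n) (auto simp: expand_inf_arith)

lemma expand_inf_of_int: "expand_inf (of_int n) = of_int n"
  by (cases n) (auto simp: expand_inf_arith expand_inf_of_nat expand_inf_diff)

lemma expand_inf_power: "expand_inf (x ^ n) = expand_inf x ^ n"
  by (induction n) (auto simp: expand_inf_arith)

lemma expand_inf_qhalf_powi: "expand_inf (qhalf powi k) = qhalf_fls k"
proof -
  have 1: "expand_inf qhalf = qhalf_fls 1"
    unfolding qhalf_def by (subst expand_inf_Fract) (simp_all flip: one_pCons)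
  show ?thesis
  proof (cases "k \<ge> 0")
    case True
    then show ?thesis by (simp add: power_int_def expand_inf_power 1 qhalf_fls_power)
  next
    case False
    then have "expand_inf (qhalf powi k) = inverse (qhalf_fls (int (nat (- k))))"
      by (simp add: power_int_def expand_inf_power expand_inf_inverse 1 qhalf_fls_power power_inverse)
    then show ?thesis using False by (simp add: qhalf_fls_def fls_inverse_X_intpow)
  qed
qed

lemma qhalf_nz [simp]: "qhalf \<noteq> 0"
  by (simp add: qhalf_def Zero_fract_def eq_fract)

lemma expand_inf_qbr: "expand_inf (qbr m) = qhalf_fls m - qhalf_fls (- m)"
  by (simp add: qbr_def expand_inf_diff expand_inf_qhalf_powi)

lemma qbr_nz: "m \<noteq> 0 \<Longrightarrow> qbr m \<noteq> 0"
proof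
  assume m: "m \<noteq> 0" "qbr m = 0"
  then have "fls_nth (qhalf_fls m - qhalf_fls (- m) :: rat fls) m = 0"
    using expand_inf_qbr[of m] by simp
  then show False using m(1) by (simp add: qhalf_fls_nth)
qed

section \<open>Schur functions at the alphabets of partitions\<close>

definition msets :: "nat \<Rightarrow> nat \<Rightarrow> nat multiset set" where
  "msets m n = {M. set_mset M \<subseteq> {1..m} \<and> size M = n}"

lemma msets_0: "msets 0 n = (if n = 0 then {{#}} else {})"
  by (auto simp: msets_def)

lemma msets_Suc_bij:
  "bij_betw (\<lambda>(r, M). M + replicate_mset r (Suc m)) (SIGMA r:{..n}. msets m (n - r)) (msets (Suc m) n)"
proof (rule bij_betw_byWitness[where f' = "\<lambda>M. (count M (Suc m), filter_mset (\<lambda>x. x \<noteq> Suc m) M)"])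
  let ?f = "\<lambda>x. x \<noteq> Suc m"
  have filt: "filter_mset ?f X = X" "count X (Suc m) = 0" if "set_mset X \<subseteq> {1..m}" for X
  proof -
    have nin: "Suc m \<notin># X" using that by auto
    then show "filter_mset ?f X = X"
      by (intro multiset_eqI) (auto simp: not_in_iff)
    show "count X (Suc m) = 0" using nin by (simp add: not_in_iff)
  qed
  have fr: "filter_mset ?f (replicate_mset k (Suc m)) = {#}" for k by (induction k) simp_all
  show "\<forall>p\<in>SIGMA r:{..n}. msets m (n - r).
      (count (case p of (r, M) \<Rightarrow> M + replicate_mset r (Suc m)) (Suc m),
       filter_mset ?f (case p of (r, M) \<Rightarrow> M + replicate_mset r (Suc m))) = p"
    by (auto simp: msets_def filt fr)
  show "\<forall>M\<in>msets (Suc m) n. (case (count M (Suc m), filter_mset ?f M) of (r, M) \<Rightarrow> M + replicate_mset r (Suc m)) = M"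
    by (simp add: mset_split_off)
  show "(\<lambda>(r, M). M + replicate_mset r (Suc m)) ` (SIGMA r:{..n}. msets m (n - r)) \<subseteq> msets (Suc m) n"
    by (auto simp: msets_def split: if_splits)
  show "(\<lambda>M. (count M (Suc m), filter_mset ?f M)) ` msets (Suc m) n \<subseteq> (SIGMA r:{..n}. msets m (n - r))"
  proof (rule image_subsetI)
    fix M assume M: "M \<in> msets (Suc m) n"
    have "size (filter_mset ?f M) + count M (Suc m) = size M"
      using arg_cong[OF mset_split_off[of "Suc m" M], of size] by simp
    then show "(count M (Suc m), filter_mset ?f M) \<in> (SIGMA r:{..n}. msets m (n - r))"
      using M by (auto simp: msets_def le_Suc_eq)
  qed
qed

lemma finite_msets [simp]: "finite (msets m n)"
proof (induction m arbitrary: n)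
  case (Suc m)
  then show ?case using bij_betw_finite[OF msets_Suc_bij[of m n]] by auto
qed (simp add: msets_0)

lemma evs_eq_sum_monomials:
  fixes x :: "nat \<Rightarrow> 'a::comm_ring_1"
  shows "evs x m \<rho> = (\<Sum>M\<in>msets m (psize \<rho>). of_int (mcoeff (schur \<rho>) M) * (\<Prod>i\<in>#M. x i))"
proof (induction m arbitrary: \<rho>)
  case 0
  then show ?case by (auto simp: msets_0 mcoeff_schur_empty_mset psize_eq_0_iff)
next
  case (Suc m)
  let ?n = "psize \<rho>" and ?t = "\<lambda>M. \<Prod>i\<in>#M. x i"
  have "(\<Sum>M\<in>msets (Suc m) ?n. of_int (mcoeff (schur \<rho>) M) * ?t M) =
      (\<Sum>(r, M)\<in>(SIGMA r:{..?n}. msets m (?n - r)).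
         of_int (mcoeff (schur \<rho>) (M + replicate_mset r (Suc m))) * ?t (M + replicate_mset r (Suc m)))"
    by (subst sum.reindex_bij_betw[OF msets_Suc_bij, symmetric]) (simp add: case_prod_unfold)
  also have "\<dots> = (\<Sum>r\<le>?n. \<Sum>M\<in>msets m (?n - r).
         of_int (mcoeff (schur \<rho>) (M + replicate_mset r (Suc m))) * ?t (M + replicate_mset r (Suc m)))"
    by (rule sum.Sigma [symmetric]) auto
  also have "\<dots> = (\<Sum>r\<le>?n. \<Sum>M\<in>msets m (?n - r). \<Sum>\<kappa>\<in>pieri_down r \<rho>.
         x (Suc m) ^ r * (of_int (mcoeff (schur \<kappa>) M) * ?t M))"
    by (intro sum.cong refl)
       (auto simp: msets_def schur_branching sum_distrib_right sum_distrib_left mult_ac intro!: sum.cong)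
  also have "\<dots> = (\<Sum>r\<le>?n. \<Sum>\<kappa>\<in>pieri_down r \<rho>. \<Sum>M\<in>msets m (?n - r).
         x (Suc m) ^ r * (of_int (mcoeff (schur \<kappa>) M) * ?t M))"
    by (rule sum.cong[OF refl], rule sum.swap)
  also have "\<dots> = (\<Sum>r\<le>?n. \<Sum>\<kappa>\<in>pieri_down r \<rho>. x (Suc m) ^ r * evs x m \<kappa>)"
  proof (intro sum.cong refl)
    fix r \<kappa> assume "\<kappa> \<in> pieri_down r \<rho>"
    then have "?n - r = psize \<kappa>" by (auto simp: pieri_down_def)
    then show "(\<Sum>M\<in>msets m (?n - r). x (Suc m) ^ r * (of_int (mcoeff (schur \<kappa>) M) * ?t M)) =
        x (Suc m) ^ r * evs x m \<kappa>"
      by (simp add: Suc.IH sum_distrib_left)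
  qed
  finally show ?case by simp
qed

definition rho_exp :: "partition \<Rightarrow> nat \<Rightarrow> int" where
  "rho_exp \<alpha> i = 2 * int (part \<alpha> i) - 2 * int i + 1"

definition rho_var :: "partition \<Rightarrow> nat \<Rightarrow> rat fls" where
  "rho_var \<alpha> i = qhalf_fls (rho_exp \<alpha> i)"

definition wt :: "partition \<Rightarrow> nat multiset \<Rightarrow> int" where
  "wt \<alpha> M = (\<Sum>i\<in>#M. rho_exp \<alpha> i)"

lemma prod_rho_var: "(\<Prod>i\<in>#M. rho_var \<alpha> i) = qhalf_fls (wt \<alpha> M)"
  by (induction M) (auto simp: wt_def rho_var_def qhalf_fls_add)

text \<open>
  Variable number $i$ has at most this weight minus $2 i$, so a monomial of given degree and bounded
  order contains only boundedly many variables.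
\<close>

definition wt_bound :: "partition \<Rightarrow> int" where
  "wt_bound \<alpha> = 2 * int (psize \<alpha>) + 1"

lemma rho_exp_le: "rho_exp \<alpha> i \<le> wt_bound \<alpha> - 2 * int i"
  using parts_of_le_psize[of \<alpha> "i - 1"] by (simp add: rho_exp_def part_def wt_bound_def)

lemma wt_le: "wt \<alpha> M \<le> wt_bound \<alpha> * int (size M)"
proof (induction M)
  case (add i M)
  then show ?case using rho_exp_le[of \<alpha> i] by (simp add: wt_def algebra_simps)
qed (simp add: wt_def)

lemma wt_le_member:
  assumes "i \<in># M"
  shows "wt \<alpha> M \<le> wt_bound \<alpha> * int (size M) - 2 * int i"
proof -
  obtain M' where "M = add_mset i M'" using assms by (metis mset_add)
  then show ?thesis using wt_le[of \<alpha> M'] rho_exp_le[of \<alpha> i] by (simp add: wt_def algebra_simps)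
qed

definition eval_term :: "partition \<Rightarrow> partition \<Rightarrow> nat multiset \<Rightarrow> rat fls" where
  "eval_term \<nu> \<alpha> M = of_int (mcoeff (schur \<nu>) M) * qhalf_fls (wt \<alpha> M)"

lemma eval_term_nth: "fls_nth (eval_term \<nu> \<alpha> M) k = (if k = - wt \<alpha> M then of_int (mcoeff (schur \<nu>) M) else 0)"
  by (auto simp: eval_term_def qhalf_fls_nth)

lemma eval_rho_schur_eq:
  "eval_rho (schur \<nu>) \<alpha> = (THE R. (eval_term \<nu> \<alpha> has_sum expand_inf R) {M. 0 \<notin># M})"
  unfolding eval_rho_def eval_term_def[abs_def] prod_rho_var[symmetric] rho_var_def rho_exp_def ..

lemma eval_term_bounded:
  assumes "0 \<notin># M" "k \<le> B" "fls_nth (eval_term \<nu> \<alpha> M) k \<noteq> 0"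
    and m: "nat (wt_bound \<alpha> * int (psize \<nu>) + B) \<le> m"
  shows "M \<in> msets m (psize \<nu>)"
proof -
  have sz: "size M = psize \<nu>" and k: "k = - wt \<alpha> M"
    using assms(3) mcoeff_schur_size[of \<nu> M] by (auto simp: eval_term_nth split: if_splits)
  have "i \<in> {1..m}" if i: "i \<in># M" for i
  proof -
    have "2 * int i \<le> wt_bound \<alpha> * int (psize \<nu>) + B"
      using wt_le_member[OF i, of \<alpha>] k assms(2) sz by simp
    moreover have "i \<noteq> 0" using i assms(1) by (cases "i = 0") auto
    ultimately show ?thesis using m by simp
  qed
  then show ?thesis using sz by (auto simp: msets_def)
qed

text \<open>
  The sum over all monomials that defines \<open>eval_rho\<close> converges, and it is the limit of the values at
  the first \<open>m\<close> letters.
\<close>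

lemma eval_term_has_sum:
  obtains S where "(eval_term \<nu> \<alpha> has_sum S) {M. 0 \<notin># M}" and "fls_lim (\<lambda>m. evs (rho_var \<alpha>) m \<nu>) S"
proof -
  have "finite {M\<in>{M. 0 \<notin># M}. \<exists>k\<le>B. fls_nth (eval_term \<nu> \<alpha> M) k \<noteq> 0}" for B
    by (rule finite_subset[OF _ finite_msets[of "nat (wt_bound \<alpha> * int (psize \<nu>) + B)" "psize \<nu>"]])
       (use eval_term_bounded in blast)
  then obtain S where S: "(eval_term \<nu> \<alpha> has_sum S) {M. 0 \<notin># M}"
    and nth: "\<And>k. fls_nth S k =
      (\<Sum>M | M \<in> {M. 0 \<notin># M} \<and> fls_nth (eval_term \<nu> \<alpha> M) k \<noteq> 0. fls_nth (eval_term \<nu> \<alpha> M) k)"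
    by (rule fls_has_sum[of "{M. 0 \<notin># M}" "eval_term \<nu> \<alpha>"]) blast
  have "fls_lim (\<lambda>m. evs (rho_var \<alpha>) m \<nu>) S"
    unfolding fls_lim_def
  proof (intro allI exI impI)
    fix B m k assume m: "nat (wt_bound \<alpha> * int (psize \<nu>) + B) \<le> m" and k: "k \<le> B"
    have "fls_nth (evs (rho_var \<alpha>) m \<nu>) k = (\<Sum>M\<in>msets m (psize \<nu>). fls_nth (eval_term \<nu> \<alpha> M) k)"
      by (simp add: evs_eq_sum_monomials prod_rho_var fls_nth_sum eval_term_def)
    also have "\<dots> = fls_nth S k"
      unfolding nth
    proof (rule sum.mono_neutral_right)
      show "{M. M \<in> {M. 0 \<notin># M} \<and> fls_nth (eval_term \<nu> \<alpha> M) k \<noteq> 0} \<subseteq> msets m (psize \<nu>)"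
        using eval_term_bounded[OF _ k _ m] by blast
      show "\<forall>M\<in>msets m (psize \<nu>) - {M. M \<in> {M. 0 \<notin># M} \<and> fls_nth (eval_term \<nu> \<alpha> M) k \<noteq> 0}.
          fls_nth (eval_term \<nu> \<alpha> M) k = 0"
        by (auto simp: msets_def)
    qed simp
    finally show "fls_nth (evs (rho_var \<alpha>) m \<nu>) k = fls_nth S k" .
  qed
  then show ?thesis using S that by blast
qed

definition schur_lim :: "partition \<Rightarrow> partition \<Rightarrow> rat fls" where
  "schur_lim \<alpha> \<nu> = infsum (eval_term \<nu> \<alpha>) {M. 0 \<notin># M}"

lemma schur_lim:
  "(eval_term \<nu> \<alpha> has_sum schur_lim \<alpha> \<nu>) {M. 0 \<notin># M}" "fls_lim (\<lambda>m. evs (rho_var \<alpha>) m \<nu>) (schur_lim \<alpha> \<nu>)"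
proof -
  obtain S where "(eval_term \<nu> \<alpha> has_sum S) {M. 0 \<notin># M}" "fls_lim (\<lambda>m. evs (rho_var \<alpha>) m \<nu>) S"
    by (rule eval_term_has_sum)
  then show "(eval_term \<nu> \<alpha> has_sum schur_lim \<alpha> \<nu>) {M. 0 \<notin># M}"
    "fls_lim (\<lambda>m. evs (rho_var \<alpha>) m \<nu>) (schur_lim \<alpha> \<nu>)"
    by (simp_all add: schur_lim_def infsumI)
qed

text \<open>
  Multiplicativity is a polynomial identity, hence it passes to the limit.
\<close>

lemma schur_hom_schur_lim: "schur_hom (schur_lim \<alpha>)"
  unfolding schur_hom_def
proof (intro conjI allI)
  have "fls_lim (\<lambda>m. evs (rho_var \<alpha>) m empty_partition) 1"
    by (simp add: schur_hom_empty[OF schur_hom_evs])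
  then show "schur_lim \<alpha> empty_partition = 1" using schur_lim(2) fls_lim_unique by blast
  fix \<eta> \<rho>
  have "fls_lim (\<lambda>m. evs (rho_var \<alpha>) m \<eta> * evs (rho_var \<alpha>) m \<rho>) (schur_lim \<alpha> \<eta> * schur_lim \<alpha> \<rho>)"
    by (intro fls_lim_times schur_lim)
  moreover have "fls_lim (\<lambda>m. evs (rho_var \<alpha>) m \<eta> * evs (rho_var \<alpha>) m \<rho>)
      (\<Sum>\<nu>\<in>partitions (psize \<eta> + psize \<rho>). of_int (lr \<nu> \<eta> \<rho>) * schur_lim \<alpha> \<nu>)"
    unfolding schur_hom_times[OF schur_hom_evs]
    by (intro fls_lim_sum fls_lim_times schur_lim fls_lim_const)
  ultimately show "schur_lim \<alpha> \<eta> * schur_lim \<alpha> \<rho> =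
      (\<Sum>\<nu>\<in>partitions (psize \<eta> + psize \<rho>). of_int (lr \<nu> \<eta> \<rho>) * schur_lim \<alpha> \<nu>)"
    by (rule fls_lim_unique)
qed

text \<open>
  The power sum $p_k(q^{\alpha+\rho})$ as a rational function: finitely many corrections to the geometric
  series for the empty partition.
\<close>

definition power_rho :: "partition \<Rightarrow> nat \<Rightarrow> qrat" where
  "power_rho \<alpha> k = (\<Sum>i=1..plen \<alpha>. qhalf powi (int k * (2 * int (part \<alpha> i) - 2 * int i + 1)) -
     qhalf powi (int k * (1 - 2 * int i))) + 1 / qbr (int k)"

lemma geometric_rho:
  assumes "k > 0"
  shows "(\<Sum>i=1..m. qhalf_fls (int k * (1 - 2 * int i))) = (1 - qhalf_fls (- (2 * int k * int m))) * expand_inf (1 / qbr (int k))"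
proof -
  have nz: "expand_inf (qbr (int k)) \<noteq> 0" using qbr_nz[of "int k"] assms by simp
  have "expand_inf (qbr (int k)) * (\<Sum>i=1..m. qhalf_fls (int k * (1 - 2 * int i))) = 1 - qhalf_fls (- (2 * int k * int m))"
  proof (induction m)
    case (Suc m)
    have "qhalf_fls (int k) * qhalf_fls (int k * (1 - 2 * int (Suc m))) = (qhalf_fls (- (2 * int k * int m)) :: rat fls)"
      "qhalf_fls (- int k) * qhalf_fls (int k * (1 - 2 * int (Suc m))) = (qhalf_fls (- (2 * int k * int (Suc m))) :: rat fls)"
      by (simp_all add: algebra_simps flip: qhalf_fls_add)
    then show ?case using Suc by (simp add: expand_inf_qbr algebra_simps)
  qed (simp)
  then show ?thesis using nz by (simp add: expand_inf_divide field_simps)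
qed

lemma fls_lim_power_rho:
  assumes "k > 0"
  shows "fls_lim (\<lambda>m. \<Sum>i=1..m. rho_var \<alpha> i ^ k) (expand_inf (power_rho \<alpha> k))"
proof -
  define P :: "rat fls" where "P = (\<Sum>i=1..plen \<alpha>. qhalf_fls (int k * rho_exp \<alpha> i) - qhalf_fls (int k * (1 - 2 * int i)))"
  have eq: "(\<Sum>i=1..m. rho_var \<alpha> i ^ k) = P + (1 - qhalf_fls (- (2 * int k * int m))) * expand_inf (1 / qbr (int k))"
    if m: "m \<ge> plen \<alpha>" for m
  proof -
    have "(\<Sum>i=1..m. rho_var \<alpha> i ^ k) = (\<Sum>i=1..m. qhalf_fls (int k * rho_exp \<alpha> i) - qhalf_fls (int k * (1 - 2 * int i))) +
        (\<Sum>i=1..m. qhalf_fls (int k * (1 - 2 * int i)))"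
      by (simp add: rho_var_def qhalf_fls_power sum_subtractf)
    also have "(\<Sum>i=1..m. qhalf_fls (int k * rho_exp \<alpha> i) - qhalf_fls (int k * (1 - 2 * int i))) = P"
      unfolding P_def
    proof (rule sum.mono_neutral_right)
      show "\<forall>i\<in>{1..m} - {1..plen \<alpha>}. qhalf_fls (int k * rho_exp \<alpha> i) - qhalf_fls (int k * (1 - 2 * int i)) = (0 :: rat fls)"
      proof
        fix i assume "i \<in> {1..m} - {1..plen \<alpha>}"
        then have "part \<alpha> i = 0" using parts_of_eq_0_iff[of \<alpha> "i - 1"] by (auto simp: part_def)
        then have "rho_exp \<alpha> i = 1 - 2 * int i" by (simp add: rho_exp_def)
        then show "qhalf_fls (int k * rho_exp \<alpha> i) - qhalf_fls (int k * (1 - 2 * int i)) = (0 :: rat fls)"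
          by simp
      qed
    qed (use m in auto)
    finally show ?thesis unfolding geometric_rho[OF assms] .
  qed
  have "fls_lim (\<lambda>m. P + (1 + (- 1) * qhalf_fls (- ((2 * int k) * int m))) * expand_inf (1 / qbr (int k)))
      (P + (1 + (- 1) * 0) * expand_inf (1 / qbr (int k)))"
    by (intro fls_lim_add fls_lim_times fls_lim_const fls_lim_qhalf_0) (use assms in simp)
  also have "P + (1 + (- 1) * 0) * expand_inf (1 / qbr (int k)) = expand_inf (power_rho \<alpha> k)"
    by (simp add: power_rho_def P_def expand_inf_arith expand_inf_sum expand_inf_diff expand_inf_qhalf_powi rho_exp_def)
  finally have lim: "fls_lim (\<lambda>m. P + (1 - qhalf_fls (- (2 * int k * int m))) * expand_inf (1 / qbr (int k)))
      (expand_inf (power_rho \<alpha> k))" by simp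
  show ?thesis
    unfolding fls_lim_def
  proof
    fix B
    obtain m0 where m0: "\<forall>m\<ge>m0. \<forall>j\<le>B. fls_nth (P + (1 - qhalf_fls (- (2 * int k * int m))) * expand_inf (1 / qbr (int k))) j =
        fls_nth (expand_inf (power_rho \<alpha> k)) j"
      using fls_limD[OF lim, of B] by blast
    have "\<forall>m\<ge>max m0 (plen \<alpha>). \<forall>j\<le>B. fls_nth (\<Sum>i=1..m. rho_var \<alpha> i ^ k) j = fls_nth (expand_inf (power_rho \<alpha> k)) j"
      using m0 eq by (metis max.boundedE)
    then show "\<exists>m0. \<forall>m\<ge>m0. \<forall>j\<le>B. fls_nth (\<Sum>i=1..m. rho_var \<alpha> i ^ k) j = fls_nth (expand_inf (power_rho \<alpha> k)) j"
      by blast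
  qed
qed

lemma newton_lim:
  assumes "\<And>m. newton (\<lambda>k. p m k) (\<lambda>n. h m n)"
    and p: "\<And>k. k > 0 \<Longrightarrow> fls_lim (\<lambda>m. p m k) (P k)" and h: "\<And>n. fls_lim (\<lambda>m. h m n) (H n)"
  shows "newton P H"
  unfolding newton_def
proof (intro conjI allI)
  have "fls_lim (\<lambda>m. h m 0) 1" using assms(1) by (simp add: newton_def)
  then show "H 0 = 1" using h fls_lim_unique by blast
  fix n
  have "fls_lim (\<lambda>m. of_nat n * h m n) (of_nat n * H n)"
    by (intro fls_lim_times fls_lim_const h)
  moreover have "of_nat n * h m n = (\<Sum>k=1..n. p m k * h m (n - k))" for m
    using assms(1)[of m] by (simp add: newton_def)
  ultimately have "fls_lim (\<lambda>m. \<Sum>k=1..n. p m k * h m (n - k)) (of_nat n * H n)" by simp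
  moreover have "fls_lim (\<lambda>m. \<Sum>k=1..n. p m k * h m (n - k)) (\<Sum>k=1..n. P k * H (n - k))"
    by (intro fls_lim_sum fls_lim_times p h) simp
  ultimately show "of_nat n * H n = (\<Sum>k=1..n. P k * H (n - k))" by (rule fls_lim_unique)
qed

lemma newton_schur_lim: "newton (\<lambda>k. expand_inf (power_rho \<alpha> k)) (\<lambda>n. schur_lim \<alpha> (row_partition n))"
proof (rule newton_lim)
  show "newton (\<lambda>k. \<Sum>i=1..m. rho_var \<alpha> i ^ k) (\<lambda>n. evs (rho_var \<alpha>) m (row_partition n))" for m
    by (rule evs_row_newton)
qed (rule fls_lim_power_rho schur_lim(2); assumption)+

text \<open>
  Newton's identities express $h_n$ by the power sums, which are rational.
\<close>

lemma schur_lim_row_rational: "schur_lim \<alpha> (row_partition n) \<in> range expand_inf"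
proof (induction n rule: less_induct)
  case (less n)
  show ?case
  proof (cases "n = 0")
    case True
    then have "schur_lim \<alpha> (row_partition n) = expand_inf 1"
      by (simp add: schur_hom_empty[OF schur_hom_schur_lim])
    then show ?thesis by blast
  next
    case False
    have "\<forall>j. \<exists>R. j < n \<longrightarrow> schur_lim \<alpha> (row_partition j) = expand_inf R" using less by blast
    then obtain R where R: "\<And>j. j < n \<Longrightarrow> schur_lim \<alpha> (row_partition j) = expand_inf (R j)" by metis
    have "of_nat n * schur_lim \<alpha> (row_partition n) = (\<Sum>k=1..n. expand_inf (power_rho \<alpha> k) * schur_lim \<alpha> (row_partition (n - k)))"
      using newton_schur_lim[of \<alpha>] by (simp add: newton_def)
    also have "\<dots> = (\<Sum>k=1..n. expand_inf (power_rho \<alpha> k) * expand_inf (R (n - k)))"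
      using False by (intro sum.cong refl) (simp add: R)
    also have "\<dots> = expand_inf (\<Sum>k=1..n. power_rho \<alpha> k * R (n - k))"
      by (simp add: expand_inf_sum expand_inf_arith)
    finally have "schur_lim \<alpha> (row_partition n) = expand_inf ((\<Sum>k=1..n. power_rho \<alpha> k * R (n - k)) / of_nat n)"
      using False by (simp add: expand_inf_divide expand_inf_of_nat field_simps)
    then show ?thesis by blast
  qed
qed

lemma schur_lim_rational: "schur_lim \<alpha> \<nu> \<in> range expand_inf"
proof (rule pieri_induct)
  show "x - y \<in> range expand_inf" if "x \<in> range expand_inf" "y \<in> range expand_inf" for x y
    using that by (auto simp flip: expand_inf_diff)
  have "schur_lim \<alpha> empty_partition = expand_inf 1" by (simp add: schur_hom_empty[OF schur_hom_schur_lim])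
  then show "schur_lim \<alpha> empty_partition \<in> range expand_inf" by blast
  fix \<kappa> r assume "schur_lim \<alpha> \<kappa> \<in> range expand_inf"
  then show "(\<Sum>\<nu>\<in>pieri_up r \<kappa>. schur_lim \<alpha> \<nu>) \<in> range expand_inf"
    using schur_lim_row_rational[of \<alpha> r]
    by (auto simp flip: schur_hom_pieri[OF schur_hom_schur_lim] expand_inf_arith)
qed

text \<open>
  Since the limit is the expansion of a rational function, and of only one, the definite description in
  \<open>eval_rho\<close> denotes that function.
\<close>

lemma expand_inf_eval_rho: "expand_inf (eval_rho (schur \<nu>) \<alpha>) = schur_lim \<alpha> \<nu>"
proof -
  obtain R where R: "schur_lim \<alpha> \<nu> = expand_inf R" using schur_lim_rational by blast
  have "eval_rho (schur \<nu>) \<alpha> = R"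
    unfolding eval_rho_schur_eq
  proof (rule the_equality)
    show "(eval_term \<nu> \<alpha> has_sum expand_inf R) {M. 0 \<notin># M}" using schur_lim(1)[of \<nu> \<alpha>] R by simp
    fix R' assume "(eval_term \<nu> \<alpha> has_sum expand_inf R') {M. 0 \<notin># M}"
    then have "expand_inf R' = expand_inf R" using schur_lim(1)[of \<nu> \<alpha>] R by (metis infsumI)
    then show "R' = R" by (simp add: expand_inf_inject)
  qed
  then show ?thesis using R by simp
qed

lemma schur_hom_eval_rho: "schur_hom (\<lambda>\<nu>. eval_rho (schur \<nu>) \<alpha>)"
  unfolding schur_hom_def
proof (intro conjI allI)
  show "eval_rho (schur empty_partition) \<alpha> = 1"
    by (subst expand_inf_inject [symmetric]) (simp only: expand_inf_eval_rho schur_hom_empty[OF schur_hom_schur_lim] expand_inf_1)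
  fix \<eta> \<rho>
  have "expand_inf (eval_rho (schur \<eta>) \<alpha> * eval_rho (schur \<rho>) \<alpha>) =
      expand_inf (\<Sum>\<nu>\<in>partitions (psize \<eta> + psize \<rho>). of_int (lr \<nu> \<eta> \<rho>) * eval_rho (schur \<nu>) \<alpha>)"
    by (simp only: expand_inf_arith expand_inf_sum expand_inf_of_int expand_inf_eval_rho
        schur_hom_times[OF schur_hom_schur_lim])
  then show "eval_rho (schur \<eta>) \<alpha> * eval_rho (schur \<rho>) \<alpha> =
      (\<Sum>\<nu>\<in>partitions (psize \<eta> + psize \<rho>). of_int (lr \<nu> \<eta> \<rho>) * eval_rho (schur \<nu>) \<alpha>)"
    by (simp only: expand_inf_inject)
qed

text \<open>
  The Cauchy identity for two infinite alphabets: the first is already a multiplicative functional, and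
  the second is the limit of its finite parts.
\<close>

lemma newton_cauchy_eval_rho:
  "newton (\<lambda>k. power_rho \<alpha> k * power_rho \<beta> k)
     (\<lambda>n. \<Sum>\<rho>\<in>partitions n. eval_rho (schur \<rho>) \<alpha> * eval_rho (schur \<rho>) \<beta>)"
proof -
  have "newton (\<lambda>k. expand_inf (power_rho \<alpha> k) * expand_inf (power_rho \<beta> k))
      (\<lambda>n. \<Sum>\<rho>\<in>partitions n. schur_lim \<alpha> \<rho> * schur_lim \<beta> \<rho>)"
  proof (rule newton_lim[where p = "\<lambda>m k. expand_inf (power_rho \<alpha> k) * (\<Sum>i=1..m. rho_var \<beta> i ^ k)"
        and h = "\<lambda>m n. \<Sum>\<rho>\<in>partitions n. schur_lim \<alpha> \<rho> * evs (rho_var \<beta>) m \<rho>"])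
    show "newton (\<lambda>k. expand_inf (power_rho \<alpha> k) * (\<Sum>i=1..m. rho_var \<beta> i ^ k))
        (\<lambda>n. \<Sum>\<rho>\<in>partitions n. schur_lim \<alpha> \<rho> * evs (rho_var \<beta>) m \<rho>)" for m
      by (rule cauchy_newton[OF schur_hom_schur_lim newton_schur_lim])
  qed (intro fls_lim_times fls_lim_sum fls_lim_const fls_lim_power_rho schur_lim(2); assumption?)+
  then have N: "newton (\<lambda>k. expand_inf (power_rho \<alpha> k * power_rho \<beta> k))
      (\<lambda>n. expand_inf (\<Sum>\<rho>\<in>partitions n. eval_rho (schur \<rho>) \<alpha> * eval_rho (schur \<rho>) \<beta>))"
    by (simp only: expand_inf_arith expand_inf_sum expand_inf_eval_rho)
  show ?thesis
    unfolding newton_def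
  proof (intro conjI allI)
    show "(\<Sum>\<rho>\<in>partitions 0. eval_rho (schur \<rho>) \<alpha> * eval_rho (schur \<rho>) \<beta>) = 1"
      using N unfolding newton_def by (metis expand_inf_1 expand_inf_inject)
    fix n
    show "of_nat n * (\<Sum>\<rho>\<in>partitions n. eval_rho (schur \<rho>) \<alpha> * eval_rho (schur \<rho>) \<beta>) =
      (\<Sum>k=1..n. power_rho \<alpha> k * power_rho \<beta> k *
        (\<Sum>\<rho>\<in>partitions (n - k). eval_rho (schur \<rho>) \<alpha> * eval_rho (schur \<rho>) \<beta>))"
      using N unfolding newton_def
      by (subst expand_inf_inject [symmetric])
         (simp only: expand_inf_arith(2)[of "of_nat n"] expand_inf_of_nat expand_inf_sum[of _ "{1..n}"]
            expand_inf_arith(2)[of "power_rho \<alpha> _ * power_rho \<beta> _"])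
  qed
qed

section \<open>Conjugation and hook lengths\<close>

lemma less_parts_of_conjugate: "i < parts_of (conjugate \<mu>) j \<longleftrightarrow> j < parts_of \<mu> i"
proof -
  let ?S = "{i. j < parts_of \<mu> i}"
  have "finite ?S" by (rule finite_subset[OF _ finite_parts_of[of \<mu>]]) auto
  define k where "k = (LEAST i. \<not> j < parts_of \<mu> i)"
  have k: "\<not> j < parts_of \<mu> k"
    unfolding k_def by (rule LeastI[of _ "plen \<mu>"]) (simp add: parts_of_eq_0_iff[THEN iffD2])
  have S: "i \<in> ?S \<longleftrightarrow> i < k" for i
  proof
    assume "i \<in> ?S"
    then show "i < k" using k parts_of_antimono[of k i \<mu>] by (auto simp: not_less[symmetric] intro: ccontr)
  next
    assume "i < k"
    then have "\<not> \<not> j < parts_of \<mu> i" unfolding k_def by (rule not_less_Least)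
    then show "i \<in> ?S" by simp
  qed
  then have "?S = {..<k}" by blast
  then have "parts_of (conjugate \<mu>) j = k" by (simp add: conjugate.rep_eq)
  then show ?thesis using S[of i] by simp
qed

lemma mem_diagram_conjugate: "(i, j) \<in> diagram (conjugate \<mu>) \<longleftrightarrow> (j, i) \<in> diagram \<mu>"
  using less_parts_of_conjugate[of "j - 1" \<mu> "i - 1"] by (auto simp: mem_diagram)

lemma le_part_conjugate:
  assumes "1 \<le> i" "1 \<le> j"
  shows "i \<le> part (conjugate \<mu>) j \<longleftrightarrow> j \<le> part \<mu> i"
  using less_parts_of_conjugate[of "i - 1" \<mu> "j - 1"] assms by (auto simp: part_def)

lemma diagram_conjugate: "diagram (conjugate \<mu>) = prod.swap ` diagram \<mu>"
  by (auto simp: mem_diagram_conjugate intro: rev_image_eqI)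

lemma conjugate_conjugate [simp]: "conjugate (conjugate \<mu>) = \<mu>"
  by (rule diagram_inject) (auto simp: mem_diagram_conjugate)

lemma sum_diagram_conjugate: "(\<Sum>(i, j)\<in>diagram (conjugate \<mu>). f i j) = (\<Sum>(i, j)\<in>diagram \<mu>. f j i)"
  unfolding diagram_conjugate by (subst sum.reindex) (auto simp: case_prod_unfold)

lemma prod_diagram_conjugate: "(\<Prod>(i, j)\<in>diagram (conjugate \<mu>). f i j) = (\<Prod>(i, j)\<in>diagram \<mu>. f j i)"
  unfolding diagram_conjugate by (subst prod.reindex) (auto simp: case_prod_unfold)

lemma psize_conjugate [simp]: "psize (conjugate \<mu>) = psize \<mu>"
  unfolding card_diagram[symmetric] diagram_conjugate by (rule card_image) simp

text \<open>
  Twice the sum of the contents of the cells; transposition changes the sign of every content.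
\<close>

lemma kappa_contents: "kappa \<mu> = 2 * (\<Sum>(i, j)\<in>diagram \<mu>. int j - int i)"
proof -
  have row: "int m * (int m - 2 * int i + 1) = 2 * (\<Sum>j=1..m. int j - int i)" for m i
    by (induction m) (auto simp: algebra_simps)
  show ?thesis
    unfolding kappa_def diagram_Sigma row by (simp add: sum.Sigma sum_distrib_left case_prod_unfold right_diff_distrib)
qed

lemma kappa_conjugate: "kappa (conjugate \<mu>) = - kappa \<mu>"
  unfolding kappa_contents sum_diagram_conjugate
  by (simp add: case_prod_unfold sum_subtractf)

definition hook :: "partition \<Rightarrow> nat \<Rightarrow> nat \<Rightarrow> int" where
  "hook \<mu> i j = int (part \<mu> i) + int (part (conjugate \<mu>) j) - int i - int j + 1"

lemma part_antimono: "i \<le> j \<Longrightarrow> part \<mu> j \<le> part \<mu> i"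
  by (auto simp: part_def intro: parts_of_antimono)

lemma part_pos_iff: "1 \<le> i \<Longrightarrow> 1 \<le> part \<mu> i \<longleftrightarrow> i \<le> plen \<mu>"
  using parts_of_eq_0_iff[of \<mu> "i - 1"] by (auto simp: part_def)

text \<open>
  The hook lengths in row \<open>i\<close> and the differences $\mu_i - \mu_k + k - i$ for $k > i$ are disjoint, and
  together they are the numbers from 1 to $\mu_i + l - i$. For the disjointness, compare the difference for
  \<open>k\<close> with the hook length for \<open>j\<close>: the former is smaller if cell $(k, j)$ is in the diagram, and larger if
  not. The count then does the rest.
\<close>

lemma hook_row:
  assumes i: "i \<in> {1..plen \<mu>}"
  defines "l \<equiv> plen \<mu>"
  shows "(\<Prod>k=i+1..l. g (int (part \<mu> i) - int (part \<mu> k) + int k - int i)) * (\<Prod>j=1..part \<mu> i. g (hook \<mu> i j)) =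
    (\<Prod>n=1..part \<mu> i + l - i. (g (int n) :: 'a::comm_monoid_mult))"
proof -
  define a where "a k = int (part \<mu> i) - int (part \<mu> k) + int k - int i" for k
  define A where "A = a ` {i+1..l}"
  define B where "B = hook \<mu> i ` {1..part \<mu> i}"
  define C where "C = int ` {1..part \<mu> i + l - i}"
  have conj: "part (conjugate \<mu>) j' \<le> part (conjugate \<mu>) j" if "j \<le> j'" for j j'
    by (rule part_antimono[OF that])
  have injA: "inj_on a {i+1..l}"
  proof (rule linorder_inj_onI)
    fix k k' :: nat assume "k < k'"
    then show "a k \<noteq> a k'" using part_antimono[of k k' \<mu>] by (simp add: a_def)
  qed auto
  have injB: "inj_on (hook \<mu> i) {1..part \<mu> i}"
  proof (rule linorder_inj_onI)
    fix k k' :: nat assume "k < k'"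
    then show "hook \<mu> i k \<noteq> hook \<mu> i k'" using conj[of k k'] by (simp add: hook_def)
  qed auto
  have A: "A \<subseteq> C"
  proof
    fix x assume "x \<in> A"
    then obtain k where k: "k \<in> {i+1..l}" "x = a k" by (auto simp: A_def)
    have "part \<mu> k \<le> part \<mu> i" "1 \<le> part \<mu> k"
      using k i part_antimono[of i k \<mu>] part_pos_iff[of k \<mu>] by (auto simp: l_def)
    then have "1 \<le> x" "x \<le> int (part \<mu> i + l - i)" using k i by (auto simp: a_def l_def)
    then show "x \<in> C" unfolding C_def by (auto simp: image_iff intro!: bexI[of _ "nat x"])
  qed
  have B: "B \<subseteq> C"
  proof
    fix x assume "x \<in> B"
    then obtain j where j: "j \<in> {1..part \<mu> i}" "x = hook \<mu> i j" by (auto simp: B_def)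
    have "i \<le> part (conjugate \<mu>) j" using le_part_conjugate[of i j \<mu>] i j by auto
    moreover have "part (conjugate \<mu>) j \<le> l"
      using le_part_conjugate[of "part (conjugate \<mu>) j" j \<mu>] part_pos_iff[of "part (conjugate \<mu>) j" \<mu>] i j
      by (cases "part (conjugate \<mu>) j = 0") (auto simp: l_def)
    ultimately have "1 \<le> x" "x \<le> int (part \<mu> i + l - i)" using j i by (auto simp: hook_def l_def)
    then show "x \<in> C" unfolding C_def by (auto simp: image_iff intro!: bexI[of _ "nat x"])
  qed
  have disj: "A \<inter> B = {}"
  proof -
    have "a k \<noteq> hook \<mu> i j" if k: "k \<in> {i+1..l}" and j: "j \<in> {1..part \<mu> i}" for k j
    proof (cases "j \<le> part \<mu> k")
      case True
      then have "k \<le> part (conjugate \<mu>) j" using le_part_conjugate[of k j \<mu>] k j by auto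
      then show ?thesis using True by (simp add: a_def hook_def)
    next
      case False
      then have "\<not> k \<le> part (conjugate \<mu>) j" using le_part_conjugate[of k j \<mu>] k j by auto
      then show ?thesis using False by (simp add: a_def hook_def)
    qed
    then show ?thesis by (auto simp: A_def B_def)
  qed
  have fin: "finite A" "finite B" "finite C" by (simp_all add: A_def B_def C_def)
  have "card (A \<union> B) = card C"
    using i fin disj injA injB by (simp add: card_Un_disjoint A_def B_def C_def card_image l_def)
  then have "A \<union> B = C" using A B fin by (intro card_subset_eq) auto
  then have "(\<Prod>x\<in>C. g x) = (\<Prod>x\<in>A. g x) * (\<Prod>x\<in>B. g x)"
    using prod.union_disjoint[OF fin(1,2) disj, of g] by simp
  then have "(\<Prod>k=i+1..l. g (a k)) * (\<Prod>j=1..part \<mu> i. g (hook \<mu> i j)) = (\<Prod>n=1..part \<mu> i + l - i. g (int n))"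
    using injA injB by (simp add: A_def B_def C_def prod.reindex)
  then show ?thesis by (simp only: a_def)
qed

text \<open>
  By \<open>hook_row\<close> the numerator of each row, multiplied by the hook lengths of the row, is the product
  of all numbers up to $\mu_i + l - i$, and the two denominators of the row make up the same product.
\<close>

lemma W1_hook: "W1 \<mu> = qhalf powi (kappa \<mu> div 2) / (\<Prod>(i, j)\<in>diagram \<mu>. qbr (hook \<mu> i j))"
proof -
  define l where "l = plen \<mu>"
  have "{(i, j). 1 \<le> i \<and> i < j \<and> j \<le> l} = (SIGMA i:{1..l}. {i+1..l})" by auto
  then have "(\<Prod>(i, j) | 1 \<le> i \<and> i < j \<and> j \<le> l. qbr (int (part \<mu> i) - int (part \<mu> j) + int j - int i) / qbr (int j - int i)) =
      (\<Prod>i=1..l. \<Prod>j=i+1..l. qbr (int (part \<mu> i) - int (part \<mu> j) + int j - int i) / qbr (int j - int i))"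
    by (simp add: prod.Sigma)
  then have "W1 \<mu> = qhalf powi (kappa \<mu> div 2) * (\<Prod>i=1..l.
      (\<Prod>j=i+1..l. qbr (int (part \<mu> i) - int (part \<mu> j) + int j - int i) / qbr (int j - int i)) *
      (\<Prod>v=1..part \<mu> i. 1 / qbr (int v - int i + int l)))"
    by (simp add: W1_def l_def prod.distrib)
  also have "(\<Prod>i=1..l.
      (\<Prod>j=i+1..l. qbr (int (part \<mu> i) - int (part \<mu> j) + int j - int i) / qbr (int j - int i)) *
      (\<Prod>v=1..part \<mu> i. 1 / qbr (int v - int i + int l))) =
      (\<Prod>i=1..l. \<Prod>j=1..part \<mu> i. 1 / qbr (hook \<mu> i j))"
  proof (rule prod.cong[OF refl])
    fix i assume i: "i \<in> {1..l}"
    let ?X = "\<Prod>j=i+1..l. qbr (int (part \<mu> i) - int (part \<mu> j) + int j - int i)"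
    let ?H = "\<Prod>j=1..part \<mu> i. qbr (hook \<mu> i j)"
    let ?N = "\<Prod>n=1..part \<mu> i + l - i. qbr (int n)"
    let ?D = "\<Prod>j=i+1..l. qbr (int j - int i)"
    let ?V = "\<Prod>v=1..part \<mu> i. qbr (int v - int i + int l)"
    have N0: "?N \<noteq> 0" by (simp add: qbr_nz)
    have XH: "?X * ?H = ?N" using hook_row[of i \<mu> qbr] i by (simp add: l_def)
    have "?D = (\<Prod>n=1..l-i. qbr (int n))"
      by (rule prod.reindex_bij_witness[of _ "\<lambda>n. n + i" "\<lambda>j. j - i"]) auto
    moreover have "?V = (\<Prod>n=l-i+1..part \<mu> i + l - i. qbr (int n))"
      by (rule prod.reindex_bij_witness[of _ "\<lambda>n. n + i - l" "\<lambda>v. v + l - i"]) (use i in \<open>auto simp: of_nat_diff algebra_simps\<close>)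
    ultimately have DV: "?D * ?V = ?N"
      using prod.ub_add_nat[of 1 "l - i" "\<lambda>n. qbr (int n)" "part \<mu> i"] i by (simp add: add.commute)
    have "x / d * (1 / v) = 1 / h" if "x * h = n" "d * v = n" "n \<noteq> 0" for x h n d v :: qrat
    proof -
      have "h \<noteq> 0" "d \<noteq> 0" "v \<noteq> 0" using that by auto
      then show ?thesis using that by (simp add: field_simps)
    qed
    from this[OF XH DV N0] have "?X / ?D * (1 / ?V) = 1 / ?H" .
    then show "(\<Prod>j=i+1..l. qbr (int (part \<mu> i) - int (part \<mu> j) + int j - int i) / qbr (int j - int i)) *
      (\<Prod>v=1..part \<mu> i. 1 / qbr (int v - int i + int l)) = (\<Prod>j=1..part \<mu> i. 1 / qbr (hook \<mu> i j))"
      by (simp add: prod_dividef)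
  qed
  also have "\<dots> = 1 / (\<Prod>(i, j)\<in>diagram \<mu>. qbr (hook \<mu> i j))"
    unfolding diagram_Sigma by (simp add: prod.Sigma l_def prod_dividef case_prod_unfold)
  finally show ?thesis by simp
qed

text \<open>
  The multiset of hook lengths is invariant under transposition.
\<close>

lemma W1_conjugate: "W1 (conjugate \<mu>) = qhalf powi (- kappa \<mu>) * W1 \<mu>"
proof -
  have "(\<Prod>(i, j)\<in>diagram (conjugate \<mu>). qbr (hook (conjugate \<mu>) i j)) = (\<Prod>(i, j)\<in>diagram \<mu>. qbr (hook \<mu> i j))"
    unfolding prod_diagram_conjugate by (intro prod.cong) (auto simp: hook_def algebra_simps)
  moreover obtain c where c: "kappa \<mu> = 2 * c" using even_kappa[of \<mu>] by auto
  moreover have "- (2 * c) div 2 = - c" by simp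
  moreover have "qhalf powi (- c) = qhalf powi (- (2 * c)) * qhalf powi c"
    by (simp flip: power_int_add)
  ultimately show ?thesis unfolding W1_hook kappa_conjugate by (simp add: mult.assoc)
qed

lemma W1_nz: "W1 \<mu> \<noteq> 0"
proof -
  have "hook \<mu> i j \<noteq> 0" if "(i, j) \<in> diagram \<mu>" for i j
    using that le_part_conjugate[of i j \<mu>] by (auto simp: hook_def diagram_def)
  then show ?thesis by (auto simp: W1_hook case_prod_unfold qbr_nz)
qed

section \<open>Vandermonde determinants over interlacing sequences\<close>

lemma det_mat_leibniz:
  "det (mat n n (\<lambda>(i, j). A i j)) = (\<Sum>p | p permutes {0..<n}. signof p * (\<Prod>i=0..<n. A i (p i)))"
  unfolding det_def'[OF mat_carrier]
  by (intro sum.cong refl arg_cong2[of _ _ _ _ "(*)"] prod.cong)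
     (auto simp: permutes_in_image atLeastLessThan_iff dest: permutes_in_image)

lemma det_scale_columns:
  "det (mat n n (\<lambda>(i, j). c j * A i j)) = (\<Prod>j=0..<n. c j) * det (mat n n (\<lambda>(i, j). A i j :: 'a::comm_ring_1))"
proof -
  have "(\<Prod>i=0..<n. c (p i)) = (\<Prod>j=0..<n. c j)" if "p permutes {0..<n}" for p
    using prod.permute[OF that, of c] by (simp add: o_def)
  then show ?thesis
    unfolding det_mat_leibniz sum_distrib_left by (intro sum.cong refl) (simp add: prod.distrib mult_ac)
qed

lemma det_scale_rows:
  "det (mat n n (\<lambda>(i, j). c i * A i j)) = (\<Prod>i=0..<n. c i) * det (mat n n (\<lambda>(i, j). A i j :: 'a::comm_ring_1))"
  unfolding det_mat_leibniz sum_distrib_left by (intro sum.cong refl) (simp add: prod.distrib mult_ac)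

text \<open>
  Multilinearity in the rows, of which row \<open>i\<close> involves only the choice \<open>m i\<close>.
\<close>

lemma det_sum_rows:
  assumes "\<And>i. i < n \<Longrightarrow> finite (I i)"
  shows "(\<Sum>m\<in>PiE {0..<n} I. det (mat n n (\<lambda>(i, j). f j (m i)))) =
    det (mat n n (\<lambda>(i, j). \<Sum>a\<in>I i. f j a :: 'a::comm_ring_1))"
proof -
  have "(\<Sum>m\<in>PiE {0..<n} I. det (mat n n (\<lambda>(i, j). f j (m i)))) =
      (\<Sum>p | p permutes {0..<n}. signof p * (\<Sum>m\<in>PiE {0..<n} I. \<Prod>i=0..<n. f (p i) (m i)))"
    unfolding det_mat_leibniz sum_distrib_left by (rule sum.swap)
  also have "\<dots> = (\<Sum>p | p permutes {0..<n}. signof p * (\<Prod>i=0..<n. \<Sum>a\<in>I i. f (p i) a))"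
    by (intro sum.cong refl arg_cong2[of _ _ _ _ "(*)"] prod_sum_PiE [symmetric]) (use assms in auto)
  finally show ?thesis unfolding det_mat_leibniz .
qed

lemma det_unit_upper:
  assumes "\<And>i. i < n \<Longrightarrow> U i i = 1" "\<And>i j. j < i \<Longrightarrow> i < n \<Longrightarrow> U i j = 0"
  shows "det (mat n n (\<lambda>(i, j). U i j)) = (1 :: 'a::comm_ring_1)"
proof -
  let ?U = "mat n n (\<lambda>(i, j). U i j)"
  have "upper_triangular ?U" using assms(2) by (auto simp: upper_triangular_def)
  then have "det ?U = prod_list (diag_mat ?U)" by (rule det_upper_triangular[OF _ mat_carrier])
  also have "\<dots> = 1" unfolding prod_list_diag_prod using assms(1) by simp
  finally show ?thesis .
qed

lemma det_delete_corner_column: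
  fixes A :: "nat \<Rightarrow> nat \<Rightarrow> 'a::comm_ring_1"
  assumes "\<And>i. i < n \<Longrightarrow> A i 0 = 0" "A n 0 = 1"
  shows "det (mat (Suc n) (Suc n) (\<lambda>(i, j). A i j)) = (-1) ^ n * det (mat n n (\<lambda>(i, j). A i (Suc j)))"
proof -
  let ?A = "mat (Suc n) (Suc n) (\<lambda>(i, j). A i j)"
  have "det ?A = (\<Sum>i<Suc n. ?A $$ (i, 0) * cofactor ?A i 0)"
    by (rule laplace_expansion_column) auto
  also have "\<dots> = cofactor ?A n 0" using assms by simp
  also have "mat_delete ?A n 0 = mat n n (\<lambda>(i, j). A i (Suc j))"
    unfolding mat_delete_def by (rule eq_matI) auto
  then have "cofactor ?A n 0 = (-1) ^ n * det (mat n n (\<lambda>(i, j). A i (Suc j)))"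
    by (simp add: cofactor_def)
  finally show ?thesis .
qed

lemma det_delete_corner_row:
  fixes A :: "nat \<Rightarrow> nat \<Rightarrow> 'a::comm_ring_1"
  assumes "\<And>j. j < n \<Longrightarrow> A n (Suc j) = 0" "A n 0 = 1"
  shows "det (mat (Suc n) (Suc n) (\<lambda>(i, j). A i j)) = (-1) ^ n * det (mat n n (\<lambda>(i, j). A i (Suc j)))"
proof -
  let ?A = "mat (Suc n) (Suc n) (\<lambda>(i, j). A i j)"
  have "det ?A = (\<Sum>j<Suc n. ?A $$ (n, j) * cofactor ?A n j)"
    by (rule laplace_expansion_row) auto
  also have "\<dots> = cofactor ?A n 0" using assms by (subst sum.lessThan_Suc_shift) simp
  also have "mat_delete ?A n 0 = mat n n (\<lambda>(i, j). A i (Suc j))"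
    unfolding mat_delete_def by (rule eq_matI) auto
  then have "cofactor ?A n 0 = (-1) ^ n * det (mat n n (\<lambda>(i, j). A i (Suc j)))"
    by (simp add: cofactor_def)
  finally show ?thesis .
qed

lemma mat_times_mat:
  "mat n n (\<lambda>(i, j). U i j) * mat n n (\<lambda>(i, j). A i j) = mat n n (\<lambda>(i, j). \<Sum>k=0..<n. U i k * A k j)"
  by (rule eq_matI) (auto simp: scalar_prod_def)

text \<open>
  A column of ones is cleared, except for its last entry, by subtracting from each row the next one.
\<close>

lemma det_row_differences:
  fixes A :: "nat \<Rightarrow> nat \<Rightarrow> 'a::comm_ring_1"
  assumes "\<And>i. i \<le> n \<Longrightarrow> A i 0 = 1"
  shows "det (mat (Suc n) (Suc n) (\<lambda>(i, j). A i j)) =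
    (-1) ^ n * det (mat n n (\<lambda>(i, j). A i (Suc j) - A (Suc i) (Suc j)))"
proof -
  \<comment> \<open>The row operation as a unitriangular factor.\<close>
  define U :: "nat \<Rightarrow> nat \<Rightarrow> 'a" where "U i k = (if k = i then 1 else if k = Suc i then -1 else 0)" for i k
  define D where "D i j = A i j - (if i < n then A (Suc i) j else 0)" for i j
  have U: "(\<Sum>k=0..<Suc n. U i k * A k j) = D i j" if "i < Suc n" for i j
  proof -
    have "(\<Sum>k=0..<Suc n. U i k * A k j) =
        (\<Sum>k=0..<Suc n. (if k = i then A k j else 0) - (if k = Suc i then A k j else 0))"
      by (rule sum.cong) (auto simp: U_def)
    also have "\<dots> = D i j" using that by (auto simp: sum_subtractf sum.delta D_def simp del: sum.op_ivl_Suc)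
    finally show ?thesis .
  qed
  have "det (mat (Suc n) (Suc n) (\<lambda>(i, j). A i j)) =
      det (mat (Suc n) (Suc n) (\<lambda>(i, j). U i j)) * det (mat (Suc n) (Suc n) (\<lambda>(i, j). A i j))"
    by (subst det_unit_upper) (auto simp: U_def)
  also have "\<dots> = det (mat (Suc n) (Suc n) (\<lambda>(i, j). \<Sum>k=0..<Suc n. U i k * A k j))"
    by (subst det_mult [symmetric]) (auto simp: mat_times_mat simp del: sum.op_ivl_Suc)
  also have "mat (Suc n) (Suc n) (\<lambda>(i, j). \<Sum>k=0..<Suc n. U i k * A k j) = mat (Suc n) (Suc n) (\<lambda>(i, j). D i j)"
    by (rule eq_matI) (auto simp: U simp del: sum.op_ivl_Suc)
  also have "det \<dots> = (-1) ^ n * det (mat n n (\<lambda>(i, j). D i (Suc j)))"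
    by (rule det_delete_corner_column) (use assms in \<open>auto simp: D_def\<close>)
  also have "mat n n (\<lambda>(i, j). D i (Suc j)) = mat n n (\<lambda>(i, j). A i (Suc j) - A (Suc i) (Suc j))"
    by (rule eq_matI) (auto simp: D_def)
  finally show ?thesis .
qed

definition vander :: "nat \<Rightarrow> (nat \<Rightarrow> 'a::comm_ring_1) \<Rightarrow> 'a" where
  "vander n X = (\<Prod>j=0..<n. \<Prod>i=0..<j. X j - X i)"

text \<open>
  Subtracting from each column $X_n$ times the previous one leaves a single entry in the last row.
\<close>

lemma det_vandermonde: "det (mat n n (\<lambda>(i, j). X i ^ j)) = vander n (X :: nat \<Rightarrow> 'a::comm_ring_1)"
proof (induction n)
  case (Suc n)
  define U :: "nat \<Rightarrow> nat \<Rightarrow> 'a" where "U k j = (if k = j then 1 else if Suc k = j then - X n else 0)" for k j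
  define D where "D i j = (case j of 0 \<Rightarrow> 1 | Suc j \<Rightarrow> (X i - X n) * X i ^ j)" for i j
  have U: "(\<Sum>k=0..<Suc n. X i ^ k * U k j) = D i j" if "j < Suc n" for i j
  proof -
    have "(\<Sum>k=0..<Suc n. X i ^ k * U k j) =
        (\<Sum>k=0..<Suc n. (if k = j then X i ^ k else 0) - (if Suc k = j then X n * X i ^ k else 0))"
      by (rule sum.cong) (auto simp: U_def)
    also have "\<dots> = D i j"
    proof (cases j)
      case (Suc j')
      then show ?thesis using that
        by (auto simp: sum_subtractf sum.delta D_def algebra_simps simp del: sum.op_ivl_Suc)
    qed (auto simp: sum_subtractf sum.delta D_def simp del: sum.op_ivl_Suc)
    finally show ?thesis .
  qed
  have "det (mat (Suc n) (Suc n) (\<lambda>(i, j). X i ^ j)) =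
      det (mat (Suc n) (Suc n) (\<lambda>(i, j). X i ^ j)) * det (mat (Suc n) (Suc n) (\<lambda>(i, j). U i j))"
    by (subst (2) det_unit_upper) (auto simp: U_def)
  also have "\<dots> = det (mat (Suc n) (Suc n) (\<lambda>(i, j). \<Sum>k=0..<Suc n. X i ^ k * U k j))"
    by (subst det_mult [symmetric]) (auto simp: mat_times_mat simp del: sum.op_ivl_Suc)
  also have "mat (Suc n) (Suc n) (\<lambda>(i, j). \<Sum>k=0..<Suc n. X i ^ k * U k j) = mat (Suc n) (Suc n) (\<lambda>(i, j). D i j)"
    by (rule eq_matI) (auto simp: U simp del: sum.op_ivl_Suc)
  also have "det \<dots> = (-1) ^ n * det (mat n n (\<lambda>(i, j). D i (Suc j)))"
    by (rule det_delete_corner_row) (auto simp: D_def)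
  also have "det (mat n n (\<lambda>(i, j). D i (Suc j))) = (\<Prod>i=0..<n. X i - X n) * det (mat n n (\<lambda>(i, j). X i ^ j))"
    unfolding D_def nat.case by (rule det_scale_rows)
  also have "(-1) ^ n * \<dots> = (\<Prod>i=0..<n. (-1) * (X i - X n)) * vander n X"
    unfolding prod.distrib Suc by (simp add: mult.assoc)
  also have "\<dots> = vander (Suc n) X" by (simp add: vander_def mult.commute)
  finally show ?case .
qed (simp add: vander_def)

text \<open>
  The sum over interlacing sequences can be taken row by row inside the determinant, where it is a
  geometric series in each entry. Up to the factors $q^{j+1} - 1$ the summed entries are differences of
  consecutive rows of the larger Vandermonde matrix, that is, what remains of it when its column of
  ones is cleared.
\<close>

lemma interlacing_vandermonde:
  fixes q :: "'a::field"
  assumes l: "\<And>i. i < n \<Longrightarrow> l (Suc i) < l i"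
  shows "(-1) ^ n * (\<Prod>j=0..<n. q ^ Suc j - 1) *
     (\<Sum>m\<in>PiE {0..<n} (\<lambda>i. {l (Suc i)..<l i}). q ^ (\<Sum>i=0..<n. m i) * vander n (\<lambda>i. q ^ m i)) =
     vander (Suc n) (\<lambda>i. q ^ l i)"
proof -
  let ?I = "\<lambda>i. {l (Suc i)..<l i}"
  have "(\<Sum>m\<in>PiE {0..<n} ?I. q ^ (\<Sum>i=0..<n. m i) * vander n (\<lambda>i. q ^ m i)) =
      (\<Sum>m\<in>PiE {0..<n} ?I. det (mat n n (\<lambda>(i, j). (q ^ m i) ^ Suc j)))"
  proof (rule sum.cong[OF refl])
    fix m
    have "det (mat n n (\<lambda>(i, j). (q ^ m i) ^ Suc j)) = det (mat n n (\<lambda>(i, j). q ^ m i * (q ^ m i) ^ j))" by simp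
    also have "\<dots> = (\<Prod>i=0..<n. q ^ m i) * det (mat n n (\<lambda>(i, j). (q ^ m i) ^ j))" by (rule det_scale_rows)
    also have "\<dots> = q ^ (\<Sum>i=0..<n. m i) * vander n (\<lambda>i. q ^ m i)"
      by (simp add: det_vandermonde power_sum)
    finally show "q ^ (\<Sum>i=0..<n. m i) * vander n (\<lambda>i. q ^ m i) = det (mat n n (\<lambda>(i, j). (q ^ m i) ^ Suc j))" ..
  qed
  also have "\<dots> = det (mat n n (\<lambda>(i, j). \<Sum>a\<in>?I i. (q ^ a) ^ Suc j))"
    by (rule det_sum_rows[where f = "\<lambda>j a. (q ^ a) ^ Suc j"]) simp
  finally have S: "(\<Sum>m\<in>PiE {0..<n} ?I. q ^ (\<Sum>i=0..<n. m i) * vander n (\<lambda>i. q ^ m i)) =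
    det (mat n n (\<lambda>(i, j). \<Sum>a\<in>?I i. (q ^ a) ^ Suc j))" .
  have geo: "(q ^ Suc j - 1) * (\<Sum>a\<in>?I i. (q ^ a) ^ Suc j) = (q ^ l i) ^ Suc j - (q ^ l (Suc i)) ^ Suc j"
    if "i < n" for i j
  proof -
    have "(\<Sum>a\<in>{b..<b+d}. (q ^ a) ^ Suc j) * (q ^ Suc j - 1) = (q ^ (b + d)) ^ Suc j - (q ^ b) ^ Suc j" for b d
      by (induction d) (simp_all add: algebra_simps power_add power_mult_distrib)
    from this[of "l (Suc i)" "l i - l (Suc i)"] show ?thesis using l[OF that] by (simp add: mult.commute)
  qed
  have "(\<Prod>j=0..<n. q ^ Suc j - 1) * det (mat n n (\<lambda>(i, j). \<Sum>a\<in>?I i. (q ^ a) ^ Suc j)) =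
      det (mat n n (\<lambda>(i, j). (q ^ Suc j - 1) * (\<Sum>a\<in>?I i. (q ^ a) ^ Suc j)))"
    by (rule det_scale_columns [symmetric])
  also have "mat n n (\<lambda>(i, j). (q ^ Suc j - 1) * (\<Sum>a\<in>?I i. (q ^ a) ^ Suc j)) =
      mat n n (\<lambda>(i, j). (q ^ l i) ^ Suc j - (q ^ l (Suc i)) ^ Suc j)"
    by (rule eq_matI) (simp_all only: geo dim_row_mat dim_col_mat index_mat prod.case)
  also have "(-1) ^ n * det \<dots> = det (mat (Suc n) (Suc n) (\<lambda>(i, j). (q ^ l i) ^ j))"
    by (rule det_row_differences [symmetric]) simp
  finally show ?thesis unfolding S by (simp add: det_vandermonde mult.assoc)
qed

section \<open>The principal specialization\<close>

abbreviation q_fls :: "rat fls" where "q_fls \<equiv> qhalf_fls 2"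

definition br :: "int \<Rightarrow> rat fls" where "br m = qhalf_fls m - qhalf_fls (- m)"

lemma expand_inf_qbr_br: "expand_inf (qbr m) = br m"
  by (simp add: br_def expand_inf_qbr)

lemma br_nz: "m \<noteq> 0 \<Longrightarrow> br m \<noteq> 0"
  using qbr_nz[of m] by (simp flip: expand_inf_qbr_br)

lemma br_minus: "br (- m) = - br m"
  by (simp add: br_def)

lemma qhalf_fls_nz [simp]: "qhalf_fls w \<noteq> (0 :: rat fls)"
proof
  assume "qhalf_fls w = (0 :: rat fls)"
  then have "fls_nth (qhalf_fls w :: rat fls) (- w) = 0" by simp
  then show False by (simp add: qhalf_fls_nth)
qed

lemma fls_lim_eventually:
  assumes "fls_lim f L" "\<And>m. m \<ge> m0 \<Longrightarrow> g m = f m"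
  shows "fls_lim g L"
  unfolding fls_lim_def
proof
  fix B
  obtain m1 where "\<forall>m\<ge>m1. \<forall>k\<le>B. fls_nth (f m) k = fls_nth L k"
    using fls_limD[OF assms(1), of B] by blast
  then have "\<forall>m\<ge>max m0 m1. \<forall>k\<le>B. fls_nth (g m) k = fls_nth L k" using assms(2) by simp
  then show "\<exists>m0. \<forall>m\<ge>m0. \<forall>k\<le>B. fls_nth (g m) k = fls_nth L k" by blast
qed

lemma finite_hstrip: "finite {\<kappa>. hstrip \<nu> \<kappa>}"
  by (rule finite_subset[OF _ finite_psize_le[of "psize \<nu>"]]) (auto dest: hstrip_psize_le)

lemma sum_pieri_down:
  fixes f :: "nat \<Rightarrow> partition \<Rightarrow> 'a::comm_monoid_add"
  shows "(\<Sum>r\<le>psize \<nu>. \<Sum>\<kappa>\<in>pieri_down r \<nu>. f r \<kappa>) = (\<Sum>\<kappa> | hstrip \<nu> \<kappa>. f (psize \<nu> - psize \<kappa>) \<kappa>)"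
proof -
  have "(\<Sum>r\<le>psize \<nu>. \<Sum>\<kappa>\<in>pieri_down r \<nu>. f r \<kappa>) = (\<Sum>(r, \<kappa>)\<in>(SIGMA r:{..psize \<nu>}. pieri_down r \<nu>). f r \<kappa>)"
    by (rule sum.Sigma) auto
  also have "\<dots> = (\<Sum>\<kappa> | hstrip \<nu> \<kappa>. f (psize \<nu> - psize \<kappa>) \<kappa>)"
    by (rule sum.reindex_bij_witness[where i = "\<lambda>\<kappa>. (psize \<nu> - psize \<kappa>, \<kappa>)" and j = snd])
       (auto simp: pieri_down_def dest: hstrip_psize_le)
  finally show ?thesis .
qed

text \<open>
  The parts of \<open>\<nu>\<close> shifted by the staircase $n - 1, \dots, 0$, which makes them strictly decreasing.
\<close>

definition stair :: "nat \<Rightarrow> partition \<Rightarrow> nat \<Rightarrow> nat" where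
  "stair n \<nu> i = parts_of \<nu> i + (n - 1 - i)"

text \<open>
  The staircases in use for \<open>\<nu>\<close> and \<open>\<kappa>\<close> differ by one row. This turns the weak inequalities of a
  horizontal strip into membership in disjoint half-open intervals.
\<close>

lemma interlacing_bij:
  assumes len: "plen \<nu> \<le> Suc n"
  shows "bij_betw (\<lambda>\<kappa>. restrict (stair n \<kappa>) {0..<n}) {\<kappa>. hstrip \<nu> \<kappa> \<and> plen \<kappa> \<le> n}
    (PiE {0..<n} (\<lambda>i. {stair (Suc n) \<nu> (Suc i)..<stair (Suc n) \<nu> i}))"
    (is "bij_betw ?F ?T ?P")
proof -
  define G where "G m = Abs_partition (\<lambda>i. if i < n then m i - (n - 1 - i) else (0::nat))" for m
  have st: "stair (Suc n) \<nu> (Suc i) = parts_of \<nu> (Suc i) + (n - 1 - i)"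
    "stair (Suc n) \<nu> i = parts_of \<nu> i + (n - 1 - i) + 1" if "i < n" for i
    using that by (auto simp: stair_def)
  have PG: "parts_of (G m) i = (if i < n then m i - (n - 1 - i) else 0)" if m: "m \<in> ?P" for m i
  proof -
    have r: "parts_of \<nu> (Suc i) + (n - 1 - i) \<le> m i" "m i \<le> parts_of \<nu> i + (n - 1 - i)" if "i < n" for i
      using m that st[OF that] by (auto simp: PiE_def Pi_def)
    have "parts_of (G m) = (\<lambda>i. if i < n then m i - (n - 1 - i) else 0)"
      unfolding G_def
    proof (rule parts_of_Abs[where n = n])
      fix i show "(if Suc i < n then m (Suc i) - (n - 1 - Suc i) else 0) \<le> (if i < n then m i - (n - 1 - i) else 0)"
      proof (cases "Suc i < n")
        case True
        then show ?thesis using r(1)[of i] r(2)[of "Suc i"] by simp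
      qed simp
    qed simp
    then show ?thesis by simp
  qed
  show ?thesis
  proof (rule bij_betw_byWitness[where f' = G])
    show "\<forall>\<kappa>\<in>?T. G (?F \<kappa>) = \<kappa>"
    proof
      fix \<kappa> assume \<kappa>: "\<kappa> \<in> ?T"
      have "(\<lambda>i. if i < n then ?F \<kappa> i - (n - 1 - i) else 0) = parts_of \<kappa>"
        using \<kappa> parts_of_eq_0_iff[of \<kappa>] by (auto simp: fun_eq_iff stair_def)
      then show "G (?F \<kappa>) = \<kappa>" unfolding G_def by (simp add: parts_of_inverse)
    qed
    show "\<forall>m\<in>?P. ?F (G m) = m"
    proof
      fix m assume m: "m \<in> ?P"
      show "?F (G m) = m"
      proof
        fix i show "?F (G m) i = m i"
        proof (cases "i < n")
          case True
          then have "n - 1 - i \<le> m i" using m st[OF True] by (force simp: PiE_def Pi_def)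
          then show ?thesis using True PG[OF m, of i] by (simp add: stair_def)
        next
          case False
          then show ?thesis using m by (simp add: PiE_def extensional_def)
        qed
      qed
    qed
    show "?F ` ?T \<subseteq> ?P"
    proof (rule image_subsetI)
      fix \<kappa> assume \<kappa>: "\<kappa> \<in> ?T"
      show "?F \<kappa> \<in> ?P"
      proof (rule PiE_I)
        fix i assume "i \<in> {0..<n}"
        then have i: "i < n" by simp
        have "parts_of \<kappa> i \<le> parts_of \<nu> i" "parts_of \<nu> (Suc i) \<le> parts_of \<kappa> i"
          using \<kappa> by (auto simp: hstrip_def)
        then show "?F \<kappa> i \<in> {stair (Suc n) \<nu> (Suc i)..<stair (Suc n) \<nu> i}"
          unfolding st[OF i] restrict_apply stair_def atLeastLessThan_iff using i by simp linarith
      qed simp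
    qed
    show "G ` ?P \<subseteq> ?T"
    proof (rule image_subsetI)
      fix m assume m: "m \<in> ?P"
      have r: "parts_of \<nu> (Suc i) + (n - 1 - i) \<le> m i" "m i \<le> parts_of \<nu> i + (n - 1 - i)" if "i < n" for i
        using m that st[OF that] by (auto simp: PiE_def Pi_def)
      have "parts_of (G m) i \<le> parts_of \<nu> i \<and> parts_of \<nu> (Suc i) \<le> parts_of (G m) i" for i
      proof (cases "i < n")
        case True
        then show ?thesis using r[OF True] by (auto simp: PG[OF m])
      next
        case False
        then show ?thesis using len parts_of_eq_0_iff[of \<nu> "Suc i"] by (auto simp: PG[OF m])
      qed
      moreover have "plen (G m) \<le> n" using parts_of_eq_0_iff[of "G m" n] by (simp add: PG[OF m])
      ultimately show "G m \<in> ?T" by (auto simp: hstrip_def)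
    qed
  qed
qed

lemma vander_cong: "(\<And>i. i < n \<Longrightarrow> X i = Y i) \<Longrightarrow> vander n X = vander n Y"
  unfolding vander_def by (intro prod.cong refl) auto

lemma vander_branching:
  assumes len: "plen \<nu> \<le> Suc n"
  shows "(-1) ^ n * (\<Prod>j=0..<n. q_fls ^ Suc j - 1) * q_fls ^ (\<Sum>i=0..<n. n - 1 - i) *
    (\<Sum>\<kappa> | hstrip \<nu> \<kappa> \<and> plen \<kappa> \<le> n. q_fls ^ psize \<kappa> * vander n (\<lambda>i. q_fls ^ stair n \<kappa> i)) =
    vander (Suc n) (\<lambda>i. q_fls ^ stair (Suc n) \<nu> i)"
proof -
  let ?T = "{\<kappa>. hstrip \<nu> \<kappa> \<and> plen \<kappa> \<le> n}"
  have lt: "stair (Suc n) \<nu> (Suc i) < stair (Suc n) \<nu> i" if "i < n" for i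
    using parts_of_antimono[of i "Suc i" \<nu>] that by (simp add: stair_def)
  have "q_fls ^ (\<Sum>i=0..<n. n - 1 - i) * (\<Sum>\<kappa>\<in>?T. q_fls ^ psize \<kappa> * vander n (\<lambda>i. q_fls ^ stair n \<kappa> i)) =
     (\<Sum>\<kappa>\<in>?T. q_fls ^ (\<Sum>i=0..<n. restrict (stair n \<kappa>) {0..<n} i) *
        vander n (\<lambda>i. q_fls ^ restrict (stair n \<kappa>) {0..<n} i))"
    unfolding sum_distrib_left
  proof (rule sum.cong[OF refl])
    fix \<kappa> assume "\<kappa> \<in> ?T"
    then have "psize \<kappa> = (\<Sum>i=0..<n. parts_of \<kappa> i)" by (simp add: psize_sum atLeast0LessThan)
    then have "(\<Sum>i=0..<n. restrict (stair n \<kappa>) {0..<n} i) = (\<Sum>i=0..<n. n - 1 - i) + psize \<kappa>"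
      by (simp add: stair_def flip: sum.distrib) (intro sum.cong; auto)
    moreover have "vander n (\<lambda>i. q_fls ^ restrict (stair n \<kappa>) {0..<n} i) = vander n (\<lambda>i. q_fls ^ stair n \<kappa> i)"
      by (rule vander_cong) simp
    ultimately show "q_fls ^ (\<Sum>i=0..<n. n - 1 - i) * (q_fls ^ psize \<kappa> * vander n (\<lambda>i. q_fls ^ stair n \<kappa> i)) =
        q_fls ^ (\<Sum>i=0..<n. restrict (stair n \<kappa>) {0..<n} i) *
        vander n (\<lambda>i. q_fls ^ restrict (stair n \<kappa>) {0..<n} i)"
      by (simp only: power_add mult.assoc)
  qed
  also have "\<dots> = (\<Sum>m\<in>PiE {0..<n} (\<lambda>i. {stair (Suc n) \<nu> (Suc i)..<stair (Suc n) \<nu> i}).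
      q_fls ^ (\<Sum>i=0..<n. m i) * vander n (\<lambda>i. q_fls ^ m i))"
    by (rule sum.reindex_bij_betw[OF interlacing_bij[OF len]])
  finally have e: "q_fls ^ (\<Sum>i=0..<n. n - 1 - i) * (\<Sum>\<kappa>\<in>?T. q_fls ^ psize \<kappa> * vander n (\<lambda>i. q_fls ^ stair n \<kappa> i)) =
     (\<Sum>m\<in>PiE {0..<n} (\<lambda>i. {stair (Suc n) \<nu> (Suc i)..<stair (Suc n) \<nu> i}).
      q_fls ^ (\<Sum>i=0..<n. m i) * vander n (\<lambda>i. q_fls ^ m i))" .
  have "(-1) ^ n * (\<Prod>j=0..<n. q_fls ^ Suc j - 1) *
      (\<Sum>m\<in>PiE {0..<n} (\<lambda>i. {stair (Suc n) \<nu> (Suc i)..<stair (Suc n) \<nu> i}).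
        q_fls ^ (\<Sum>i=0..<n. m i) * vander n (\<lambda>i. q_fls ^ m i)) =
      vander (Suc n) (\<lambda>i. q_fls ^ stair (Suc n) \<nu> i)"
    by (rule interlacing_vandermonde, rule lt)
  then show ?thesis unfolding e[symmetric] by (simp only: mult.assoc)
qed

lemma q_fls_power_ne_1: "q_fls ^ Suc j - 1 \<noteq> 0"
proof
  assume "q_fls ^ Suc j - 1 = 0"
  then have "qhalf_fls (int (Suc j) * 2) = (1 :: rat fls)"
    unfolding qhalf_fls_power by simp
  then have "fls_nth (qhalf_fls (int (Suc j) * 2) :: rat fls) 0 = fls_nth 1 0" by (rule arg_cong)
  then show False unfolding qhalf_fls_nth by simp
qed

text \<open>
  Weyl's formula for the alphabet $x_i = q^{1/2-i}$, by induction on its length. As $x_n = q x_{n+1}$, the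
  branching recursion weights \<open>\<kappa>\<close> by $q^{|\kappa|}$ up to a common factor, which is the weight in
  \<open>vander_branching\<close>. The constant \<open>C\<close> there is the same for \<open>\<nu>\<close> and for the empty partition and
  cancels in the quotient.
\<close>

lemma evs_principal:
  defines "x \<equiv> \<lambda>i. qhalf_fls (1 - 2 * int i) :: rat fls"
  shows "vander n (\<lambda>i. q_fls ^ stair n empty_partition i) \<noteq> 0 \<and>
    (\<forall>\<nu>. evs x n \<nu> = (if plen \<nu> \<le> n then x n ^ psize \<nu> *
      (vander n (\<lambda>i. q_fls ^ stair n \<nu> i) / vander n (\<lambda>i. q_fls ^ stair n empty_partition i)) else 0))"
proof (induction n)
  case 0
  have "plen \<nu> = 0 \<longleftrightarrow> \<nu> = empty_partition" for \<nu>
    using parts_of_eq_0_iff[of \<nu>] by (metis le0 le_zero_eq parts_of_empty partition_eqI)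
  then show ?case by (auto simp: vander_def)
next
  case (Suc n)
  define V where "V n = vander n (\<lambda>i. q_fls ^ stair n empty_partition i)" for n
  define C where "C = (-1) ^ n * (\<Prod>j=0..<n. q_fls ^ Suc j - 1) * q_fls ^ (\<Sum>i=0..<n. n - 1 - i)"
  have C: "C \<noteq> 0" using q_fls_power_ne_1 by (auto simp: C_def)
  define S where "S \<nu> = (\<Sum>\<kappa> | hstrip \<nu> \<kappa> \<and> plen \<kappa> \<le> n. q_fls ^ psize \<kappa> * vander n (\<lambda>i. q_fls ^ stair n \<kappa> i))" for \<nu>
  have S: "C * S \<nu> = vander (Suc n) (\<lambda>i. q_fls ^ stair (Suc n) \<nu> i)" if "plen \<nu> \<le> Suc n" for \<nu>
    unfolding C_def S_def by (rule vander_branching[OF that])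
  have V: "V n \<noteq> 0" using Suc by (simp add: V_def)
  have pe: "plen empty_partition = 0" using parts_of_eq_0_iff[of empty_partition 0] by simp
  have "{\<kappa>. hstrip empty_partition \<kappa> \<and> plen \<kappa> \<le> n} = {empty_partition}"
    using pe by (auto simp: hstrip_def intro!: partition_eqI)
  then have VS: "V (Suc n) = C * V n" using S[of empty_partition] pe by (simp add: S_def V_def)
  have x: "x n = q_fls * x (Suc n)" by (simp add: x_def flip: qhalf_fls_add)
  have "evs x (Suc n) \<nu> = (if plen \<nu> \<le> Suc n then x (Suc n) ^ psize \<nu> *
      (vander (Suc n) (\<lambda>i. q_fls ^ stair (Suc n) \<nu> i) / V (Suc n)) else 0)" for \<nu>
  proof -
    have "evs x (Suc n) \<nu> = (\<Sum>\<kappa> | hstrip \<nu> \<kappa>. x (Suc n) ^ (psize \<nu> - psize \<kappa>) * evs x n \<kappa>)"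
      by (simp add: sum_pieri_down)
    also have "\<dots> = (\<Sum>\<kappa> | hstrip \<nu> \<kappa> \<and> plen \<kappa> \<le> n. x (Suc n) ^ (psize \<nu> - psize \<kappa>) * evs x n \<kappa>)"
      by (rule sum.mono_neutral_right) (use Suc in \<open>auto simp: finite_hstrip\<close>)
    also have "\<dots> = (\<Sum>\<kappa> | hstrip \<nu> \<kappa> \<and> plen \<kappa> \<le> n.
        x (Suc n) ^ psize \<nu> * (q_fls ^ psize \<kappa> * vander n (\<lambda>i. q_fls ^ stair n \<kappa> i)) / V n)"
    proof (rule sum.cong[OF refl])
      fix \<kappa> assume k: "\<kappa> \<in> {\<kappa>. hstrip \<nu> \<kappa> \<and> plen \<kappa> \<le> n}"
      then have le: "psize \<kappa> \<le> psize \<nu>" by (simp add: hstrip_psize_le)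
      have "x (Suc n) ^ (psize \<nu> - psize \<kappa>) * x n ^ psize \<kappa> = x (Suc n) ^ psize \<nu> * q_fls ^ psize \<kappa>"
        using le by (simp add: x power_mult_distrib flip: power_add)
      then show "x (Suc n) ^ (psize \<nu> - psize \<kappa>) * evs x n \<kappa> =
          x (Suc n) ^ psize \<nu> * (q_fls ^ psize \<kappa> * vander n (\<lambda>i. q_fls ^ stair n \<kappa> i)) / V n"
        using k Suc by (simp add: V_def mult.assoc[symmetric])
    qed
    also have "\<dots> = x (Suc n) ^ psize \<nu> * S \<nu> / V n"
      by (simp add: S_def sum_distrib_left sum_divide_distrib)
    also have "\<dots> = (if plen \<nu> \<le> Suc n then x (Suc n) ^ psize \<nu> *
      (vander (Suc n) (\<lambda>i. q_fls ^ stair (Suc n) \<nu> i) / V (Suc n)) else 0)"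
    proof (cases "plen \<nu> \<le> Suc n")
      case True
      then show ?thesis using C V unfolding S[OF True, symmetric] VS by simp
    next
      case False
      then have e: "{\<kappa>. hstrip \<nu> \<kappa> \<and> plen \<kappa> \<le> n} = {}" using hstrip_plen(1)[of \<nu>] by fastforce
      show ?thesis using False by (simp add: S_def e)
    qed
    finally show ?thesis .
  qed
  then show ?case using VS C V by (simp add: V_def)
qed

text \<open>
  The quotient of Vandermonde products of \<open>vander_ratio\<close>, stripped of its power of $q$.
\<close>

definition weyl_ratio :: "partition \<Rightarrow> nat \<Rightarrow> rat fls" where
  "weyl_ratio \<nu> n = (\<Prod>j=0..<n. \<Prod>i=0..<j.
     br (int (parts_of \<nu> i) - int (parts_of \<nu> j) + int j - int i) / br (int j - int i))"

lemma q_fls_power_diff: "q_fls ^ a - q_fls ^ b = qhalf_fls (int a + int b) * br (int a - int b)"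
  by (simp add: br_def qhalf_fls_power right_diff_distrib algebra_simps flip: qhalf_fls_add)

text \<open>
  Every index occurs in $n - 1$ pairs.
\<close>

lemma sum_pairs: "(\<Sum>j=0..<n. \<Sum>i=0..<j. f i + f j) + (\<Sum>i=0..<n. f i) = n * (\<Sum>i=0..<n. f i :: nat)"
proof (induction n)
  case (Suc n)
  have "(\<Sum>i=0..<n. f i + f n) = (\<Sum>i=0..<n. f i) + n * f n" by (simp add: sum.distrib)
  then show ?case using Suc by (simp add: algebra_simps)
qed simp

lemma qhalf_fls_sum: "(\<Prod>i\<in>I. qhalf_fls (f i)) = (qhalf_fls (\<Sum>i\<in>I. f i) :: rat fls)"
  by (induction I rule: infinite_finite_induct) (auto simp: qhalf_fls_add)

lemma vander_ratio:
  assumes len: "plen \<nu> \<le> n"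
  shows "vander n (\<lambda>i. q_fls ^ stair n \<nu> i) / vander n (\<lambda>i. q_fls ^ stair n empty_partition i) =
    qhalf_fls ((int n - 1) * int (psize \<nu>)) * weyl_ratio \<nu> n"
proof -
  have "vander n (\<lambda>i. q_fls ^ stair n \<nu> i) / vander n (\<lambda>i. q_fls ^ stair n empty_partition i) =
      (\<Prod>j=0..<n. \<Prod>i=0..<j. (q_fls ^ stair n \<nu> j - q_fls ^ stair n \<nu> i) /
         (q_fls ^ stair n empty_partition j - q_fls ^ stair n empty_partition i))"
    by (simp add: vander_def prod_dividef)
  also have "\<dots> = (\<Prod>j=0..<n. \<Prod>i=0..<j. qhalf_fls (int (parts_of \<nu> i + parts_of \<nu> j)) *
     (br (int (parts_of \<nu> i) - int (parts_of \<nu> j) + int j - int i) / br (int j - int i)))"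
  proof (rule prod.cong[OF refl], rule prod.cong[OF refl])
    fix j i assume j: "j \<in> {0..<n}" and i: "i \<in> {0..<j}"
    let ?a = "int (parts_of \<nu> i) - int (parts_of \<nu> j) + int j - int i"
    let ?s = "int (n - 1 - i) + int (n - 1 - j)"
    have "q_fls ^ stair n \<nu> j - q_fls ^ stair n \<nu> i = qhalf_fls (int (parts_of \<nu> i + parts_of \<nu> j)) * qhalf_fls ?s * - br ?a"
      unfolding q_fls_power_diff br_minus[symmetric] qhalf_fls_add[symmetric]
      using i j by (intro arg_cong2[of _ _ _ _ "(*)"] arg_cong[of _ _ qhalf_fls] arg_cong[of _ _ br]) (auto simp: stair_def)
    moreover have "q_fls ^ stair n empty_partition j - q_fls ^ stair n empty_partition i =
        qhalf_fls ?s * - br (int j - int i)"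
      unfolding q_fls_power_diff br_minus[symmetric]
      using i j by (intro arg_cong2[of _ _ _ _ "(*)"] arg_cong[of _ _ qhalf_fls] arg_cong[of _ _ br]) (auto simp: stair_def)
    ultimately show "(q_fls ^ stair n \<nu> j - q_fls ^ stair n \<nu> i) /
         (q_fls ^ stair n empty_partition j - q_fls ^ stair n empty_partition i) =
       qhalf_fls (int (parts_of \<nu> i + parts_of \<nu> j)) * (br ?a / br (int j - int i))"
      by simp
  qed
  also have "\<dots> = qhalf_fls (\<Sum>j=0..<n. \<Sum>i=0..<j. int (parts_of \<nu> i + parts_of \<nu> j)) * weyl_ratio \<nu> n"
    by (simp only: prod.distrib qhalf_fls_sum weyl_ratio_def)
  also have "(\<Sum>j=0..<n. \<Sum>i=0..<j. int (parts_of \<nu> i + parts_of \<nu> j)) = (int n - 1) * int (psize \<nu>)"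
  proof -
    have "int (\<Sum>j=0..<n. \<Sum>i=0..<j. parts_of \<nu> i + parts_of \<nu> j) + int (psize \<nu>) = int n * int (psize \<nu>)"
      using arg_cong[OF sum_pairs[of "parts_of \<nu>" n], of int] psize_sum[OF len]
      by (simp add: atLeast0LessThan)
    then show ?thesis by (simp add: left_diff_distrib)
  qed
  finally show ?thesis .
qed

text \<open>
  Pairs of an index up to $l(\nu)$ with one beyond it contribute quotients that telescope.
\<close>

lemma weyl_ratio_extend:
  "weyl_ratio \<nu> (plen \<nu> + d) = weyl_ratio \<nu> (plen \<nu>) *
    (\<Prod>i=0..<plen \<nu>. \<Prod>v=1..parts_of \<nu> i. br (int (plen \<nu> + d) - 1 - int i + int v) / br (int (plen \<nu>) - 1 - int i + int v))"
proof (induction d)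
  case 0
  have "(\<Prod>v=1..parts_of \<nu> i. br (int (plen \<nu>) - 1 - int i + int v) / br (int (plen \<nu>) - 1 - int i + int v)) = 1"
    if "i \<in> {0..<plen \<nu>}" for i
    using that by (intro prod.neutral) (auto simp: br_nz)
  then show ?case by simp
next
  case (Suc d)
  let ?l = "plen \<nu>"
  let ?n = "?l + d"
  have zn: "parts_of \<nu> i = 0" if "i \<ge> ?l" for i using that parts_of_eq_0_iff[of \<nu> i] by simp
  have tel: "(\<Prod>v=1..k. f (v + 1)) * f 1 = (\<Prod>v=1..k. f v) * f (k + 1)" for f :: "nat \<Rightarrow> rat fls" and k
    by (induction k) (auto simp: mult_ac)
  have "weyl_ratio \<nu> (Suc ?n) = weyl_ratio \<nu> ?n *
      (\<Prod>i=0..<?n. br (int (parts_of \<nu> i) + int ?n - int i) / br (int ?n - int i))"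
    by (simp add: weyl_ratio_def zn)
  also have "(\<Prod>i=0..<?n. br (int (parts_of \<nu> i) + int ?n - int i) / br (int ?n - int i)) =
      (\<Prod>i=0..<?l. br (int (parts_of \<nu> i) + int ?n - int i) / br (int ?n - int i))"
    by (rule prod.mono_neutral_right) (auto simp: zn br_nz)
  finally have 1: "weyl_ratio \<nu> (Suc ?n) = weyl_ratio \<nu> ?l * (\<Prod>i=0..<?l.
      (\<Prod>v=1..parts_of \<nu> i. br (int ?n - 1 - int i + int v) / br (int ?l - 1 - int i + int v)) *
      (br (int (parts_of \<nu> i) + int ?n - int i) / br (int ?n - int i)))"
    by (simp only: Suc prod.distrib mult.assoc)
  have "(\<Prod>v=1..parts_of \<nu> i. br (int ?n - 1 - int i + int v) / br (int ?l - 1 - int i + int v)) *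
      (br (int (parts_of \<nu> i) + int ?n - int i) / br (int ?n - int i)) =
      (\<Prod>v=1..parts_of \<nu> i. br (int (Suc ?n) - 1 - int i + int v) / br (int ?l - 1 - int i + int v))"
    if i: "i \<in> {0..<?l}" for i
  proof -
    let ?k = "parts_of \<nu> i"
    have nz: "br (int ?n - int i) \<noteq> 0" using i by (intro br_nz) auto
    have "(\<Prod>v=1..?k. br (int (Suc ?n) - 1 - int i + int v)) * br (int ?n - int i) =
        (\<Prod>v=1..?k. br (int ?n - 1 - int i + int v)) * br (int ?k + int ?n - int i)"
      using tel[of "\<lambda>v. br (int ?n - 1 - int i + int v)" ?k] by (simp add: algebra_simps)
    then have "(\<Prod>v=1..?k. br (int ?n - 1 - int i + int v)) * (br (int ?k + int ?n - int i) / br (int ?n - int i)) =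
        (\<Prod>v=1..?k. br (int (Suc ?n) - 1 - int i + int v))"
      using nz by (simp only: times_divide_eq_right) (simp add: eq_divide_eq divide_eq_eq)
    then show ?thesis unfolding prod_dividef by (simp only: times_divide_eq_left)
  qed
  then show ?case using 1 by simp
qed

lemma W1_expand:
  "expand_inf (W1 \<nu>) = weyl_ratio \<nu> (plen \<nu>) *
    (\<Prod>i=0..<plen \<nu>. \<Prod>v=1..parts_of \<nu> i. qhalf_fls (int v - 1 - int i) * inverse (br (int (plen \<nu>) - 1 - int i + int v)))"
proof -
  let ?l = "plen \<nu>"
  have "qhalf_fls (kappa \<nu> div 2) = (\<Prod>i=0..<?l. \<Prod>v=1..parts_of \<nu> i. qhalf_fls (int v - 1 - int i) :: rat fls)"
  proof -
    have "kappa \<nu> div 2 = (\<Sum>i=1..?l. \<Sum>j=1..part \<nu> i. int j - int i)"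
      unfolding kappa_contents diagram_Sigma by (simp add: sum.Sigma)
    also have "\<dots> = (\<Sum>i=0..<?l. \<Sum>v=1..parts_of \<nu> i. int v - 1 - int i)"
      by (rule sum.reindex_bij_witness[of _ Suc "\<lambda>i. i - 1"]) (auto simp: part_def intro!: sum.cong)
    finally show ?thesis by (simp only: qhalf_fls_sum)
  qed
  moreover have "expand_inf (\<Prod>(i, j) | 1 \<le> i \<and> i < j \<and> j \<le> ?l.
        qbr (int (part \<nu> i) - int (part \<nu> j) + int j - int i) / qbr (int j - int i)) = weyl_ratio \<nu> ?l"
  proof -
    have "weyl_ratio \<nu> ?l = (\<Prod>(j, i)\<in>(SIGMA j:{0..<?l}. {0..<j}).
        br (int (parts_of \<nu> i) - int (parts_of \<nu> j) + int j - int i) / br (int j - int i))"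
      unfolding weyl_ratio_def by (rule prod.Sigma) auto
    also have "\<dots> = (\<Prod>(i, j) | 1 \<le> i \<and> i < j \<and> j \<le> ?l.
        br (int (part \<nu> i) - int (part \<nu> j) + int j - int i) / br (int j - int i))"
      by (rule prod.reindex_bij_witness[of _ "\<lambda>(i, j). (j - 1, i - 1)" "\<lambda>(j, i). (Suc i, Suc j)"])
         (auto simp: part_def algebra_simps)
    finally show ?thesis
      by (simp add: expand_inf_prod case_prod_unfold expand_inf_divide expand_inf_qbr_br)
  qed
  moreover have "expand_inf (\<Prod>i=1..?l. \<Prod>v=1..part \<nu> i. 1 / qbr (int v - int i + int ?l)) =
      (\<Prod>i=0..<?l. \<Prod>v=1..parts_of \<nu> i. inverse (br (int ?l - 1 - int i + int v)))"
    unfolding expand_inf_prod expand_inf_divide expand_inf_qbr_br expand_inf_1 divide_inverse mult_1_left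
    by (rule prod.reindex_bij_witness[of _ Suc "\<lambda>i. i - 1"])
       (auto simp: part_def algebra_simps expand_inf_inverse expand_inf_qbr_br intro!: prod.cong)
  ultimately show ?thesis
    by (simp add: W1_def expand_inf_arith expand_inf_qhalf_powi prod.distrib mult_ac)
qed

text \<open>
  The formula for the alphabet of \<open>n\<close> letters depends on \<open>n\<close> only through the factors
  $q^{-n/2} [n - i + v]$, one for each cell, with rows and columns counted from 1. As $n$ grows, each
  tends to $q^{(v-i)/2}$; the product of these limits is $q^{\kappa_\nu/4}$, as $v - i$ is the content of
  the cell.
\<close>

lemma W1_eq_eval_rho: "W1 \<nu> = eval_rho (schur \<nu>) empty_partition"
proof -
  let ?l = "plen \<nu>"
  \<comment> \<open>The factor of a cell, written so that its only dependence on \<open>n\<close> is a summand that tends to 0.\<close>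
  define y where "y n i v = qhalf_fls (int v - 1 - int i) * (1 + (-1) * (qhalf_fls (2 * (1 + int i - int v)) * qhalf_fls (- (2 * int n)))) *
      (inverse (br (int ?l - 1 - int i + int v)) :: rat fls)" for n i v
  have x: "rho_var empty_partition = (\<lambda>i. qhalf_fls (1 - 2 * int i))"
    by (simp add: fun_eq_iff rho_var_def rho_exp_def part_def)
  have y: "qhalf_fls (- int n) * (br (int n - 1 - int i + int v) / br (int ?l - 1 - int i + int v)) = y n i v" for n i v
  proof -
    have "qhalf_fls (- int n) * br (int n - 1 - int i + int v) =
        qhalf_fls (int v - 1 - int i) - qhalf_fls (int v - 1 - int i) * (qhalf_fls (2 * (1 + int i - int v)) * qhalf_fls (- (2 * int n)))"
      unfolding br_def right_diff_distrib qhalf_fls_add[symmetric]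
      by (intro arg_cong2[of _ _ _ _ "(-)"] arg_cong[of _ _ qhalf_fls]) auto
    then show ?thesis by (simp add: y_def divide_inverse right_diff_distrib mult.assoc[symmetric])
  qed
  have "fls_lim (\<lambda>n. weyl_ratio \<nu> ?l * (\<Prod>i=0..<?l. \<Prod>v=1..parts_of \<nu> i. y n i v))
      (weyl_ratio \<nu> ?l * (\<Prod>i=0..<?l. \<Prod>v=1..parts_of \<nu> i. qhalf_fls (int v - 1 - int i) *
        (1 + (-1) * (qhalf_fls (2 * (1 + int i - int v)) * 0)) * (inverse (br (int ?l - 1 - int i + int v)))))"
    unfolding y_def by (intro fls_lim_times fls_lim_prod fls_lim_add fls_lim_const fls_lim_qhalf_0) simp
  then have "fls_lim (\<lambda>n. weyl_ratio \<nu> ?l * (\<Prod>i=0..<?l. \<Prod>v=1..parts_of \<nu> i. y n i v)) (expand_inf (W1 \<nu>))"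
    by (simp add: W1_expand)
  then have "fls_lim (\<lambda>n. evs (rho_var empty_partition) n \<nu>) (expand_inf (W1 \<nu>))"
  proof (rule fls_lim_eventually)
    fix n assume n: "n \<ge> ?l"
    then obtain d where d: "n = ?l + d" using le_Suc_ex by blast
    have "evs (rho_var empty_partition) n \<nu> = qhalf_fls (1 - 2 * int n) ^ psize \<nu> *
        (qhalf_fls ((int n - 1) * int (psize \<nu>)) * weyl_ratio \<nu> n)"
      unfolding x using evs_principal[of n] n vander_ratio[OF n] by simp
    also have "\<dots> = qhalf_fls (- (int n * int (psize \<nu>))) * weyl_ratio \<nu> n"
    proof -
      have "int (psize \<nu>) * (1 - 2 * int n) + (int n - 1) * int (psize \<nu>) = - (int n * int (psize \<nu>))"
        by (simp add: algebra_simps)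
      then show ?thesis
        by (simp only: qhalf_fls_power mult.assoc[symmetric] qhalf_fls_add[symmetric])
    qed
    also have "qhalf_fls (- (int n * int (psize \<nu>))) = (\<Prod>i=0..<?l. \<Prod>v=1..parts_of \<nu> i. qhalf_fls (- int n) :: rat fls)"
      by (simp add: qhalf_fls_power qhalf_fls_sum psize_sum[of \<nu> ?l] atLeast0LessThan sum_distrib_left sum_negf mult.commute)
    also have "\<dots> * weyl_ratio \<nu> n = weyl_ratio \<nu> ?l * (\<Prod>i=0..<?l. \<Prod>v=1..parts_of \<nu> i. y n i v)"
      unfolding d weyl_ratio_extend y[symmetric] prod.distrib by (simp only: mult_ac)
    finally show "evs (rho_var empty_partition) n \<nu> = \<dots>" .
  qed
  then have "expand_inf (W1 \<nu>) = schur_lim empty_partition \<nu>"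
    using schur_lim(2) fls_lim_unique by blast
  then show ?thesis by (simp flip: expand_inf_eval_rho add: expand_inf_inject)
qed

section \<open>The Laurent polynomials and power sums\<close>

lemma fls_infsum_lim:
  fixes t :: "nat \<Rightarrow> 'a::comm_ring_1 fls"
  assumes fin: "\<And>B. finite {i\<in>{1..}. \<exists>k\<le>B. fls_nth (t i) k \<noteq> 0}"
  shows "fls_lim (\<lambda>m. \<Sum>i=1..m. t i) (infsum t {1..})"
proof -
  obtain S where S: "(t has_sum S) {1..}"
    and nth: "\<And>k. fls_nth S k = (\<Sum>i | i \<in> {1..} \<and> fls_nth (t i) k \<noteq> 0. fls_nth (t i) k)"
    by (rule fls_has_sum[OF fin]) blast
  have "fls_lim (\<lambda>m. \<Sum>i=1..m. t i) S"
    unfolding fls_lim_def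
  proof
    fix B
    let ?X = "{i\<in>{1..}. \<exists>k\<le>B. fls_nth (t i) k \<noteq> 0}"
    obtain m0 where m0: "?X \<subseteq> {..m0}" using fin[of B] by (meson finite_nat_iff_bounded_le)
    have "fls_nth (\<Sum>i=1..m. t i) k = fls_nth S k" if "m0 \<le> m" "k \<le> B" for m k
      unfolding nth fls_nth_sum
    proof (rule sum.mono_neutral_right)
      show "{i. i \<in> {1..} \<and> fls_nth (t i) k \<noteq> 0} \<subseteq> {1..m}"
        using m0 that by (auto simp: subset_iff intro: order_trans)
    qed auto
    then show "\<exists>m0. \<forall>m\<ge>m0. \<forall>k\<le>B. fls_nth (\<Sum>i=1..m. t i) k = fls_nth S k" by blast
  qed
  then show ?thesis using S by (simp add: infsumI)
qed

definition shift_series :: "partition \<Rightarrow> int fls" where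
  "shift_series \<alpha> = (\<Sum>\<^sub>\<infinity>i\<in>{1..}. qhalf_fls (2 * (int (part \<alpha> i) - int i)))"

text \<open>
  The change of \<open>shift_series\<close> relative to the empty partition; it is a Laurent polynomial.
\<close>

definition shift_poly :: "partition \<Rightarrow> int fls" where
  "shift_poly \<alpha> = (\<Sum>i=1..plen \<alpha>. qhalf_fls (2 * (int (part \<alpha> i) - int i)) - qhalf_fls (2 * (- int i)))"

lemma fls_lim_shift_series: "fls_lim (\<lambda>m. \<Sum>i=1..m. qhalf_fls (2 * (int (part \<alpha> i) - int i))) (shift_series \<alpha>)"
  unfolding shift_series_def
proof (rule fls_infsum_lim)
  fix B :: int
  show "finite {i \<in> {1..}. \<exists>k\<le>B. fls_nth (qhalf_fls (2 * (int (part \<alpha> i) - int i)) :: int fls) k \<noteq> 0}"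
  proof (rule finite_subset)
    show "{i \<in> {1..}. \<exists>k\<le>B. fls_nth (qhalf_fls (2 * (int (part \<alpha> i) - int i)) :: int fls) k \<noteq> 0} \<subseteq> {..nat (B + 2 * int (psize \<alpha>))}"
    proof
      fix i assume "i \<in> {i \<in> {1..}. \<exists>k\<le>B. fls_nth (qhalf_fls (2 * (int (part \<alpha> i) - int i)) :: int fls) k \<noteq> 0}"
      then have "- (2 * (int (part \<alpha> i) - int i)) \<le> B" by (auto simp: qhalf_fls_nth split: if_splits)
      moreover have "part \<alpha> i \<le> psize \<alpha>" by (simp add: part_def parts_of_le_psize)
      ultimately show "i \<in> {..nat (B + 2 * int (psize \<alpha>))}" by simp
    qed
  qed simp
qed

lemma part_eq_0: "\<not> i \<le> plen \<mu> \<Longrightarrow> part \<mu> i = 0"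
  using parts_of_eq_0_iff[of \<mu> "i - 1"] by (auto simp: part_def)

lemma part_empty [simp]: "part empty_partition i = 0"
  by (simp add: part_def)

lemma shift_series_empty_inverse: "(qhalf_fls 2 - 1) * shift_series empty_partition = 1"
proof -
  have tele: "(qhalf_fls 2 - 1) * (\<Sum>i=1..m. qhalf_fls (2 * (int (part empty_partition i) - int i))) =
      1 + (-1) * qhalf_fls (- (2 * int m)) * (1 :: int fls)" for m
  proof (induction m)
    case (Suc m)
    have "(qhalf_fls 2 * qhalf_fls (2 * (0 - int (Suc m))) :: int fls) = qhalf_fls (- (2 * int m))"
      by (simp flip: qhalf_fls_add)
    then show ?case using Suc by (simp add: algebra_simps)
  qed simp
  have "fls_lim (\<lambda>m. (qhalf_fls 2 - 1) * (\<Sum>i=1..m. qhalf_fls (2 * (int (part empty_partition i) - int i))))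
      ((qhalf_fls 2 - 1) * shift_series empty_partition)"
    by (intro fls_lim_times fls_lim_const fls_lim_shift_series)
  moreover have "fls_lim (\<lambda>m. 1 + (-1) * qhalf_fls (- (2 * int m)) * (1 :: int fls)) (1 + (-1) * 0 * 1)"
    by (intro fls_lim_add fls_lim_times fls_lim_const fls_lim_qhalf_0) simp
  ultimately show ?thesis unfolding tele using fls_lim_unique by fastforce
qed

lemma shift_series_eq: "shift_series \<alpha> = shift_poly \<alpha> + shift_series empty_partition"
proof -
  have eq: "(\<Sum>i=1..m. qhalf_fls (2 * (int (part \<alpha> i) - int i))) =
      shift_poly \<alpha> + (\<Sum>i=1..m. qhalf_fls (2 * (int (part empty_partition i) - int i)))" if m: "m \<ge> plen \<alpha>" for m
  proof -
    have "shift_poly \<alpha> = (\<Sum>i=1..m. qhalf_fls (2 * (int (part \<alpha> i) - int i)) - qhalf_fls (2 * (- int i)))"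
      unfolding shift_poly_def
      by (rule sum.mono_neutral_left) (use m in \<open>auto simp: part_eq_0\<close>)
    then show ?thesis by (simp add: sum_subtractf)
  qed
  have "fls_lim (\<lambda>m. shift_poly \<alpha> + (\<Sum>i=1..m. qhalf_fls (2 * (int (part empty_partition i) - int i))))
      (shift_poly \<alpha> + shift_series empty_partition)"
    by (intro fls_lim_add fls_lim_const fls_lim_shift_series)
  then have "fls_lim (\<lambda>m. \<Sum>i=1..m. qhalf_fls (2 * (int (part \<alpha> i) - int i))) (shift_poly \<alpha> + shift_series empty_partition)"
    by (rule fls_lim_eventually) (rule eq)
  then show ?thesis using fls_lim_shift_series fls_lim_unique by blast
qed

text \<open>
  The quotient of \<open>shift_poly\<close> by $q - 1$, a sum over the cells of the diagram.
\<close>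

definition box_poly :: "partition \<Rightarrow> int fls" where
  "box_poly \<alpha> = (\<Sum>i=1..plen \<alpha>. \<Sum>j<part \<alpha> i. qhalf_fls (2 * (int j - int i)))"

lemma shift_box_poly: "shift_poly \<alpha> = (qhalf_fls 2 - 1) * box_poly \<alpha>"
proof -
  have "(qhalf_fls 2 - 1) * (\<Sum>j<a. qhalf_fls (2 * (int j - int i))) = (qhalf_fls (2 * (int a - int i)) - qhalf_fls (2 * (- int i)) :: int fls)" for a i
  proof (induction a)
    case (Suc a)
    have "(qhalf_fls 2 * qhalf_fls (2 * (int a - int i)) :: int fls) = qhalf_fls (2 * (int (Suc a) - int i))"
      by (simp add: algebra_simps flip: qhalf_fls_add)
    then show ?case using Suc by (simp add: algebra_simps)
  qed simp
  then show ?thesis by (simp add: shift_poly_def box_poly_def sum_distrib_left)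
qed

text \<open>
  In the product of two shift series the constant part cancels, and the mixed terms are Laurent
  polynomials because the series of the empty partition is $1 / (q - 1)$.
\<close>

lemma f_series_poly:
  "f_series \<alpha> \<beta> = qhalf_fls 2 * (shift_poly \<alpha> * shift_poly \<beta> + box_poly \<alpha> + box_poly \<beta>)"
proof -
  let ?S = "shift_series empty_partition"
  have e: "(\<Sum>\<^sub>\<infinity>i\<in>{1::nat..}. qhalf_fls (2 * (- int i))) = ?S"
    by (simp add: shift_series_def)
  have S: "shift_poly \<gamma> * ?S = box_poly \<gamma>" for \<gamma>
  proof -
    have "shift_poly \<gamma> * ?S = box_poly \<gamma> * ((qhalf_fls 2 - 1) * ?S)"
      unfolding shift_box_poly by (simp only: mult_ac)
    then show ?thesis by (simp only: shift_series_empty_inverse mult_1_right)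
  qed
  have "f_series \<alpha> \<beta> = qhalf_fls 2 * (shift_series \<alpha> * shift_series \<beta> - ?S * ?S)"
    unfolding f_series_def e shift_series_def ..
  also have "shift_series \<alpha> * shift_series \<beta> - ?S * ?S = shift_poly \<alpha> * shift_poly \<beta> + shift_poly \<alpha> * ?S + shift_poly \<beta> * ?S"
    unfolding shift_series_eq[of \<alpha>] shift_series_eq[of \<beta>] by (simp add: algebra_simps)
  finally show ?thesis unfolding S .
qed

text \<open>
  \<open>F\<close> is a Laurent polynomial in $q$, at least in its integral powers, and \<open>e n\<close> is its value at
  $q^n$. The relation is built up along the formation of \<open>F\<close>, which avoids a separate type of Laurent
  polynomials.
\<close>

definition laurent :: "int fls \<Rightarrow> (nat \<Rightarrow> qrat) \<Rightarrow> bool" where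
  "laurent F e \<longleftrightarrow> finite {k. fls_nth F (- 2 * k) \<noteq> 0} \<and>
     (\<forall>n. e n = Sum_any (\<lambda>k. of_int (fls_nth F (- 2 * k)) * qhalf powi (2 * int n * k)))"

lemma laurentI:
  assumes "finite K" "\<And>k. k \<notin> K \<Longrightarrow> fls_nth F (- 2 * k) = 0"
    and "\<And>n. e n = (\<Sum>k\<in>K. of_int (fls_nth F (- 2 * k)) * qhalf powi (2 * int n * k))"
  shows "laurent F e"
  unfolding laurent_def
proof (intro conjI allI)
  show "finite {k. fls_nth F (- 2 * k) \<noteq> 0}"
    by (rule finite_subset[OF _ assms(1)]) (use assms(2) in blast)
  fix n
  show "e n = Sum_any (\<lambda>k. of_int (fls_nth F (- 2 * k)) * qhalf powi (2 * int n * k))"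
    unfolding assms(3) by (rule Sum_any.expand_superset [symmetric]) (use assms(1,2) in auto)
qed

lemma laurentE:
  assumes "laurent F e"
  obtains K where "finite K" "\<And>k. k \<notin> K \<Longrightarrow> fls_nth F (- 2 * k) = 0"
    "\<And>L n. finite L \<Longrightarrow> K \<subseteq> L \<Longrightarrow> e n = (\<Sum>k\<in>L. of_int (fls_nth F (- 2 * k)) * qhalf powi (2 * int n * k))"
proof (rule that[of "{k. fls_nth F (- 2 * k) \<noteq> 0}"])
  show "finite {k. fls_nth F (- 2 * k) \<noteq> 0}" using assms by (simp add: laurent_def)
  fix L n assume "finite L" "{k. fls_nth F (- 2 * k) \<noteq> 0} \<subseteq> L"
  then show "e n = (\<Sum>k\<in>L. of_int (fls_nth F (- 2 * k)) * qhalf powi (2 * int n * k))"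
    using assms unfolding laurent_def by (subst Sum_any.expand_superset[symmetric]) auto
qed auto

lemma laurent_qhalf: "laurent (qhalf_fls (2 * w)) (\<lambda>n. qhalf powi (2 * int n * w))"
  by (rule laurentI[of "{w}"]) (auto simp: qhalf_fls_nth)

lemma laurent_0: "laurent 0 (\<lambda>_. 0)"
  by (rule laurentI[of "{}"]) auto

lemma laurent_add:
  assumes "laurent F e" "laurent G d"
  shows "laurent (F + G) (\<lambda>n. e n + d n)"
proof -
  obtain K where K: "finite K" "\<And>k. k \<notin> K \<Longrightarrow> fls_nth F (- 2 * k) = 0"
    "\<And>L n. finite L \<Longrightarrow> K \<subseteq> L \<Longrightarrow> e n = (\<Sum>k\<in>L. of_int (fls_nth F (- 2 * k)) * qhalf powi (2 * int n * k))"
    using assms(1) by (rule laurentE) blast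
  obtain K' where K': "finite K'" "\<And>k. k \<notin> K' \<Longrightarrow> fls_nth G (- 2 * k) = 0"
    "\<And>L n. finite L \<Longrightarrow> K' \<subseteq> L \<Longrightarrow> d n = (\<Sum>k\<in>L. of_int (fls_nth G (- 2 * k)) * qhalf powi (2 * int n * k))"
    using assms(2) by (rule laurentE) blast
  show ?thesis
  proof (rule laurentI[of "K \<union> K'"])
    fix n
    show "e n + d n = (\<Sum>k\<in>K \<union> K'. of_int (fls_nth (F + G) (- 2 * k)) * qhalf powi (2 * int n * k))"
      using K(1) K'(1) K(3)[of "K \<union> K'" n] K'(3)[of "K \<union> K'" n]
      by (simp add: distrib_right sum.distrib)
  qed (use K(1,2) K'(1,2) in auto)
qed

lemma laurent_uminus:
  assumes "laurent F e"
  shows "laurent (- F) (\<lambda>n. - e n)"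
proof -
  obtain K where K: "finite K" "\<And>k. k \<notin> K \<Longrightarrow> fls_nth F (- 2 * k) = 0"
    "\<And>L n. finite L \<Longrightarrow> K \<subseteq> L \<Longrightarrow> e n = (\<Sum>k\<in>L. of_int (fls_nth F (- 2 * k)) * qhalf powi (2 * int n * k))"
    using assms(1) by (rule laurentE) blast
  show ?thesis
    by (rule laurentI[of K]) (use K(1,2) K(3)[of K] in \<open>auto simp: sum_negf\<close>)
qed

lemma laurent_diff: "laurent F e \<Longrightarrow> laurent G d \<Longrightarrow> laurent (F - G) (\<lambda>n. e n - d n)"
  using laurent_add[of F e "- G" "\<lambda>n. - d n"] laurent_uminus[of G d] by simp

lemma laurent_sum:
  "(\<And>i. i \<in> I \<Longrightarrow> laurent (F i) (e i)) \<Longrightarrow> laurent (\<Sum>i\<in>I. F i) (\<lambda>n. \<Sum>i\<in>I. e i n)"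
  by (induction I rule: infinite_finite_induct) (auto intro: laurent_0 laurent_add)

lemma laurent_shift:
  assumes "laurent F e"
  shows "laurent (qhalf_fls (2 * w) * F) (\<lambda>n. qhalf powi (2 * int n * w) * e n)"
proof -
  obtain K where K: "finite K" "\<And>k. k \<notin> K \<Longrightarrow> fls_nth F (- 2 * k) = 0"
    "\<And>L n. finite L \<Longrightarrow> K \<subseteq> L \<Longrightarrow> e n = (\<Sum>k\<in>L. of_int (fls_nth F (- 2 * k)) * qhalf powi (2 * int n * k))"
    using assms(1) by (rule laurentE) blast
  have nth: "fls_nth (qhalf_fls (2 * w) * F) (- 2 * k) = fls_nth F (- 2 * (k - w))" for k
    by (simp only: qhalf_fls_times_nth) (simp add: algebra_simps)
  show ?thesis
  proof (rule laurentI[of "(\<lambda>k. k + w) ` K"])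
    fix n
    have "(\<Sum>k\<in>(\<lambda>k. k + w) ` K. of_int (fls_nth (qhalf_fls (2 * w) * F) (- 2 * k)) * qhalf powi (2 * int n * k)) =
        (\<Sum>k\<in>K. of_int (fls_nth F (- 2 * k)) * qhalf powi (2 * int n * (k + w)))"
      by (subst sum.reindex, simp add: inj_on_def, simp only: o_def nth add_diff_cancel_right')
    also have "\<dots> = qhalf powi (2 * int n * w) * e n"
      using K(3)[of K n] K(1) by (simp add: sum_distrib_left distrib_left power_int_add mult_ac)
    finally show "qhalf powi (2 * int n * w) * e n =
        (\<Sum>k\<in>(\<lambda>k. k + w) ` K. of_int (fls_nth (qhalf_fls (2 * w) * F) (- 2 * k)) * qhalf powi (2 * int n * k))" ..
  next
    fix k assume "k \<notin> (\<lambda>k. k + w) ` K"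
    then have "k - w \<notin> K" by (auto simp: image_iff)
    then show "fls_nth (qhalf_fls (2 * w) * F) (- 2 * k) = 0" unfolding nth by (rule K(2))
  qed (use K in auto)
qed

definition shift_at :: "partition \<Rightarrow> nat \<Rightarrow> qrat" where
  "shift_at \<alpha> n = (\<Sum>i=1..plen \<alpha>. qhalf powi (2 * int n * (int (part \<alpha> i) - int i)) - qhalf powi (2 * int n * (- int i)))"

definition box_at :: "partition \<Rightarrow> nat \<Rightarrow> qrat" where
  "box_at \<alpha> n = (\<Sum>i=1..plen \<alpha>. \<Sum>j<part \<alpha> i. qhalf powi (2 * int n * (int j - int i)))"

lemma laurent_f_series:
  "laurent (f_series \<alpha> \<beta>) (\<lambda>n. qhalf powi (2 * int n * 1) * (shift_at \<alpha> n * shift_at \<beta> n + box_at \<alpha> n + box_at \<beta> n))"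
proof -
  have shift: "laurent (shift_poly \<gamma>) (shift_at \<gamma>)" for \<gamma>
    unfolding shift_poly_def shift_at_def by (intro laurent_sum laurent_diff laurent_qhalf)
  have box: "laurent (box_poly \<gamma>) (box_at \<gamma>)" for \<gamma>
    unfolding box_poly_def box_at_def by (intro laurent_sum laurent_qhalf)
  have "laurent (shift_poly \<alpha> * shift_poly \<beta>) (\<lambda>n. shift_at \<alpha> n * shift_at \<beta> n)"
    unfolding shift_poly_def[of \<alpha>] shift_at_def[of \<alpha>] sum_distrib_right left_diff_distrib
    by (intro laurent_sum laurent_diff laurent_shift shift)
  then have "laurent (qhalf_fls (2 * 1) * (shift_poly \<alpha> * shift_poly \<beta> + box_poly \<alpha> + box_poly \<beta>))
      (\<lambda>n. qhalf powi (2 * int n * 1) * (shift_at \<alpha> n * shift_at \<beta> n + box_at \<alpha> n + box_at \<beta> n))"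
    by (intro laurent_shift laurent_add box)
  then show ?thesis by (simp add: f_series_poly)
qed

lemma finite_f_coeff: "finite {k. f_coeff k \<alpha> \<beta> \<noteq> 0}"
  using laurent_f_series[of \<alpha> \<beta>] by (simp add: laurent_def f_coeff_def)

text \<open>
  The power sum is $q^{n/2}$ times the shift series at $q^n$, and the factor $q$ in \<open>f_series\<close> is the
  square of this prefactor.
\<close>

lemma f_at_eq_power_rho:
  assumes n: "n > 0"
  shows "f_at \<alpha> \<beta> n = power_rho \<alpha> n * power_rho \<beta> n - power_rho empty_partition n * power_rho empty_partition n"
proof -
  \<comment> \<open>The values of $q$ and $q^{1/2}$ after the substitution of $q^n$ for $q$.\<close>
  define q where "q = qhalf powi (2 * int n)"
  define h where "h = qhalf powi (int n)"
  have "q = qhalf powi (int n + int n)" by (simp only: q_def mult_2)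
  also have "\<dots> = h * h" unfolding h_def by (rule power_int_add) simp
  finally have hq: "h * h = q" ..
  have h0: "h \<noteq> 0" by (simp add: h_def)
  have "qbr (int n) = h - inverse h" by (simp add: qbr_def h_def power_int_minus)
  then have qb: "qbr (int n) * h = q - 1" using h0 by (simp add: left_diff_distrib hq)
  then have q1: "q - 1 \<noteq> 0" using qbr_nz[of "int n"] n h0 by auto
  have iq: "1 / qbr (int n) = h / (q - 1)"
    using qb q1 h0 qbr_nz[of "int n"] n by (simp add: frac_eq_eq mult.commute)
  have pr: "power_rho \<gamma> n = h * (shift_at \<gamma> n + 1 / (q - 1))" for \<gamma>
  proof -
    have e: "int n * (2 * a - 2 * b + 1) = int n + 2 * int n * (a - b)"
      "int n * (1 - 2 * b) = int n + 2 * int n * (- b)" for a b :: int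
      by (simp_all add: algebra_simps)
    have h: "qhalf powi (int n + c) = h * qhalf powi c" for c
      unfolding h_def by (rule power_int_add) simp
    show ?thesis
      unfolding power_rho_def shift_at_def iq e h by (simp add: distrib_left sum_distrib_left right_diff_distrib)
  qed
  have sb: "shift_at \<gamma> n = (q - 1) * box_at \<gamma> n" for \<gamma>
  proof -
    have "(q - 1) * (\<Sum>j<a. qhalf powi (2 * int n * (int j - int i))) =
        qhalf powi (2 * int n * (int a - int i)) - qhalf powi (2 * int n * (- int i))" for a i
    proof (induction a)
      case (Suc a)
      have "q * qhalf powi (2 * int n * (int a - int i)) = qhalf powi (2 * int n * (int (Suc a) - int i))"
      proof -
        have "qhalf powi (2 * int n + c) = q * qhalf powi c" for c
          unfolding q_def by (rule power_int_add) simp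
        moreover have "2 * int n * (int (Suc a) - int i) = 2 * int n + 2 * int n * (int a - int i)"
          by (simp add: algebra_simps)
        ultimately show ?thesis by (simp only:)
      qed
      then show ?case using Suc by (simp add: algebra_simps)
    qed simp
    then show ?thesis by (simp add: shift_at_def box_at_def sum_distrib_left)
  qed
  have "shift_at empty_partition n = 0"
  proof -
    have "plen empty_partition = 0" using parts_of_eq_0_iff[of empty_partition 0] by simp
    then show ?thesis by (simp add: shift_at_def)
  qed
  then have "power_rho \<alpha> n * power_rho \<beta> n - power_rho empty_partition n * power_rho empty_partition n =
      q * (shift_at \<alpha> n * shift_at \<beta> n + shift_at \<alpha> n / (q - 1) + shift_at \<beta> n / (q - 1))"
    unfolding pr hq[symmetric] by (simp add: algebra_simps)
  also have "\<dots> = q * (shift_at \<alpha> n * shift_at \<beta> n + box_at \<alpha> n + box_at \<beta> n)"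
    using q1 by (simp add: sb)
  also have "\<dots> = f_at \<alpha> \<beta> n"
    using laurent_f_series[of \<alpha> \<beta>] unfolding laurent_def f_at_def f_coeff_def q_def by simp
  finally show ?thesis ..
qed

section \<open>Substitution and exponential of formal power series\<close>

text \<open>
  Agreement in total degree up to \<open>K\<close>. Infinite sums and exponentials are handled by replacing them
  with finite sums modulo this congruence.
\<close>

definition mcong :: "nat \<Rightarrow> ('v, 'a::comm_ring_1) mfps \<Rightarrow> ('v, 'a) mfps \<Rightarrow> bool" where
  "mcong K F G \<longleftrightarrow> (\<forall>M. size M \<le> K \<longrightarrow> mcoeff F M = mcoeff G M)"

text \<open>
  All terms have total degree at least \<open>n\<close>.
\<close>

definition mord :: "nat \<Rightarrow> ('v, 'a::comm_ring_1) mfps \<Rightarrow> bool" where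
  "mord n F \<longleftrightarrow> (\<forall>M. size M < n \<longrightarrow> mcoeff F M = 0)"

lemma mfps_eq_mcong: "(\<And>K. mcong K F G) \<Longrightarrow> F = G"
  by (rule mfps_eqI) (auto simp: mcong_def)

lemma mcong_refl [simp]: "mcong K F F"
  by (simp add: mcong_def)

lemma mcong_sym: "mcong K F G \<Longrightarrow> mcong K G F"
  by (simp add: mcong_def)

lemma mcong_trans [trans]: "mcong K F G \<Longrightarrow> mcong K G H \<Longrightarrow> mcong K F H"
  by (simp add: mcong_def)

lemma mcong_times:
  assumes "mcong K F F'" "mcong K G G'"
  shows "mcong K (F * G) (F' * G')"
  unfolding mcong_def mcoeff_times
proof (intro allI impI sum.cong refl)
  fix M :: "'a multiset" and p assume "size M \<le> K" "p \<in> {(A, B). A + B = M}"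
  then show "(case p of (A, B) \<Rightarrow> mcoeff F A * mcoeff G B) = (case p of (A, B) \<Rightarrow> mcoeff F' A * mcoeff G' B)"
    using assms by (auto simp: mcong_def)
qed

lemma mcong_sum:
  assumes "\<And>i. i \<in> I \<Longrightarrow> mcong K (F i) (G i)"
  shows "mcong K (\<Sum>i\<in>I. F i) (\<Sum>i\<in>I. G i)"
  using assms by (auto simp: mcong_def intro!: sum.cong)

lemma mord_0 [simp]: "mord 0 F"
  by (simp add: mord_def)

lemma mord_mono: "mord n F \<Longrightarrow> m \<le> n \<Longrightarrow> mord m F"
  by (auto simp: mord_def)

lemma mord_mcong_0: "mord n F \<Longrightarrow> K < n \<Longrightarrow> mcong K F 0"
  by (auto simp: mord_def mcong_def)

lemma mord_times:
  assumes "mord a F" "mord b G"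
  shows "mord (a + b) (F * G)"
  unfolding mord_def mcoeff_times
proof (intro allI impI sum.neutral ballI)
  fix M :: "'a multiset" and p assume "size M < a + b" "p \<in> {(A, B). A + B = M}"
  moreover obtain A B where p: "p = (A, B)" by force
  ultimately have "size A < a \<or> size B < b" by auto
  then show "(case p of (A, B) \<Rightarrow> mcoeff F A * mcoeff G B) = 0"
    using assms p by (auto simp: mord_def)
qed

lemma mord_times_left: "mord a F \<Longrightarrow> mord a (F * G)"
  using mord_times[of a F 0 G] by simp

lemma mord_times_right: "mord a G \<Longrightarrow> mord a (F * G)"
  using mord_times[of 0 F a G] by simp

lemma mord_power: "mord 1 F \<Longrightarrow> mord n (F ^ n)"
proof (induction n)
  case (Suc n)
  then show ?case using mord_times[of 1 F n "F ^ n"] by simp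
qed simp

lemma mord_add: "mord n F \<Longrightarrow> mord n G \<Longrightarrow> mord n (F + G)"
  by (auto simp: mord_def)

lemma mord_sum: "(\<And>i. i \<in> I \<Longrightarrow> mord n (F i)) \<Longrightarrow> mord n (\<Sum>i\<in>I. F i)"
  by (auto simp: mord_def)

lemma mcoeff_mvar: "mcoeff (mvar v) M = (if M = {#v#} then 1 else 0)"
  by (simp add: mvar_def)

lemma mord_mvar [simp]: "mord (Suc 0) (mvar v)"
  by (auto simp: mord_def mcoeff_mvar)

lemma mconst_0 [simp]: "mconst 0 = 0" and mconst_1 [simp]: "mconst 1 = 1"
  by (simp_all add: mconst_arith)

lemma mconst_sum: "mconst (\<Sum>i\<in>I. f i) = (\<Sum>i\<in>I. mconst (f i))"
  by (induction I rule: infinite_finite_induct) (auto simp: mconst_arith)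

lemma mconst_uminus: "mconst (- a) = - mconst a"
  by (rule mfps_eqI) simp

lemma mconst_of_nat: "mconst (of_nat n) = of_nat n"
  by (induction n) (auto simp: mconst_arith)

lemma mconst_of_int: "mconst (of_int n) = of_int n"
  by (cases n) (auto simp: mconst_arith mconst_of_nat mconst_uminus)

lemma mcoeff_msum:
  assumes "finite J" "J \<subseteq> I" "\<And>i. i \<in> I \<Longrightarrow> i \<notin> J \<Longrightarrow> mcoeff (F i) M = 0"
  shows "mcoeff (msum F I) M = (\<Sum>i\<in>J. mcoeff (F i) M)"
  unfolding msum_def mcoeff_Abs_mfps
  by (rule sum.mono_neutral_left) (use assms in auto)

lemma msum_cong: "(\<And>i. i \<in> I \<Longrightarrow> F i = G i) \<Longrightarrow> msum F I = msum G I"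
  unfolding msum_def by (intro arg_cong[of _ _ Abs_mfps] ext sum.cong) auto

lemma msum_mcong:
  assumes "finite J" "J \<subseteq> I" "\<And>i. i \<in> I \<Longrightarrow> i \<notin> J \<Longrightarrow> mord (Suc K) (F i)"
  shows "mcong K (msum F I) (\<Sum>i\<in>J. F i)"
  unfolding mcong_def
proof (intro allI impI)
  fix M :: "'b multiset" assume "size M \<le> K"
  then have "mcoeff (msum F I) M = (\<Sum>i\<in>J. mcoeff (F i) M)"
    using assms by (intro mcoeff_msum) (auto simp: mord_def)
  then show "mcoeff (msum F I) M = mcoeff (\<Sum>i\<in>J. F i) M" by simp
qed

text \<open>
  In a product of truncated series, the terms beyond the triangle have degree greater than \<open>K\<close>.
\<close>

lemma mcong_triangle:
  assumes "\<And>i j. mord (i + j) (F i j)"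
  shows "mcong K (\<Sum>n\<le>K. \<Sum>i\<le>n. F i (n - i)) (\<Sum>i\<le>K. \<Sum>j\<le>K. F i j)"
  unfolding mcong_def
proof (intro allI impI)
  fix M :: "'a multiset" assume M: "size M \<le> K"
  have "(\<Sum>(i, j)\<in>{(i, j). i + j \<le> K}. mcoeff (F i j) M) = (\<Sum>(i, j)\<in>{..K} \<times> {..K}. mcoeff (F i j) M)"
  proof (rule sum.mono_neutral_left)
    have "mcoeff (F i j) M = 0" if "K < i + j" for i j
      using assms[of i j] that M by (simp add: mord_def)
    then show "\<forall>p\<in>{..K} \<times> {..K} - {(i, j). i + j \<le> K}. (case p of (i, j) \<Rightarrow> mcoeff (F i j) M) = 0"
      by (metis (mono_tags, lifting) DiffD2 case_prod_unfold mem_Collect_eq not_le)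
  qed auto
  then show "mcoeff (\<Sum>n\<le>K. \<Sum>i\<le>n. F i (n - i)) M = mcoeff (\<Sum>i\<le>K. \<Sum>j\<le>K. F i j) M"
    using sum.triangle_reindex_eq[of "\<lambda>i j. mcoeff (F i j) M" K]
    by (simp add: sum.cartesian_product case_prod_unfold)
qed

text \<open>
  Substitution of \<open>x\<close> for the variable of \<open>f\<close>.
\<close>

definition psub :: "('v, 'a::comm_ring_1) mfps \<Rightarrow> 'a fps \<Rightarrow> ('v, 'a) mfps" where
  "psub x f = msum (\<lambda>n. mconst (fps_nth f n) * x ^ n) UNIV"

lemma psub_mcong:
  assumes "mord 1 x"
  shows "mcong K (psub x f) (\<Sum>n\<le>K. mconst (fps_nth f n) * x ^ n)"
  unfolding psub_def
  by (rule msum_mcong)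
     (use assms in \<open>auto intro!: mord_times_right intro: mord_mono[OF mord_power]\<close>)

lemma psub_times:
  assumes x: "mord 1 x"
  shows "psub x (f * g) = psub x f * psub x g"
proof (rule mfps_eq_mcong)
  fix K
  let ?c = "\<lambda>i j. mconst (fps_nth f i * fps_nth g j) * x ^ (i + j)"
  have "mcong K (psub x (f * g)) (\<Sum>n\<le>K. mconst (fps_nth (f * g) n) * x ^ n)"
    by (rule psub_mcong[OF x])
  also have "(\<Sum>n\<le>K. mconst (fps_nth (f * g) n) * x ^ n) = (\<Sum>n\<le>K. \<Sum>i\<le>n. ?c i (n - i))"
    by (simp add: fps_mult_nth mconst_sum sum_distrib_right atLeast0AtMost)
  also have "mcong K \<dots> (\<Sum>i\<le>K. \<Sum>j\<le>K. ?c i j)"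
    by (rule mcong_triangle) (intro mord_times_right mord_power x)
  also have "(\<Sum>i\<le>K. \<Sum>j\<le>K. ?c i j) =
      (\<Sum>i\<le>K. mconst (fps_nth f i) * x ^ i) * (\<Sum>j\<le>K. mconst (fps_nth g j) * x ^ j)"
    by (simp add: sum_product mconst_arith power_add mult_ac)
  also have "mcong K \<dots> (psub x f * psub x g)"
    by (intro mcong_times mcong_sym[OF psub_mcong[OF x]])
  finally show "mcong K (psub x (f * g)) (psub x f * psub x g)" .
qed

lemma psub_1: "mord 1 x \<Longrightarrow> psub x 1 = 1"
proof (rule mfps_eq_mcong)
  fix K assume "mord 1 x"
  then have "mcong K (psub x 1) (\<Sum>n\<le>K. mconst (fps_nth 1 n) * x ^ n)" by (rule psub_mcong)
  also have "(\<Sum>n\<le>K. mconst (fps_nth 1 n) * x ^ n) = (\<Sum>n\<le>K. if n = 0 then 1 else 0)"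
    by (intro sum.cong) auto
  finally show "mcong K (psub x 1) 1" by simp
qed

lemma psub_X: "mord 1 x \<Longrightarrow> psub x fps_X = x"
proof (rule mfps_eq_mcong)
  fix K assume "mord 1 x"
  then have "mcong (Suc K) (psub x fps_X) (\<Sum>n\<le>Suc K. mconst (fps_nth fps_X n) * x ^ n)" by (rule psub_mcong)
  also have "(\<Sum>n\<le>Suc K. mconst (fps_nth fps_X n) * x ^ n) = (\<Sum>n\<le>Suc K. if n = 1 then x else 0)"
    by (intro sum.cong) auto
  finally show "mcong K (psub x fps_X) x" by (simp add: mcong_def)
qed

lemma psub_power: "mord 1 x \<Longrightarrow> psub x (f ^ n) = psub x f ^ n"
  by (induction n) (auto simp: psub_1 psub_times)

lemma psub_lincomb:
  assumes x: "mord 1 x"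
  shows "psub x (\<Sum>i\<in>I. fps_const (c i) * f i) = (\<Sum>i\<in>I. mconst (c i) * psub x (f i))"
proof (rule mfps_eq_mcong)
  fix K
  have "mcong K (psub x (\<Sum>i\<in>I. fps_const (c i) * f i)) (\<Sum>n\<le>K. mconst (fps_nth (\<Sum>i\<in>I. fps_const (c i) * f i) n) * x ^ n)"
    by (rule psub_mcong[OF x])
  also have "(\<Sum>n\<le>K. mconst (fps_nth (\<Sum>i\<in>I. fps_const (c i) * f i) n) * x ^ n) =
      (\<Sum>n\<le>K. \<Sum>i\<in>I. mconst (c i) * (mconst (fps_nth (f i) n) * x ^ n))"
    unfolding fps_sum_nth fps_mult_left_const_nth mconst_sum sum_distrib_right mconst_arith(2) mult.assoc ..
  also have "\<dots> = (\<Sum>i\<in>I. mconst (c i) * (\<Sum>n\<le>K. mconst (fps_nth (f i) n) * x ^ n))"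
    by (subst sum.swap) (simp add: sum_distrib_left)
  also have "mcong K \<dots> (\<Sum>i\<in>I. mconst (c i) * psub x (f i))"
    by (intro mcong_sum mcong_times mcong_refl mcong_sym[OF psub_mcong[OF x]])
  finally show "mcong K (psub x (\<Sum>i\<in>I. fps_const (c i) * f i)) (\<Sum>i\<in>I. mconst (c i) * psub x (f i))" .
qed

lemma psub_add:
  assumes "mord 1 x"
  shows "psub x (f + g) = psub x f + psub x g"
  using psub_lincomb[OF assms, of "\<lambda>_. 1" "\<lambda>b. if b then f else g" UNIV]
  by (simp add: UNIV_bool add.commute)

lemma mord_psub:
  assumes x: "mord 1 x" and "fps_nth f 0 = 0"
  shows "mord 1 (psub x f)"
  using psub_mcong[OF x, of 0 f] assms(2) by (auto simp: mord_def mcong_def)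

lemma psub_compose:
  assumes x: "mord 1 x" and g: "fps_nth g 0 = 0"
  shows "psub (psub x g) f = psub x (fps_compose f g)"
proof (rule mfps_eq_mcong)
  fix K
  have "mcong K (psub (psub x g) f) (\<Sum>n\<le>K. mconst (fps_nth f n) * psub x (g ^ n))"
    using psub_mcong[OF mord_psub[OF x g], of K f] by (simp add: psub_power[OF x])
  also have "mcong K \<dots> (\<Sum>n\<le>K. mconst (fps_nth f n) * (\<Sum>k\<le>K. mconst (fps_nth (g ^ n) k) * x ^ k))"
    by (intro mcong_sum mcong_times mcong_refl psub_mcong x)
  also have "(\<Sum>n\<le>K. mconst (fps_nth f n) * (\<Sum>k\<le>K. mconst (fps_nth (g ^ n) k) * x ^ k)) =
      (\<Sum>k\<le>K. mconst (\<Sum>n\<le>K. fps_nth f n * fps_nth (g ^ n) k) * x ^ k)"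
    unfolding sum_distrib_left by (subst sum.swap) (simp add: mconst_sum sum_distrib_right mconst_arith mult.assoc)
  also have "\<dots> = (\<Sum>k\<le>K. mconst (fps_nth (fps_compose f g) k) * x ^ k)"
  proof (intro sum.cong refl arg_cong2[of _ _ _ _ "(*)"] arg_cong[of _ _ mconst])
    fix k assume "k \<in> {..K}"
    then show "(\<Sum>n\<le>K. fps_nth f n * fps_nth (g ^ n) k) = fps_nth (fps_compose f g) k"
      unfolding fps_compose_nth
      by (intro sum.mono_neutral_right) (use startsby_zero_power_prefix[OF g] in auto)
  qed
  also have "mcong K \<dots> (psub x (fps_compose f g))" by (rule mcong_sym[OF psub_mcong[OF x]])
  finally show "mcong K (psub (psub x g) f) (psub x (fps_compose f g))" .
qed

lemma mexp_psub: "mexp (F :: ('v, 'a::field_char_0) mfps) = psub F (fps_exp 1)"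
  by (simp add: mexp_def psub_def)

lemma mexp_add:
  fixes F G :: "('v, 'a::field_char_0) mfps"
  assumes F: "mord 1 F" and G: "mord 1 G"
  shows "mexp (F + G) = mexp F * mexp G"
proof (rule mfps_eq_mcong)
  fix K
  let ?c = "\<lambda>i j. mconst (1 / (fact i * fact j)) * (F ^ i * G ^ j)"
  have "mcong K (mexp (F + G)) (\<Sum>n\<le>K. mconst (1 / fact n) * (F + G) ^ n)"
    using psub_mcong[OF mord_add[OF F G], of K "fps_exp 1"] by (simp add: mexp_psub)
  also have "(\<Sum>n\<le>K. mconst (1 / fact n) * (F + G) ^ n) = (\<Sum>n\<le>K. \<Sum>i\<le>n. ?c i (n - i))"
  proof (rule sum.cong[OF refl])
    fix n
    have "mconst (1 / fact n) * (F + G) ^ n = (\<Sum>i\<le>n. mconst (1 / fact n * of_nat (n choose i)) * (F ^ i * G ^ (n - i)))"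
      by (simp only: binomial_ring sum_distrib_left mconst_arith(2) mconst_of_nat mult.assoc)
    also have "\<dots> = (\<Sum>i\<le>n. ?c i (n - i))"
      by (intro sum.cong refl arg_cong2[of _ _ _ _ "(*)"] arg_cong[of _ _ mconst])
         (auto simp: binomial_fact field_simps)
    finally show "mconst (1 / fact n) * (F + G) ^ n = (\<Sum>i\<le>n. ?c i (n - i))" .
  qed
  also have "mcong K \<dots> (\<Sum>i\<le>K. \<Sum>j\<le>K. ?c i j)"
    by (rule mcong_triangle) (intro mord_times_right mord_times mord_power F G)
  also have "(\<Sum>i\<le>K. \<Sum>j\<le>K. ?c i j) =
      (\<Sum>i\<le>K. mconst (1 / fact i) * F ^ i) * (\<Sum>j\<le>K. mconst (1 / fact j) * G ^ j)"
  proof -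
    have "(mconst (1 / (fact i * fact j)) :: ('v, 'a) mfps) = mconst (1 / fact i) * mconst (1 / fact j)" for i j
      by (simp flip: mconst_arith)
    then show ?thesis by (simp add: sum_product mult_ac)
  qed
  also have "mcong K \<dots> (mexp F * mexp G)"
    using psub_mcong[OF F, of K "fps_exp 1"] psub_mcong[OF G, of K "fps_exp 1"]
    by (intro mcong_times mcong_sym[of K "mexp _"]) (simp_all add: mexp_psub)
  finally show "mcong K (mexp (F + G)) (mexp F * mexp G)" .
qed

lemma mexp_0: "mexp (0 :: ('v, 'a::field_char_0) mfps) = 1"
proof -
  have m0: "mord 1 (0 :: ('v, 'a) mfps)" by (simp add: mord_def)
  show ?thesis
  proof (rule mfps_eq_mcong)
    fix K
    have "mcong K (mexp (0 :: ('v, 'a) mfps)) (\<Sum>n\<le>K. mconst (fps_nth (fps_exp 1) n) * 0 ^ n)"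
      unfolding mexp_psub by (rule psub_mcong[OF m0])
    also have "(\<Sum>n\<le>K. mconst (fps_nth (fps_exp 1) n) * 0 ^ n) = (\<Sum>n\<le>K. if n = 0 then 1 else (0 :: ('v, 'a) mfps))"
      by (intro sum.cong) (auto simp: power_0_left)
    finally show "mcong K (mexp 0) (1 :: ('v, 'a) mfps)" by simp
  qed
qed

lemma mexp_sum:
  fixes F :: "'i \<Rightarrow> ('v, 'a::field_char_0) mfps"
  assumes "\<And>i. i \<in> I \<Longrightarrow> mord 1 (F i)"
  shows "mexp (\<Sum>i\<in>I. F i) = (\<Prod>i\<in>I. mexp (F i))"
  using assms
proof (induction I rule: infinite_finite_induct)
  case (insert i I)
  then show ?case by (simp add: mexp_add mord_sum)
qed (simp_all add: mexp_0)

lemma inverse_mfps_eq: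
  assumes "f * g = (1 :: ('v, 'a::comm_ring_1) mfps)"
  shows "inverse f = g"
proof -
  have "f dvd 1" using assms by (metis dvd_triv_left)
  moreover have "(THE g. f * g = 1) = g"
  proof (rule the_equality)
    fix g' assume "f * g' = 1"
    then have "g' = (f * g) * g'" by (simp add: assms)
    also have "\<dots> = g * (f * g')" by (simp only: mult_ac)
    also have "\<dots> = g" by (simp add: \<open>f * g' = 1\<close>)
    finally show "g' = g" .
  qed (rule assms)
  ultimately show ?thesis by (simp add: inverse_mfps_def)
qed

text \<open>
  An integral multiple of a logarithm, with the sign of \<open>powi\<close> chosen to fit the product formula.
\<close>

lemma mexp_multiple:
  fixes L :: "('v, 'a::field_char_0) mfps"
  assumes L: "mord 1 L" and v: "mexp L * v = 1"
  shows "mexp (mconst (of_int c) * L) = v powi (- c)"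
proof -
  have pos: "mexp (mconst (of_nat n) * L) = mexp L ^ n" for n
  proof (induction n)
    case (Suc n)
    have "mconst (of_nat (Suc n)) * L = L + mconst (of_nat n) * L" by (simp add: mconst_arith distrib_right)
    then show ?case using Suc L by (simp add: mexp_add mord_times_right)
  qed (simp add: mexp_0)
  have inv: "inverse v = mexp L" by (rule inverse_mfps_eq) (use v in \<open>simp add: mult.commute\<close>)
  show ?thesis
  proof (cases "c \<ge> 0")
    case True
    then obtain n where n: "c = int n" using nonneg_int_cases by blast
    then show ?thesis using pos[of n] by (cases "n = 0") (simp_all add: power_int_def inv)
  next
    case False
    then obtain n where n: "c = - int n" using int_cases2[of c] by auto
    have "mexp (mconst (of_int c) * L) * mexp L ^ n = mexp (mconst (of_int c) * L + mconst (of_nat n) * L)"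
      unfolding pos[symmetric]
      by (rule mexp_add [symmetric]; rule mord_times_right, rule L)
    also have "mconst (of_int c) * L + mconst (of_nat n) * L = (mconst (of_int c + of_nat n) :: ('v, 'a) mfps) * L"
      by (simp only: mconst_arith distrib_right)
    also have "\<dots> = 0" by (simp add: n)
    finally have one: "mexp (mconst (of_int c) * L) * mexp L ^ n = 1" by (simp only: mexp_0)
    have "mexp L ^ n * v ^ n = 1" by (simp only: power_mult_distrib[symmetric] v power_one)
    then have "mexp (mconst (of_int c) * L) = mexp (mconst (of_int c) * L) * mexp L ^ n * v ^ n"
      by (simp only: mult.assoc mult_1_right)
    then have "mexp (mconst (of_int c) * L) = v ^ n" unfolding one by simp
    then show ?thesis by (simp add: n power_int_def)
  qed
qed

text \<open>
  The series $\sum_n p_n t^n / n$, which is the logarithm of $\sum_n h_n t^n$ if \<open>p\<close> and \<open>h\<close> satisfy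
  Newton's identities.
\<close>

definition log_fps :: "(nat \<Rightarrow> 'a::field_char_0) \<Rightarrow> 'a fps" where
  "log_fps p = Abs_fps (\<lambda>n. if n = 0 then 0 else p n / of_nat n)"

text \<open>
  The exponential satisfies the same differential equation $t H' = P H$, and Newton's identities
  determine the coefficients recursively.
\<close>

lemma newton_exp_log:
  assumes "newton p h"
  shows "fps_compose (fps_exp 1) (log_fps p) = Abs_fps h"
proof -
  let ?E = "fps_compose (fps_exp 1) (log_fps p)"
  have L0: "fps_nth (log_fps p) 0 = 0" by (simp add: log_fps_def)
  have "fps_X * fps_deriv (log_fps p) = Abs_fps (\<lambda>k. if k = 0 then 0 else p k)"
  proof (rule fps_ext)
    fix n show "fps_nth (fps_X * fps_deriv (log_fps p)) n = fps_nth (Abs_fps (\<lambda>k. if k = 0 then 0 else p k)) n"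
      by (cases n) (simp_all add: log_fps_def del: of_nat_Suc)
  qed
  moreover have "fps_deriv ?E = fps_deriv (log_fps p) * ?E"
    using fps_compose_deriv[OF L0, of "fps_exp 1"] by (simp add: mult.commute)
  ultimately have "newton p (fps_nth ?E)"
    unfolding newton_fps by (simp add: fps_nth_inverse mult.assoc[symmetric])
  then have "fps_nth ?E n = h n" for n by (rule newton_unique[OF _ assms])
  then show ?thesis by (simp add: fps_eq_iff)
qed

lemma psub_newton:
  fixes x :: "('v, 'a::field_char_0) mfps"
  assumes "newton p h" "mord 1 x"
  shows "psub x (Abs_fps h) = mexp (psub x (log_fps p))"
  unfolding mexp_psub newton_exp_log[OF assms(1), symmetric]
  by (rule psub_compose [symmetric]) (use assms(2) in \<open>auto simp: log_fps_def\<close>)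

text \<open>
  The one-letter alphabet \<open>a\<close>: its complete symmetric functions form a geometric series.
\<close>

lemma mexp_log_geometric:
  fixes x :: "('v, 'a::field_char_0) mfps"
  assumes x: "mord 1 x"
  shows "mexp (psub x (log_fps (\<lambda>k. a ^ k))) * (1 - mconst a * x) = 1"
proof -
  have "newton (\<lambda>k. a ^ k) (\<lambda>k. a ^ k)"
    by (auto simp: newton_def simp flip: power_add)
  then have "mexp (psub x (log_fps (\<lambda>k. a ^ k))) = psub x (Abs_fps (\<lambda>k. a ^ k))"
    using psub_newton x by metis
  moreover have "psub x (1 - fps_const a * fps_X) = 1 - mconst a * x"
    using psub_lincomb[OF x, of "\<lambda>b. if b then 1 else - a" "\<lambda>b. if b then 1 else fps_X" UNIV]
    by (simp add: UNIV_bool psub_1[OF x] psub_X[OF x] mconst_uminus fps_const_neg[symmetric] del: fps_const_neg)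
  moreover have "Abs_fps (\<lambda>k. a ^ k) * (1 - fps_const a * fps_X) = 1"
  proof (rule fps_ext)
    fix n show "fps_nth (Abs_fps (\<lambda>k. a ^ k) * (1 - fps_const a * fps_X)) n = fps_nth 1 n"
      by (cases n) (simp_all add: algebra_simps)
  qed
  ultimately show ?thesis by (metis psub_times psub_1 x)
qed

abbreviation ev :: "partition \<Rightarrow> partition \<Rightarrow> qrat" where
  "ev \<alpha> \<rho> \<equiv> eval_rho (schur \<rho>) \<alpha>"

lemma msum_mcong_upto:
  assumes "\<And>\<rho>. mord (psize \<rho>) (F \<rho>)"
  shows "mcong K (msum F UNIV) (\<Sum>\<rho>\<in>partitions_upto K. F \<rho>)"
  by (rule msum_mcong) (auto simp: finite_psize_le intro: mord_mono[OF assms])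

lemma msum_single:
  assumes "a \<in> I" "\<And>i. i \<in> I \<Longrightarrow> i \<noteq> a \<Longrightarrow> F i = 0"
  shows "msum F I = F a"
proof (rule mfps_eqI)
  fix M show "mcoeff (msum F I) M = mcoeff (F a) M"
    using mcoeff_msum[of "{a}" I F M] assms by simp
qed

lemma sum_partitions_upto: "(\<Sum>\<rho>\<in>partitions_upto K. f \<rho>) = (\<Sum>n\<le>K. \<Sum>\<rho>\<in>partitions n. f \<rho>)"
proof -
  have "(\<Sum>\<rho>\<in>partitions_upto K. f \<rho>) = (\<Sum>n\<in>{..K}. \<Sum>\<rho>\<in>{\<rho>. \<rho> \<in> partitions_upto K \<and> psize \<rho> = n}. f \<rho>)"
    by (rule sum.group [symmetric]) (auto simp: finite_psize_le)
  also have "\<dots> = (\<Sum>n\<le>K. \<Sum>\<rho>\<in>partitions n. f \<rho>)"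
    by (intro sum.cong refl) auto
  finally show ?thesis .
qed

section \<open>Cauchy kernels\<close>

definition cauchy :: "partition \<Rightarrow> partition \<Rightarrow> (nat, qrat) mfps \<Rightarrow> (nat, qrat) mfps" where
  "cauchy \<alpha> \<beta> w = msum (\<lambda>\<rho>. w ^ psize \<rho> * mconst (ev \<alpha> \<rho> * ev \<beta> \<rho>)) UNIV"

lemma cauchy_psub:
  assumes w: "mord 1 w"
  shows "cauchy \<alpha> \<beta> w = psub w (Abs_fps (\<lambda>n. \<Sum>\<rho>\<in>partitions n. ev \<alpha> \<rho> * ev \<beta> \<rho>))"
proof (rule mfps_eq_mcong)
  fix K
  have "mcong K (cauchy \<alpha> \<beta> w) (\<Sum>\<rho>\<in>partitions_upto K. w ^ psize \<rho> * mconst (ev \<alpha> \<rho> * ev \<beta> \<rho>))"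
    unfolding cauchy_def by (rule msum_mcong_upto) (intro mord_times_left mord_power w)
  also have "(\<Sum>\<rho>\<in>partitions_upto K. w ^ psize \<rho> * mconst (ev \<alpha> \<rho> * ev \<beta> \<rho>)) =
      (\<Sum>n\<le>K. mconst (\<Sum>\<rho>\<in>partitions n. ev \<alpha> \<rho> * ev \<beta> \<rho>) * w ^ n)"
    unfolding sum_partitions_upto by (intro sum.cong refl) (simp add: mconst_sum sum_distrib_left mult.commute)
  also have "mcong K \<dots> (psub w (Abs_fps (\<lambda>n. \<Sum>\<rho>\<in>partitions n. ev \<alpha> \<rho> * ev \<beta> \<rho>)))"
    using mcong_sym[OF psub_mcong[OF w, of K "Abs_fps (\<lambda>n. \<Sum>\<rho>\<in>partitions n. ev \<alpha> \<rho> * ev \<beta> \<rho>)"]] by simp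
  finally show "mcong K (cauchy \<alpha> \<beta> w) (psub w (Abs_fps (\<lambda>n. \<Sum>\<rho>\<in>partitions n. ev \<alpha> \<rho> * ev \<beta> \<rho>)))" .
qed

text \<open>
  The Cauchy identity in exponential form.
\<close>

lemma cauchy_mexp:
  assumes w: "mord 1 w"
  shows "cauchy \<alpha> \<beta> w = mexp (psub w (log_fps (\<lambda>k. power_rho \<alpha> k * power_rho \<beta> k)))"
  unfolding cauchy_psub[OF w] by (rule psub_newton[OF newton_cauchy_eval_rho w])

lemma eval_rho_schur_empty [simp]: "eval_rho 1 \<alpha> = 1"
  using schur_hom_empty[OF schur_hom_eval_rho[of \<alpha>]] by simp

text \<open>
  The identity $\mathcal{W}_\nu = s_\nu(q^\rho)$ turns $\mathcal{W}_{\nu(0)}$ into a Schur function.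
\<close>

lemma K00_cauchy: "K00 w = cauchy empty_partition empty_partition w"
  unfolding K00_def cauchy_def
  by (rule msum_cong) (simp add: W2_def W1_eq_eval_rho)

lemma mord_log: "mord 1 w \<Longrightarrow> mord 1 (psub w (log_fps p))"
  by (rule mord_psub) (simp_all add: log_fps_def)

lemma K00_unit: "mord 1 w \<Longrightarrow> \<exists>g. K00 w * g = 1"
proof -
  assume w: "mord 1 w"
  let ?Y = "psub w (log_fps (\<lambda>k. power_rho empty_partition k * power_rho empty_partition k))"
  have "mexp ?Y * mexp (- ?Y) = mexp (?Y + - ?Y)"
    by (rule mexp_add [symmetric]) (use mord_log[OF w] in \<open>auto simp: mord_def\<close>)
  then have "K00 w * mexp (- ?Y) = 1" by (simp add: K00_cauchy cauchy_mexp[OF w] mexp_0)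
  then show ?thesis by blast
qed

lemma cauchy_K00:
  assumes w: "mord 1 w"
  shows "cauchy \<alpha> \<beta> w = K00 w * mexp (psub w (log_fps (f_at \<alpha> \<beta>)))"
proof -
  have "log_fps (\<lambda>k. power_rho \<alpha> k * power_rho \<beta> k) =
      log_fps (\<lambda>k. power_rho empty_partition k * power_rho empty_partition k) + log_fps (f_at \<alpha> \<beta>)"
    by (rule fps_ext) (simp add: log_fps_def f_at_eq_power_rho flip: add_divide_distrib)
  then show ?thesis
    by (simp only: K00_cauchy cauchy_mexp[OF w] psub_add[OF w] mexp_add[OF mord_log[OF w] mord_log[OF w]])
qed

lemma msum_log:
  "msum (\<lambda>n. mconst (p n / of_nat n) * w ^ n) {1..} = psub w (log_fps p)"
  unfolding psub_def msum_def
proof (intro arg_cong[of _ _ Abs_mfps] ext sum.cong)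
  fix M
  show "{i \<in> {1..}. mcoeff (mconst (p i / of_nat i) * w ^ i) M \<noteq> 0} =
      {i \<in> UNIV. mcoeff (mconst (fps_nth (log_fps p) i) * w ^ i) M \<noteq> 0}"
    by (auto simp: log_fps_def Suc_le_eq split: if_splits)
  fix i assume "i \<in> {i \<in> UNIV. mcoeff (mconst (fps_nth (log_fps p) i) * w ^ i) M \<noteq> 0}"
  then show "mcoeff (mconst (p i / of_nat i) * w ^ i) M = mcoeff (mconst (fps_nth (log_fps p) i) * w ^ i) M"
    by (auto simp: log_fps_def split: if_splits)
qed

text \<open>
  Each exponent \<open>k\<close> of the Laurent polynomial contributes \<open>f_coeff k\<close> times the logarithm of the
  geometric series with ratio $q^k w$.
\<close>

lemma mexp_f_at_product:
  assumes w: "mord 1 w"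
  shows "mexp (psub w (log_fps (f_at \<alpha> \<beta>))) =
    Prod_any (\<lambda>n. (1 - mconst (qhalf powi (2 * n)) * w) powi (- f_coeff n \<alpha> \<beta>))"
proof -
  define S where "S = {k. f_coeff k \<alpha> \<beta> \<noteq> 0}"
  have S: "finite S" unfolding S_def by (rule finite_f_coeff)
  have f: "f_at \<alpha> \<beta> n = (\<Sum>k\<in>S. of_int (f_coeff k \<alpha> \<beta>) * (qhalf powi (2 * k)) ^ n)" for n
  proof -
    have "f_at \<alpha> \<beta> n = (\<Sum>k\<in>S. of_int (f_coeff k \<alpha> \<beta>) * qhalf powi (2 * int n * k))"
      unfolding f_at_def by (rule Sum_any.expand_superset) (use S in \<open>auto simp: S_def\<close>)
    moreover have "qhalf powi (2 * int n * k) = (qhalf powi (2 * k)) ^ n" for k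
    proof -
      have "qhalf powi (2 * int n * k) = qhalf powi (2 * k * int n)" by (simp add: mult_ac)
      then show ?thesis by (simp only: power_int_mult power_int_of_nat)
    qed
    ultimately show ?thesis by simp
  qed
  have "log_fps (f_at \<alpha> \<beta>) = (\<Sum>k\<in>S. fps_const (of_int (f_coeff k \<alpha> \<beta>)) * log_fps (\<lambda>n. (qhalf powi (2 * k)) ^ n))"
    by (rule fps_ext) (simp add: log_fps_def f fps_sum_nth sum_divide_distrib)
  then have "mexp (psub w (log_fps (f_at \<alpha> \<beta>))) =
      mexp (\<Sum>k\<in>S. mconst (of_int (f_coeff k \<alpha> \<beta>)) * psub w (log_fps (\<lambda>n. (qhalf powi (2 * k)) ^ n)))"
    by (simp only: psub_lincomb[OF w])
  also have "\<dots> = (\<Prod>k\<in>S. mexp (mconst (of_int (f_coeff k \<alpha> \<beta>)) * psub w (log_fps (\<lambda>n. (qhalf powi (2 * k)) ^ n))))"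
    by (rule mexp_sum, rule mord_times_right, rule mord_log[OF w])
  also have "\<dots> = (\<Prod>k\<in>S. (1 - mconst (qhalf powi (2 * k)) * w) powi (- f_coeff k \<alpha> \<beta>))"
    by (intro prod.cong refl mexp_multiple mord_log[OF w] mexp_log_geometric[OF w])
  also have "\<dots> = Prod_any (\<lambda>n. (1 - mconst (qhalf powi (2 * n)) * w) powi (- f_coeff n \<alpha> \<beta>))"
    by (rule Prod_any.expand_superset [symmetric]) (use S in \<open>auto simp: S_def\<close>)
  finally show ?thesis .
qed

section \<open>The vertex as a transfer operator\<close>

lemma schur_hom_mconst: "schur_hom T \<Longrightarrow> schur_hom (\<lambda>\<nu>. mconst (T \<nu>))"
  unfolding schur_hom_def mconst_arith(2)[symmetric] mconst_of_int[symmetric] mconst_sum[symmetric]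
  by simp

text \<open>
  A truncated form of multiplicativity, in which the range of the sum is independent of \<open>\<eta>\<close> and \<open>\<rho>\<close>:
  if it cuts off any terms, then both sides vanish in degree up to \<open>K\<close>.
\<close>

lemma schur_hom_mcong:
  assumes e: "schur_hom e" "\<And>\<nu>. mord (psize \<nu>) (e \<nu>)"
  shows "mcong K (e \<eta> * e \<rho>) (\<Sum>\<nu>\<in>partitions_upto K. of_int (lr \<nu> \<eta> \<rho>) * e \<nu>)"
proof (cases "psize \<eta> + psize \<rho> \<le> K")
  case True
  have "e \<eta> * e \<rho> = (\<Sum>\<nu>\<in>partitions (psize \<eta> + psize \<rho>). of_int (lr \<nu> \<eta> \<rho>) * e \<nu>)"
    by (rule schur_hom_times[OF e(1)])
  also have "\<dots> = (\<Sum>\<nu>\<in>partitions_upto K. of_int (lr \<nu> \<eta> \<rho>) * e \<nu>)"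
  proof (rule sum.mono_neutral_left)
    show "\<forall>\<nu>\<in>partitions_upto K - partitions (psize \<eta> + psize \<rho>). of_int (lr \<nu> \<eta> \<rho>) * e \<nu> = 0"
    proof
      fix \<nu> assume "\<nu> \<in> partitions_upto K - partitions (psize \<eta> + psize \<rho>)"
      then have "lr \<nu> \<eta> \<rho> = 0" using lr_size[of \<nu> \<eta> \<rho>] by auto
      then show "of_int (lr \<nu> \<eta> \<rho>) * e \<nu> = 0" by simp
    qed
  qed (use True in \<open>auto simp: finite_psize_le\<close>)
  finally show ?thesis by simp
next
  case False
  then have "(\<Sum>\<nu>\<in>partitions_upto K. of_int (lr \<nu> \<eta> \<rho>) * e \<nu>) = 0"
  proof (intro sum.neutral ballI)
    fix \<nu> assume "\<nu> \<in> partitions_upto K"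
    then have "lr \<nu> \<eta> \<rho> = 0" using False lr_size[of \<nu> \<eta> \<rho>] by auto
    then show "of_int (lr \<nu> \<eta> \<rho>) * e \<nu> = 0" by simp
  qed
  moreover have "mcong K (e \<eta> * e \<rho>) 0"
    by (rule mord_mcong_0[OF mord_times[OF e(2) e(2)]]) (use False in simp)
  ultimately show ?thesis by simp
qed

text \<open>
  The sum over \<open>\<nu>\<close> in the definition of \<open>conv\<close> collapses by multiplicativity of \<open>e\<close>: a Cauchy sum
  over a union of alphabets is the product of the Cauchy sums.
\<close>

lemma conv_cauchy:
  assumes e: "schur_hom e" "\<And>\<nu>. mord (psize \<nu>) (e \<nu>)"
  shows "msum (\<lambda>\<nu>. conv T T' \<nu> * e \<nu>) UNIV = msum (\<lambda>\<eta>. T \<eta> * e \<eta>) UNIV * msum (\<lambda>\<rho>. T' \<rho> * e \<rho>) UNIV"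
proof (rule mfps_eq_mcong)
  fix K
  let ?P = "partitions_upto K"
  have "mcong K (msum (\<lambda>\<nu>. conv T T' \<nu> * e \<nu>) UNIV) (\<Sum>\<nu>\<in>?P. conv T T' \<nu> * e \<nu>)"
    by (rule msum_mcong_upto) (intro mord_times_right e)
  also have "(\<Sum>\<nu>\<in>?P. conv T T' \<nu> * e \<nu>) = (\<Sum>\<nu>\<in>?P. \<Sum>\<eta>\<in>?P. \<Sum>\<rho>\<in>?P. (T \<eta> * T' \<rho>) * (of_int (lr \<nu> \<eta> \<rho>) * e \<nu>))"
  proof (rule sum.cong[OF refl])
    fix \<nu> assume "\<nu> \<in> ?P"
    then have "conv T T' \<nu> = (\<Sum>\<eta>\<in>?P. \<Sum>\<rho>\<in>?P. of_int (lr \<nu> \<eta> \<rho>) * (T \<eta> * T' \<rho>))"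
      by (intro conv_upto) simp
    then show "conv T T' \<nu> * e \<nu> = (\<Sum>\<eta>\<in>?P. \<Sum>\<rho>\<in>?P. (T \<eta> * T' \<rho>) * (of_int (lr \<nu> \<eta> \<rho>) * e \<nu>))"
      by (simp only: sum_distrib_right) (simp only: mult_ac)
  qed
  also have "\<dots> = (\<Sum>\<eta>\<in>?P. \<Sum>\<rho>\<in>?P. (T \<eta> * T' \<rho>) * (\<Sum>\<nu>\<in>?P. of_int (lr \<nu> \<eta> \<rho>) * e \<nu>))"
    by (subst sum.swap, rule sum.cong[OF refl], subst sum.swap) (simp only: sum_distrib_left)
  also have "mcong K \<dots> (\<Sum>\<eta>\<in>?P. \<Sum>\<rho>\<in>?P. (T \<eta> * T' \<rho>) * (e \<eta> * e \<rho>))"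
    by (intro mcong_sum mcong_times mcong_refl mcong_sym[OF schur_hom_mcong[OF e]])
  also have "(\<Sum>\<eta>\<in>?P. \<Sum>\<rho>\<in>?P. (T \<eta> * T' \<rho>) * (e \<eta> * e \<rho>)) = (\<Sum>\<eta>\<in>?P. T \<eta> * e \<eta>) * (\<Sum>\<rho>\<in>?P. T' \<rho> * e \<rho>)"
    by (simp only: sum_product mult_ac)
  also have "mcong K \<dots> (msum (\<lambda>\<eta>. T \<eta> * e \<eta>) UNIV * msum (\<lambda>\<rho>. T' \<rho> * e \<rho>) UNIV)"
    by (intro mcong_times mcong_sym[OF msum_mcong_upto] mord_times_right e)
  finally show "mcong K (msum (\<lambda>\<nu>. conv T T' \<nu> * e \<nu>) UNIV)
      (msum (\<lambda>\<eta>. T \<eta> * e \<eta>) UNIV * msum (\<lambda>\<rho>. T' \<rho> * e \<rho>) UNIV)" .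
qed

text \<open>
  The vertex without its prefactors: the sum over \<open>\<eta>\<close> of the skew Schur functions of \<open>\<kappa>\<close> and \<open>\<nu>\<close> over
  \<open>\<eta>\<close>, evaluated at $q^{\mu^t+\rho}$ and $q^{\mu+\rho}$.
\<close>

definition vertex_sum :: "partition \<Rightarrow> partition \<Rightarrow> partition \<Rightarrow> qrat" where
  "vertex_sum \<mu> \<kappa> \<nu> = (\<Sum>\<eta>\<in>partitions_upto (psize \<nu>). \<Sum>\<rho>\<in>partitions_upto (psize \<kappa>). \<Sum>\<sigma>\<in>partitions_upto (psize \<nu>).
     of_int (lr \<kappa> \<eta> \<rho>) * of_int (lr \<nu> \<eta> \<sigma>) * (ev (conjugate \<mu>) \<rho> * ev \<mu> \<sigma>))"

lemma vertex_sum_upto: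
  assumes "psize \<kappa> \<le> K"
  shows "vertex_sum \<mu> \<kappa> \<nu> = (\<Sum>\<eta>\<in>partitions_upto (psize \<nu>). \<Sum>\<rho>\<in>partitions_upto K. \<Sum>\<sigma>\<in>partitions_upto (psize \<nu>).
     of_int (lr \<kappa> \<eta> \<rho>) * of_int (lr \<nu> \<eta> \<sigma>) * (ev (conjugate \<mu>) \<rho> * ev \<mu> \<sigma>))"
  unfolding vertex_sum_def
proof (rule sum.cong[OF refl], rule sum.mono_neutral_left)
  fix \<eta>
  show "\<forall>\<rho>\<in>partitions_upto K - partitions_upto (psize \<kappa>). (\<Sum>\<sigma>\<in>partitions_upto (psize \<nu>).
      of_int (lr \<kappa> \<eta> \<rho>) * of_int (lr \<nu> \<eta> \<sigma>) * (ev (conjugate \<mu>) \<rho> * ev \<mu> \<sigma>)) = 0"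
    using lr_size[of \<kappa> \<eta>] by (intro ballI sum.neutral) fastforce
qed (use assms in \<open>auto simp: finite_psize_le\<close>)

text \<open>
  Summing over \<open>\<kappa>\<close> replaces $\sum_\kappa c^\kappa_{\eta\rho} T_\kappa$ by $T_\eta T_\rho$; the variable \<open>\<rho>\<close> then
  separates, and the sum over \<open>\<eta>\<close> and \<open>\<sigma>\<close> is a convolution.
\<close>

lemma vertex_transfer:
  assumes T: "schur_hom T" "\<And>\<nu>. mord (psize \<nu>) (T \<nu>)"
  shows "msum (\<lambda>\<kappa>. T \<kappa> * mconst (vertex_sum \<mu> \<kappa> \<nu>)) UNIV =
    msum (\<lambda>\<rho>. T \<rho> * mconst (ev (conjugate \<mu>) \<rho>)) UNIV * conv T (\<lambda>\<sigma>. mconst (ev \<mu> \<sigma>)) \<nu>"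
proof (rule mfps_eq_mcong)
  fix K
  let ?P = "partitions_upto K" and ?N = "partitions_upto (psize \<nu>)"
  let ?y = "\<lambda>\<rho>. mconst (ev (conjugate \<mu>) \<rho>)" and ?x = "\<lambda>\<sigma>. mconst (ev \<mu> \<sigma>)"
  have "mcong K (msum (\<lambda>\<kappa>. T \<kappa> * mconst (vertex_sum \<mu> \<kappa> \<nu>)) UNIV) (\<Sum>\<kappa>\<in>?P. T \<kappa> * mconst (vertex_sum \<mu> \<kappa> \<nu>))"
    by (rule msum_mcong_upto) (intro mord_times_left T)
  also have "(\<Sum>\<kappa>\<in>?P. T \<kappa> * mconst (vertex_sum \<mu> \<kappa> \<nu>)) =
      (\<Sum>\<kappa>\<in>?P. \<Sum>\<eta>\<in>?N. \<Sum>\<rho>\<in>?P. \<Sum>\<sigma>\<in>?N.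
         of_int (lr \<nu> \<eta> \<sigma>) * ?y \<rho> * ?x \<sigma> * (of_int (lr \<kappa> \<eta> \<rho>) * T \<kappa>))"
  proof (rule sum.cong[OF refl])
    fix \<kappa> assume "\<kappa> \<in> ?P"
    then have "vertex_sum \<mu> \<kappa> \<nu> = (\<Sum>\<eta>\<in>?N. \<Sum>\<rho>\<in>?P. \<Sum>\<sigma>\<in>?N.
        of_int (lr \<kappa> \<eta> \<rho>) * of_int (lr \<nu> \<eta> \<sigma>) * (ev (conjugate \<mu>) \<rho> * ev \<mu> \<sigma>))"
      by (intro vertex_sum_upto) simp
    then show "T \<kappa> * mconst (vertex_sum \<mu> \<kappa> \<nu>) = (\<Sum>\<eta>\<in>?N. \<Sum>\<rho>\<in>?P. \<Sum>\<sigma>\<in>?N.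
         of_int (lr \<nu> \<eta> \<sigma>) * ?y \<rho> * ?x \<sigma> * (of_int (lr \<kappa> \<eta> \<rho>) * T \<kappa>))"
      by (simp only: mconst_sum mconst_arith(2) mconst_of_int sum_distrib_left) (simp only: mult_ac)
  qed
  also have "\<dots> = (\<Sum>\<eta>\<in>?N. \<Sum>\<rho>\<in>?P. \<Sum>\<sigma>\<in>?N. of_int (lr \<nu> \<eta> \<sigma>) * ?y \<rho> * ?x \<sigma> * (\<Sum>\<kappa>\<in>?P. of_int (lr \<kappa> \<eta> \<rho>) * T \<kappa>))"
    by (subst sum.swap, rule sum.cong[OF refl], subst sum.swap, rule sum.cong[OF refl], subst sum.swap)
       (simp only: sum_distrib_left)
  also have "mcong K \<dots> (\<Sum>\<eta>\<in>?N. \<Sum>\<rho>\<in>?P. \<Sum>\<sigma>\<in>?N. of_int (lr \<nu> \<eta> \<sigma>) * ?y \<rho> * ?x \<sigma> * (T \<eta> * T \<rho>))"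
    by (intro mcong_sum mcong_times mcong_refl mcong_sym[OF schur_hom_mcong[OF T]])
  also have "(\<Sum>\<eta>\<in>?N. \<Sum>\<rho>\<in>?P. \<Sum>\<sigma>\<in>?N. of_int (lr \<nu> \<eta> \<sigma>) * ?y \<rho> * ?x \<sigma> * (T \<eta> * T \<rho>)) =
      (\<Sum>\<rho>\<in>?P. T \<rho> * ?y \<rho>) * conv T ?x \<nu>"
    unfolding conv_def
    by (subst sum.swap) (simp only: sum_distrib_left sum_distrib_right, simp only: mult_ac)
  also have "mcong K \<dots> (msum (\<lambda>\<rho>. T \<rho> * ?y \<rho>) UNIV * conv T ?x \<nu>)"
    by (intro mcong_times mcong_refl mcong_sym[OF msum_mcong_upto] mord_times_left T)
  finally show "mcong K (msum (\<lambda>\<kappa>. T \<kappa> * mconst (vertex_sum \<mu> \<kappa> \<nu>)) UNIV)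
      (msum (\<lambda>\<rho>. T \<rho> * ?y \<rho>) UNIV * conv T ?x \<nu>)" .
qed

text \<open>
  The factor $\mathcal{W}_{\mu^t}$ contributes $q^{-\kappa_\mu/2}$ and transposing \<open>\<nu>\<close> contributes
  $q^{-\kappa_\nu/2}$, which cancel the explicit powers of $q$. The summation index $\rho^3$ is
  replaced by its transpose.
\<close>

lemma W3_vertex_sum:
  "qhalf powi kappa \<nu> * W3 \<kappa> \<mu> (conjugate \<nu>) = W1 \<mu> * vertex_sum \<mu> \<kappa> \<nu>"
proof -
  let ?N = "partitions_upto (psize \<nu>)" and ?K = "partitions_upto (psize \<kappa>)"
  have inner: "Sum_any (\<lambda>\<eta>. lr \<kappa> \<eta> \<rho> * lr \<nu> \<eta> \<sigma>) = (\<Sum>\<eta>\<in>?N. lr \<kappa> \<eta> \<rho> * lr \<nu> \<eta> \<sigma>)" for \<rho> \<sigma>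
    by (rule Sum_any.expand_superset) (use lr_size[of \<nu> _ \<sigma>] in \<open>auto simp: finite_psize_le\<close>)
  have weight: "W2 (conjugate \<mu>) \<rho> * W2 \<mu> \<sigma> / W2 \<mu> empty_partition =
      qhalf powi (- kappa \<mu>) * W1 \<mu> * (ev (conjugate \<mu>) \<rho> * ev \<mu> \<sigma>)" for \<rho> \<sigma>
    by (simp add: W2_def W1_conjugate W1_nz)
  have "W3 \<kappa> \<mu> (conjugate \<nu>) = (\<Sum>(\<rho>, \<sigma>)\<in>?K \<times> ?N.
     of_int (\<Sum>\<eta>\<in>?N. lr \<kappa> \<eta> \<rho> * lr \<nu> \<eta> (conjugate \<sigma>)) * qhalf powi (kappa \<mu> - kappa \<nu>) *
     (qhalf powi (- kappa \<mu>) * W1 \<mu> * (ev (conjugate \<mu>) \<rho> * ev \<mu> (conjugate \<sigma>))))"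
    unfolding W3_def conjugate_conjugate inner weight kappa_conjugate diff_conv_add_uminus[symmetric]
  proof (rule Sum_any.expand_superset)
    show "{p. (case p of (\<rho>, \<sigma>) \<Rightarrow> of_int (\<Sum>\<eta>\<in>?N. lr \<kappa> \<eta> \<rho> * lr \<nu> \<eta> (conjugate \<sigma>)) * qhalf powi (kappa \<mu> - kappa \<nu>) *
     (qhalf powi (- kappa \<mu>) * W1 \<mu> * (ev (conjugate \<mu>) \<rho> * ev \<mu> (conjugate \<sigma>)))) \<noteq> 0} \<subseteq> ?K \<times> ?N"
    proof clarify
      fix \<rho> \<sigma>
      assume "of_int (\<Sum>\<eta>\<in>?N. lr \<kappa> \<eta> \<rho> * lr \<nu> \<eta> (conjugate \<sigma>)) * qhalf powi (kappa \<mu> - kappa \<nu>) *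
        (qhalf powi (- kappa \<mu>) * W1 \<mu> * (ev (conjugate \<mu>) \<rho> * ev \<mu> (conjugate \<sigma>))) \<noteq> 0"
      then have "(\<Sum>\<eta>\<in>?N. lr \<kappa> \<eta> \<rho> * lr \<nu> \<eta> (conjugate \<sigma>)) \<noteq> 0"
        by (rule contrapos_nn) (simp only: of_int_0 mult_zero_left)
      then obtain \<eta> where "lr \<kappa> \<eta> \<rho> * lr \<nu> \<eta> (conjugate \<sigma>) \<noteq> 0" by (meson sum.neutral)
      then show "\<rho> \<in> ?K \<and> \<sigma> \<in> ?N" using lr_size[of \<kappa> \<eta> \<rho>] lr_size[of \<nu> \<eta> "conjugate \<sigma>"] by auto
    qed
  qed (simp add: finite_psize_le)
  also have "\<dots> = (\<Sum>(\<rho>, \<sigma>)\<in>?K \<times> ?N.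
     of_int (\<Sum>\<eta>\<in>?N. lr \<kappa> \<eta> \<rho> * lr \<nu> \<eta> \<sigma>) * qhalf powi (kappa \<mu> - kappa \<nu>) *
     (qhalf powi (- kappa \<mu>) * W1 \<mu> * (ev (conjugate \<mu>) \<rho> * ev \<mu> \<sigma>)))"
    by (rule sum.reindex_bij_witness[of _ "\<lambda>(\<rho>, \<sigma>). (\<rho>, conjugate \<sigma>)" "\<lambda>(\<rho>, \<sigma>). (\<rho>, conjugate \<sigma>)"]) auto
  also have "\<dots> = (\<Sum>\<rho>\<in>?K. \<Sum>\<sigma>\<in>?N. \<Sum>\<eta>\<in>?N.
     qhalf powi (kappa \<mu> - kappa \<nu>) * qhalf powi (- kappa \<mu>) * W1 \<mu> *
     (of_int (lr \<kappa> \<eta> \<rho>) * of_int (lr \<nu> \<eta> \<sigma>) * (ev (conjugate \<mu>) \<rho> * ev \<mu> \<sigma>)))"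
    unfolding sum.cartesian_product[symmetric] of_int_sum of_int_mult sum_distrib_right
    by (simp only: mult_ac)
  also have "\<dots> = qhalf powi (kappa \<mu> - kappa \<nu>) * qhalf powi (- kappa \<mu>) * W1 \<mu> * vertex_sum \<mu> \<kappa> \<nu>"
    unfolding vertex_sum_def sum_distrib_left
    by (subst (2) sum.swap, subst (1) sum.swap, rule sum.cong[OF refl], rule refl)
  also have "qhalf powi (kappa \<mu> - kappa \<nu>) * qhalf powi (- kappa \<mu>) = qhalf powi (- kappa \<nu>)"
    by (subst power_int_add [symmetric]) auto
  finally have "qhalf powi kappa \<nu> * W3 \<kappa> \<mu> (conjugate \<nu>) =
      (qhalf powi kappa \<nu> * qhalf powi (- kappa \<nu>)) * (W1 \<mu> * vertex_sum \<mu> \<kappa> \<nu>)" by (simp only: mult.assoc)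
  also have "qhalf powi kappa \<nu> * qhalf powi (- kappa \<nu>) = 1"
    by (subst power_int_add [symmetric]) auto
  finally show ?thesis by simp
qed

text \<open>
  The amplitude of the partition between vertices $n$ and $n + 1$, normalized to be 1 at the empty
  partition. It is evaluation at the union of the alphabets $q^{\mu^k+\rho}$, $k \le n$, the one of
  \<open>\<mu> k\<close> scaled by $Q_k \cdots Q_n$.
\<close>

fun transfer :: "(nat \<Rightarrow> partition) \<Rightarrow> nat \<Rightarrow> partition \<Rightarrow> (nat, qrat) mfps" where
  "transfer \<mu> 0 \<rho> = (if \<rho> = empty_partition then 1 else 0)"
| "transfer \<mu> (Suc n) \<rho> = mvar (Suc n) ^ psize \<rho> * conv (transfer \<mu> n) (\<lambda>\<sigma>. mconst (ev (\<mu> (Suc n)) \<sigma>)) \<rho>"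

lemma schur_hom_transfer: "schur_hom (transfer \<mu> n)"
proof (induction n)
  case 0
  have "transfer \<mu> 0 = evs undefined 0" by (rule ext) simp
  then show ?case by (simp only: schur_hom_evs)
next
  case (Suc n)
  have "transfer \<mu> (Suc n) = (\<lambda>\<rho>. mvar (Suc n) ^ psize \<rho> * conv (transfer \<mu> n) (\<lambda>\<sigma>. mconst (ev (\<mu> (Suc n)) \<sigma>)) \<rho>)"
    by (rule ext) simp
  then show ?case
    by (simp only:) (intro schur_hom_scale schur_hom_conv Suc schur_hom_mconst schur_hom_eval_rho)
qed

lemma mord_transfer: "mord (psize \<rho>) (transfer \<mu> n \<rho>)"
proof (cases n)
  case 0
  then show ?thesis by (auto simp: mord_def)
next
  case (Suc m)
  then show ?thesis by (auto intro!: mord_times_left mord_power)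
qed

lemma Qprod_Suc: "k \<le> n \<Longrightarrow> Qprod k (Suc n) = Qprod k n * mvar n"
  by (simp add: Qprod_def)

lemma mord_Qprod: "k < l \<Longrightarrow> mord 1 (Qprod k l)"
  by (cases l) (auto simp: Qprod_Suc less_Suc_eq_le intro: mord_times_right)

text \<open>
  The parameter \<open>u\<close> absorbs the variables $Q_{n+1}, \dots$ of later steps in the induction.
\<close>

lemma transfer_cauchy:
  "msum (\<lambda>\<rho>. transfer \<mu> n \<rho> * (u ^ psize \<rho> * mconst (ev \<beta> \<rho>))) UNIV =
     (\<Prod>k=1..n. cauchy (\<mu> k) \<beta> (u * Qprod k (Suc n)))"
proof (induction n arbitrary: u)
  case 0
  have "msum (\<lambda>\<rho>. transfer \<mu> 0 \<rho> * (u ^ psize \<rho> * mconst (ev \<beta> \<rho>))) UNIV =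
      transfer \<mu> 0 empty_partition * (u ^ psize empty_partition * mconst (ev \<beta> empty_partition))"
    by (rule msum_single) auto
  then show ?case by simp
next
  case (Suc n)
  \<comment> \<open>The scaling in \<open>transfer\<close> is moved to the other factor of the Cauchy sum.\<close>
  define w where "w = u * mvar (Suc n)"
  define e where "e \<rho> = w ^ psize \<rho> * mconst (ev \<beta> \<rho>)" for \<rho>
  have w: "mord 1 w" by (simp add: w_def mord_times_right)
  have "schur_hom e" unfolding e_def by (intro schur_hom_scale schur_hom_mconst schur_hom_eval_rho)
  moreover have "mord (psize \<rho>) (e \<rho>)" for \<rho> unfolding e_def by (intro mord_times_left mord_power w)
  ultimately have "msum (\<lambda>\<nu>. conv (transfer \<mu> n) (\<lambda>\<sigma>. mconst (ev (\<mu> (Suc n)) \<sigma>)) \<nu> * e \<nu>) UNIV =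
      msum (\<lambda>\<eta>. transfer \<mu> n \<eta> * e \<eta>) UNIV * msum (\<lambda>\<rho>. mconst (ev (\<mu> (Suc n)) \<rho>) * e \<rho>) UNIV"
    by (rule conv_cauchy)
  also have "msum (\<lambda>\<nu>. conv (transfer \<mu> n) (\<lambda>\<sigma>. mconst (ev (\<mu> (Suc n)) \<sigma>)) \<nu> * e \<nu>) UNIV =
      msum (\<lambda>\<rho>. transfer \<mu> (Suc n) \<rho> * (u ^ psize \<rho> * mconst (ev \<beta> \<rho>))) UNIV"
    by (rule msum_cong) (simp add: e_def w_def power_mult_distrib mult_ac)
  also have "msum (\<lambda>\<eta>. transfer \<mu> n \<eta> * e \<eta>) UNIV = (\<Prod>k=1..n. cauchy (\<mu> k) \<beta> (w * Qprod k (Suc n)))"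
    unfolding e_def by (rule Suc.IH)
  also have "\<dots> = (\<Prod>k=1..n. cauchy (\<mu> k) \<beta> (u * Qprod k (Suc (Suc n))))"
    by (intro prod.cong refl) (simp add: w_def Qprod_Suc[of _ "Suc n"] mult_ac)
  also have "msum (\<lambda>\<rho>. mconst (ev (\<mu> (Suc n)) \<rho>) * e \<rho>) UNIV = cauchy (\<mu> (Suc n)) \<beta> w"
    unfolding cauchy_def e_def by (rule msum_cong) (simp add: mconst_arith mult_ac)
  also have "w = u * Qprod (Suc n) (Suc (Suc n))" by (simp add: w_def Qprod_def)
  finally show ?case by simp
qed

section \<open>The chain of vertices\<close>

text \<open>
  The part of a summand of \<open>Ktilde\<close> that belongs to the first \<open>n\<close> vertices.
\<close>

definition chain_term :: "(nat \<Rightarrow> partition) \<Rightarrow> nat \<Rightarrow> (nat \<Rightarrow> partition) \<Rightarrow> (nat, qrat) mfps" where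
  "chain_term \<mu> n \<nu> = (\<Prod>k=1..n. mconst (qhalf powi kappa (\<nu> k) * W3 (\<nu> (k - 1)) (\<mu> k) (conjugate (\<nu> k))) *
     mvar k ^ psize (\<nu> k))"

definition chains :: "nat \<Rightarrow> (nat \<Rightarrow> partition) set" where
  "chains n = {\<nu>. \<forall>k. k \<notin> {1..n} \<longrightarrow> \<nu> k = empty_partition}"

definition chains_upto :: "nat \<Rightarrow> nat \<Rightarrow> (nat \<Rightarrow> partition) set" where
  "chains_upto K n = {\<nu>\<in>chains n. \<forall>k. psize (\<nu> k) \<le> K}"

lemma finite_chains_upto: "finite (chains_upto K n)"
proof (rule finite_subset)
  show "chains_upto K n \<subseteq> {\<nu>. \<forall>k. (k \<in> {1..n} \<longrightarrow> \<nu> k \<in> partitions_upto K) \<and> (k \<notin> {1..n} \<longrightarrow> \<nu> k = empty_partition)}"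
    unfolding chains_upto_def chains_def by blast
qed (rule finite_set_of_finite_funs; simp add: finite_psize_le)

text \<open>
  A large partition at any place of the chain pushes the summand into high degree, so that truncating
  all places is legitimate.
\<close>

lemma mord_chain_term:
  assumes "k \<in> {1..n}"
  shows "mord (psize (\<nu> k)) (chain_term \<mu> n \<nu>)"
  unfolding chain_term_def prod.remove[OF finite_atLeastAtMost assms]
  by (intro mord_times_left mord_times_right mord_power) simp

lemma chain_msum_mcong:
  "mcong K (msum (\<lambda>\<nu>. chain_term \<mu> n \<nu> * g \<nu>) (chains n)) (\<Sum>\<nu>\<in>chains_upto K n. chain_term \<mu> n \<nu> * g \<nu>)"
proof (rule msum_mcong)
  fix \<nu> assume \<nu>: "\<nu> \<in> chains n" "\<nu> \<notin> chains_upto K n"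
  then obtain k where k: "K < psize (\<nu> k)" by (auto simp: chains_upto_def not_le)
  then have "k \<in> {1..n}" using \<nu>(1) by (force simp: chains_def)
  from mord_times_left[OF mord_chain_term[OF this]] show "mord (Suc K) (chain_term \<mu> n \<nu> * g \<nu>)"
    by (rule mord_mono) (use k in simp)
qed (auto simp: finite_chains_upto, simp add: chains_upto_def)

lemma chain_term_Suc:
  "chain_term \<mu> (Suc n) (\<nu>(Suc n := \<theta>)) = chain_term \<mu> n \<nu> *
    (mconst (W1 (\<mu> (Suc n)) * vertex_sum (\<mu> (Suc n)) (\<nu> n) \<theta>) * mvar (Suc n) ^ psize \<theta>)"
proof -
  have "(\<Prod>k=1..n. mconst (qhalf powi kappa ((\<nu>(Suc n := \<theta>)) k) * W3 ((\<nu>(Suc n := \<theta>)) (k - 1)) (\<mu> k) (conjugate ((\<nu>(Suc n := \<theta>)) k))) *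
     mvar k ^ psize ((\<nu>(Suc n := \<theta>)) k)) = chain_term \<mu> n \<nu>"
    unfolding chain_term_def by (intro prod.cong refl) auto
  then show ?thesis
    unfolding chain_term_def[of \<mu> "Suc n"] by (simp add: W3_vertex_sum)
qed

definition kernel_product :: "(nat \<Rightarrow> partition) \<Rightarrow> nat \<Rightarrow> (nat, qrat) mfps" where
  "kernel_product \<mu> n = (\<Prod>l=1..n. \<Prod>k=1..<l. cauchy (\<mu> k) (conjugate (\<mu> l)) (Qprod k l))"

text \<open>
  The total amplitude with which \<open>\<kappa>\<close> leaves the first \<open>n\<close> vertices: the scalars split off so far, and
  the normalized amplitude.
\<close>

definition chain_amp :: "(nat \<Rightarrow> partition) \<Rightarrow> nat \<Rightarrow> partition \<Rightarrow> (nat, qrat) mfps" where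
  "chain_amp \<mu> n \<kappa> = mconst (\<Prod>k=1..n. W1 (\<mu> k)) * kernel_product \<mu> n * transfer \<mu> n \<kappa>"

lemma msum_const_times:
  assumes "\<And>\<rho>. mord (psize \<rho>) (F \<rho>)"
  shows "msum (\<lambda>\<rho>. c * F \<rho>) UNIV = c * msum F UNIV"
proof (rule mfps_eq_mcong)
  fix K
  have "mcong K (msum (\<lambda>\<rho>. c * F \<rho>) UNIV) (\<Sum>\<rho>\<in>partitions_upto K. c * F \<rho>)"
    by (rule msum_mcong_upto) (intro mord_times_right assms)
  also have "(\<Sum>\<rho>\<in>partitions_upto K. c * F \<rho>) = c * (\<Sum>\<rho>\<in>partitions_upto K. F \<rho>)"
    by (simp add: sum_distrib_left)
  also have "mcong K \<dots> (c * msum F UNIV)"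
    by (intro mcong_times mcong_refl mcong_sym[OF msum_mcong_upto] assms)
  finally show "mcong K (msum (\<lambda>\<rho>. c * F \<rho>) UNIV) (c * msum F UNIV)" .
qed

lemma chain_amp_vertex:
  "msum (\<lambda>\<kappa>. chain_amp \<mu> n \<kappa> * mconst (W1 (\<mu> (Suc n)) * vertex_sum (\<mu> (Suc n)) \<kappa> \<nu>)) UNIV =
    mconst (\<Prod>k=1..Suc n. W1 (\<mu> k)) * kernel_product \<mu> (Suc n) *
    conv (transfer \<mu> n) (\<lambda>\<sigma>. mconst (ev (\<mu> (Suc n)) \<sigma>)) \<nu>"
proof -
  let ?c = "mconst (\<Prod>k=1..Suc n. W1 (\<mu> k)) * kernel_product \<mu> n"
  have "msum (\<lambda>\<kappa>. chain_amp \<mu> n \<kappa> * mconst (W1 (\<mu> (Suc n)) * vertex_sum (\<mu> (Suc n)) \<kappa> \<nu>)) UNIV =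
      msum (\<lambda>\<kappa>. ?c * (transfer \<mu> n \<kappa> * mconst (vertex_sum (\<mu> (Suc n)) \<kappa> \<nu>))) UNIV"
    by (rule msum_cong) (simp add: chain_amp_def mconst_arith mult_ac)
  also have "\<dots> = ?c * msum (\<lambda>\<kappa>. transfer \<mu> n \<kappa> * mconst (vertex_sum (\<mu> (Suc n)) \<kappa> \<nu>)) UNIV"
    by (rule msum_const_times) (intro mord_times_left mord_transfer)
  also have "msum (\<lambda>\<kappa>. transfer \<mu> n \<kappa> * mconst (vertex_sum (\<mu> (Suc n)) \<kappa> \<nu>)) UNIV =
      msum (\<lambda>\<rho>. transfer \<mu> n \<rho> * mconst (ev (conjugate (\<mu> (Suc n))) \<rho>)) UNIV *
      conv (transfer \<mu> n) (\<lambda>\<sigma>. mconst (ev (\<mu> (Suc n)) \<sigma>)) \<nu>"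
    by (rule vertex_transfer[OF schur_hom_transfer mord_transfer])
  also have "msum (\<lambda>\<rho>. transfer \<mu> n \<rho> * mconst (ev (conjugate (\<mu> (Suc n))) \<rho>)) UNIV =
      (\<Prod>k=1..n. cauchy (\<mu> k) (conjugate (\<mu> (Suc n))) (Qprod k (Suc n)))"
    using transfer_cauchy[of \<mu> n 1 "conjugate (\<mu> (Suc n))"] by simp
  finally show ?thesis
    by (simp add: kernel_product_def atLeastLessThanSuc_atLeastAtMost mult_ac)
qed

text \<open>
  Summation over all chains with a weight \<open>g\<close> on the last partition, by induction on the length; the
  vertex attached in the next step is absorbed into the weight.
\<close>

lemma chain_sum:
  "msum (\<lambda>\<nu>. chain_term \<mu> n \<nu> * g (\<nu> n)) (chains n) = msum (\<lambda>\<kappa>. chain_amp \<mu> n \<kappa> * g \<kappa>) UNIV"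
proof (induction n arbitrary: g)
  case 0
  have c0: "chains 0 = {\<lambda>_. empty_partition}" by (auto simp: chains_def fun_eq_iff)
  have "msum (\<lambda>\<nu>. chain_term \<mu> 0 \<nu> * g (\<nu> 0)) (chains 0) = g empty_partition"
    using msum_single[of "\<lambda>_. empty_partition" "chains 0" "\<lambda>\<nu>. chain_term \<mu> 0 \<nu> * g (\<nu> 0)"]
    by (simp add: c0 chain_term_def)
  moreover have "msum (\<lambda>\<kappa>. chain_amp \<mu> 0 \<kappa> * g \<kappa>) UNIV = chain_amp \<mu> 0 empty_partition * g empty_partition"
    by (rule msum_single) (auto simp: chain_amp_def)
  ultimately show ?case by (simp add: chain_amp_def kernel_product_def)
next
  case (Suc n)
  show ?case
  proof (rule mfps_eq_mcong)
    fix K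
    let ?B = "\<lambda>\<kappa> \<nu>. mconst (W1 (\<mu> (Suc n)) * vertex_sum (\<mu> (Suc n)) \<kappa> \<nu>)"
    let ?Q = "\<lambda>\<nu>. mvar (Suc n) ^ psize \<nu> * g \<nu>"
    have "mcong K (msum (\<lambda>\<nu>. chain_term \<mu> (Suc n) \<nu> * g (\<nu> (Suc n))) (chains (Suc n)))
        (\<Sum>\<nu>\<in>chains_upto K (Suc n). chain_term \<mu> (Suc n) \<nu> * g (\<nu> (Suc n)))"
      by (rule chain_msum_mcong)
    also have "(\<Sum>\<nu>\<in>chains_upto K (Suc n). chain_term \<mu> (Suc n) \<nu> * g (\<nu> (Suc n))) =
        (\<Sum>(\<theta>, \<nu>)\<in>partitions_upto K \<times> chains_upto K n. ?Q \<theta> * (chain_term \<mu> n \<nu> * ?B (\<nu> n) \<theta>))"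
    proof (rule sum.reindex_bij_witness[where i = "\<lambda>(\<theta>, \<nu>). \<nu>(Suc n := \<theta>)"
          and j = "\<lambda>\<nu>. (\<nu> (Suc n), \<nu>(Suc n := empty_partition))"], goal_cases)
      case (2 \<nu>)
      then show ?case by (auto simp: chains_upto_def chains_def le_Suc_eq)
    next
      case (3 p)
      then show ?case by (auto simp: chains_upto_def chains_def fun_eq_iff)
    next
      case (4 p)
      then show ?case by (auto simp: chains_upto_def chains_def)
    next
      case (5 \<nu>)
      have "chain_term \<mu> (Suc n) \<nu> = chain_term \<mu> (Suc n) ((\<nu>(Suc n := empty_partition))(Suc n := \<nu> (Suc n)))"
        by simp
      then show ?case unfolding chain_term_Suc by (simp add: mult_ac)
    qed simp
    also have "\<dots> = (\<Sum>\<theta>\<in>partitions_upto K. ?Q \<theta> * (\<Sum>\<nu>\<in>chains_upto K n. chain_term \<mu> n \<nu> * ?B (\<nu> n) \<theta>))"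
      by (simp only: sum.cartesian_product[symmetric] sum_distrib_left)
    also have "mcong K \<dots> (\<Sum>\<theta>\<in>partitions_upto K. ?Q \<theta> * msum (\<lambda>\<nu>. chain_term \<mu> n \<nu> * ?B (\<nu> n) \<theta>) (chains n))"
      by (intro mcong_sum mcong_times mcong_refl mcong_sym[OF chain_msum_mcong])
    also have "(\<Sum>\<theta>\<in>partitions_upto K. ?Q \<theta> * msum (\<lambda>\<nu>. chain_term \<mu> n \<nu> * ?B (\<nu> n) \<theta>) (chains n)) =
        (\<Sum>\<theta>\<in>partitions_upto K. chain_amp \<mu> (Suc n) \<theta> * g \<theta>)"
    proof (rule sum.cong[OF refl])
      fix \<theta>
      have "msum (\<lambda>\<nu>. chain_term \<mu> n \<nu> * ?B (\<nu> n) \<theta>) (chains n) = msum (\<lambda>\<kappa>. chain_amp \<mu> n \<kappa> * ?B \<kappa> \<theta>) UNIV"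
        by (rule Suc.IH)
      then show "?Q \<theta> * msum (\<lambda>\<nu>. chain_term \<mu> n \<nu> * ?B (\<nu> n) \<theta>) (chains n) = chain_amp \<mu> (Suc n) \<theta> * g \<theta>"
        unfolding chain_amp_vertex by (simp add: chain_amp_def mult_ac)
    qed
    also have "mcong K \<dots> (msum (\<lambda>\<kappa>. chain_amp \<mu> (Suc n) \<kappa> * g \<kappa>) UNIV)"
      unfolding chain_amp_def
      by (intro mcong_sym[OF msum_mcong_upto] mord_times_left mord_times_right mord_transfer)
    finally show "mcong K (msum (\<lambda>\<nu>. chain_term \<mu> (Suc n) \<nu> * g (\<nu> (Suc n))) (chains (Suc n)))
        (msum (\<lambda>\<kappa>. chain_amp \<mu> (Suc n) \<kappa> * g \<kappa>) UNIV)" .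
  qed
qed

text \<open>
  The last vertex has an empty outgoing partition and no variable; the normalized amplitude there is 1.
\<close>

lemma Ktilde_kernel_product:
  assumes "N \<ge> 1"
  shows "Ktilde N \<mu> = mconst (\<Prod>k=1..N. W1 (\<mu> k)) * kernel_product \<mu> N"
proof -
  obtain n where N: "N = Suc n" using assms by (cases N) auto
  have I: "{\<nu>. \<forall>k. k \<notin> {1..<N} \<longrightarrow> \<nu> k = empty_partition} = chains n"
    by (simp add: chains_def N atLeastLessThanSuc_atLeastAtMost)
  have "Ktilde N \<mu> = msum (\<lambda>\<nu>. chain_term \<mu> n \<nu> * mconst (W1 (\<mu> N) * vertex_sum (\<mu> N) (\<nu> n) empty_partition)) (chains n)"
    unfolding Ktilde_def I
  proof (rule msum_cong)
    fix \<nu> assume "\<nu> \<in> chains n"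
    then have e: "\<nu> (Suc n) = empty_partition" by (simp add: chains_def)
    have "(\<Prod>k=1..n. mconst (qhalf powi kappa (\<nu> k) * W3 (\<nu> (k - 1)) (\<mu> k) (conjugate (\<nu> k))) *
         (if k = N then 1 else mvar k) ^ psize (\<nu> k)) = chain_term \<mu> n \<nu>"
      unfolding chain_term_def by (intro prod.cong refl) (auto simp: N)
    then show "(\<Prod>k=1..N. mconst (qhalf powi kappa (\<nu> k) * W3 (\<nu> (k - 1)) (\<mu> k) (conjugate (\<nu> k))) *
         (if k = N then 1 else mvar k) ^ psize (\<nu> k)) =
        chain_term \<mu> n \<nu> * mconst (W1 (\<mu> N) * vertex_sum (\<mu> N) (\<nu> n) empty_partition)"
      unfolding W3_vertex_sum by (simp add: N e)
  qed
  also have "\<dots> = msum (\<lambda>\<kappa>. chain_amp \<mu> n \<kappa> * mconst (W1 (\<mu> N) * vertex_sum (\<mu> N) \<kappa> empty_partition)) UNIV"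
    by (rule chain_sum)
  also have "\<dots> = mconst (\<Prod>k=1..N. W1 (\<mu> k)) * kernel_product \<mu> N *
      conv (transfer \<mu> n) (\<lambda>\<sigma>. mconst (ev (\<mu> (Suc n)) \<sigma>)) empty_partition"
    unfolding N by (rule chain_amp_vertex)
  also have "conv (transfer \<mu> n) (\<lambda>\<sigma>. mconst (ev (\<mu> (Suc n)) \<sigma>)) empty_partition = 1"
    by (intro schur_hom_empty schur_hom_conv schur_hom_transfer schur_hom_mconst schur_hom_eval_rho)
  finally show ?thesis by simp
qed

theorem theorem8p1:
  fixes N :: nat and \<mu> :: "nat \<Rightarrow> partition"
  assumes "N \<ge> 2"
  shows "Ktilde N \<mu> / (\<Prod>(k, l) | 1 \<le> k \<and> k < l \<and> l \<le> N. K00 (Qprod k l)) =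
      mconst (\<Prod>k=1..N. W1 (\<mu> k)) *
      mexp (\<Sum>(k, l) | 1 \<le> k \<and> k < l \<and> l \<le> N.
        msum (\<lambda>n. mconst (f_at (\<mu> k) (conjugate (\<mu> l)) n / of_nat n) * Qprod k l ^ n) {1..}) \<and>
      mconst (\<Prod>k=1..N. W1 (\<mu> k)) *
      mexp (\<Sum>(k, l) | 1 \<le> k \<and> k < l \<and> l \<le> N.
        msum (\<lambda>n. mconst (f_at (\<mu> k) (conjugate (\<mu> l)) n / of_nat n) * Qprod k l ^ n) {1..}) =
      mconst (\<Prod>k=1..N. W1 (\<mu> k)) *
      (\<Prod>(k, l) | 1 \<le> k \<and> k < l \<and> l \<le> N.
        Prod_any (\<lambda>n. (1 - mconst (qhalf powi (2 * n)) * Qprod k l)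
          powi (- f_coeff n (\<mu> k) (conjugate (\<mu> l)))))"
proof -
  let ?I = "{(k, l). 1 \<le> k \<and> k < l \<and> l \<le> N}"
  let ?W = "mconst (\<Prod>k=1..N. W1 (\<mu> k)) :: (nat, qrat) mfps"
  define E where "E k l = mexp (psub (Qprod k l) (log_fps (f_at (\<mu> k) (conjugate (\<mu> l)))))" for k l
  have Q: "mord 1 (Qprod k l)" if "(k, l) \<in> ?I" for k l using that by (intro mord_Qprod) auto
  have ex: "mexp (\<Sum>(k, l)\<in>?I. msum (\<lambda>n. mconst (f_at (\<mu> k) (conjugate (\<mu> l)) n / of_nat n) * Qprod k l ^ n) {1..}) =
      (\<Prod>(k, l)\<in>?I. E k l)"
    unfolding msum_log E_def case_prod_unfold
  proof (rule mexp_sum, rule mord_log)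
    fix p assume "p \<in> {p. 1 \<le> fst p \<and> fst p < snd p \<and> snd p \<le> N}"
    then show "mord 1 (Qprod (fst p) (snd p))" by (intro mord_Qprod) simp
  qed
  have "kernel_product \<mu> N = (\<Prod>(k, l)\<in>?I. cauchy (\<mu> k) (conjugate (\<mu> l)) (Qprod k l))"
  proof -
    have "kernel_product \<mu> N = (\<Prod>(l, k)\<in>(SIGMA l:{1..N}. {1..<l}). cauchy (\<mu> k) (conjugate (\<mu> l)) (Qprod k l))"
      unfolding kernel_product_def by (rule prod.Sigma) auto
    also have "\<dots> = (\<Prod>(k, l)\<in>?I. cauchy (\<mu> k) (conjugate (\<mu> l)) (Qprod k l))"
      by (rule prod.reindex_bij_witness[of _ prod.swap prod.swap]) auto
    finally show ?thesis .
  qed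
  also have "\<dots> = (\<Prod>(k, l)\<in>?I. K00 (Qprod k l) * E k l)"
    unfolding E_def by (intro prod.cong refl) (auto intro!: cauchy_K00 mord_Qprod)
  finally have kp: "kernel_product \<mu> N = (\<Prod>(k, l)\<in>?I. K00 (Qprod k l)) * (\<Prod>(k, l)\<in>?I. E k l)"
    by (simp add: case_prod_unfold prod.distrib)
  have "\<exists>g. (\<Prod>p\<in>?I. K00 (Qprod (fst p) (snd p))) * g = 1"
  proof -
    have "\<forall>p\<in>?I. \<exists>g. K00 (Qprod (fst p) (snd p)) * g = 1"
      by (intro ballI K00_unit Q) (simp only: prod.collapse)
    then obtain g where "\<forall>p\<in>?I. K00 (Qprod (fst p) (snd p)) * g p = 1"
      unfolding bchoice_iff by (rule exE)
    then have "(\<Prod>p\<in>?I. K00 (Qprod (fst p) (snd p)) * g p) = 1" by (intro prod.neutral) auto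
    then show ?thesis unfolding prod.distrib by blast
  qed
  then obtain g where g: "(\<Prod>(k, l)\<in>?I. K00 (Qprod k l)) * g = 1" by (auto simp: case_prod_unfold)
  have "Ktilde N \<mu> / (\<Prod>(k, l)\<in>?I. K00 (Qprod k l)) = Ktilde N \<mu> * g"
    by (simp only: divide_mfps_def inverse_mfps_eq[OF g])
  also have "\<dots> = ?W * (((\<Prod>(k, l)\<in>?I. K00 (Qprod k l)) * g) * (\<Prod>(k, l)\<in>?I. E k l))"
    using assms by (simp add: Ktilde_kernel_product kp mult_ac)
  also have "\<dots> = ?W * (\<Prod>(k, l)\<in>?I. E k l)" by (simp only: g mult_1_left)
  finally have 1: "Ktilde N \<mu> / (\<Prod>(k, l)\<in>?I. K00 (Qprod k l)) = ?W * (\<Prod>(k, l)\<in>?I. E k l)" .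
  have 2: "(\<Prod>(k, l)\<in>?I. E k l) = (\<Prod>(k, l)\<in>?I. Prod_any (\<lambda>n. (1 - mconst (qhalf powi (2 * n)) * Qprod k l)
          powi (- f_coeff n (\<mu> k) (conjugate (\<mu> l)))))"
    unfolding E_def by (intro prod.cong refl) (auto intro!: mexp_f_at_product mord_Qprod)
  show ?thesis unfolding ex 1 2 by simp
qed

end
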